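(* Let $p$ be an odd prime and $G$ a finite non-abelian $p$-group with cyclic center. If $C_G(\gamma_3(G)G^p)\not\le\gamma_3(G)G^p$, then $G$ has a non-inner automorphism of order $p$.
   Context: $\gamma_3(G)$ is the third term of the lower central series and $G^p=\langle g^p:g\in G\rangle$. *)

theory Defs
  imports "HOL-Algebra.Algebra"
begin

definition grp_center :: "('a, 'b) monoid_scheme \<Rightarrow> 'a set" where
  "grp_center G = {z \<in> carrier G. \<forall>g \<in> carrier G. z \<otimes>\<^bsub>G\<^esub> g = g \<otimes>\<^bsub>G\<^esub> z}"

definition grp_centralizer :: "('a, 'b) monoid_scheme \<Rightarrow> 'a set \<Rightarrow> 'a set" where
  "grp_centralizer G H = {g \<in> carrier G. \<forall>h \<in> H. g \<otimes>\<^bsub>G\<^esub> h = h \<otimes>\<^bsub>G\<^esub> g}"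

definition commutator_subgroup :: "('a, 'b) monoid_scheme \<Rightarrow> 'a set \<Rightarrow> 'a set \<Rightarrow> 'a set" where
  "commutator_subgroup G A B = generate G
     (\<Union>a \<in> A. \<Union>b \<in> B. {a \<otimes>\<^bsub>G\<^esub> b \<otimes>\<^bsub>G\<^esub> inv\<^bsub>G\<^esub> a \<otimes>\<^bsub>G\<^esub> inv\<^bsub>G\<^esub> b})"

fun lower_central :: "('a, 'b) monoid_scheme \<Rightarrow> nat \<Rightarrow> 'a set" where
  "lower_central G 0 = carrier G"
| "lower_central G (Suc 0) = carrier G"
| "lower_central G (Suc (Suc n)) = commutator_subgroup G (lower_central G (Suc n)) (carrier G)"

definition power_subgroup :: "('a, 'b) monoid_scheme \<Rightarrow> nat \<Rightarrow> 'a set" where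
  "power_subgroup G p = generate G {g [^]\<^bsub>G\<^esub> p | g. g \<in> carrier G}"

definition p_group :: "('a, 'b) monoid_scheme \<Rightarrow> nat \<Rightarrow> bool" where
  "p_group G p \<longleftrightarrow> finite (carrier G) \<and> (\<exists>n. card (carrier G) = p ^ n)"

definition inner_automorphism :: "('a, 'b) monoid_scheme \<Rightarrow> ('a \<Rightarrow> 'a) \<Rightarrow> bool" where
  "inner_automorphism G \<phi> \<longleftrightarrow>
     (\<exists>g \<in> carrier G. \<forall>x \<in> carrier G. \<phi> x = g \<otimes>\<^bsub>G\<^esub> x \<otimes>\<^bsub>G\<^esub> inv\<^bsub>G\<^esub> g)"

end

theory Submission
  imports Defs "HOL-Number_Theory.Cong"
begin

text \<open>
  Suppose that every automorphism of order \<open>p\<close> is inner. Let \<open>z\<close> have order \<open>p\<close> in the cyclic centre, let \<open>\<Phi>\<close> be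
  the Frattini subgroup, \<open>N = \<gamma>\<^sub>3(G)G^p\<close> and \<open>C = C\<^sub>G(N)\<close>. A functional \<open>l\<close> with \<open>l z = 1\<close> on an elementary abelian
  normal subgroup \<open>A\<close> embeds \<open>A\<close> into the functions from \<open>G\<close> to the prime field by \<open>a \<mapsto> (x \<mapsto> l (x^-1 a x))\<close>. A
  function \<open>F\<close> all of whose differences \<open>x \<mapsto> F (g x) - F x\<close> are in the image of \<open>A\<close> defines a crossed homomorphism
  \<open>G \<rightarrow> A\<close>, hence an automorphism of order \<open>p\<close>, hence an element of \<open>G\<close> whose commutators are prescribed by \<open>F\<close>.

  Functions that are linear on \<open>G/\<Phi>\<close> and their squares give \<open>C\<^sub>G(\<Phi>) \<le> \<Phi>\<close>. Since \<open>G/N\<close> has class two and exponent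
  \<open>p\<close>, each homomorphism from \<open>\<Phi>/N\<close> extends to a quadratic function on \<open>G\<close>; so for \<open>x \<in> \<Phi> - N\<close> there is \<open>w \<in> C\<close> with
  \<open>[w, x] = z\<close>. The product of the quadratic function of such a \<open>w\<close>, if \<open>w\<close> has order \<open>p\<close>, with a linear function is a
  cubic function; it yields \<open>w \<in> [C, G] Z(C)\<close>, so that \<open>w\<close> centralizes \<open>C\<close> when \<open>C \<le> \<Phi>\<close>. For \<open>x \<in> C - N\<close> this
  is a contradiction, once \<open>w\<close> has been given order \<open>p\<close>: as the centre is cyclic, one element whose \<open>p\<close>-th power is
  not the \<open>p\<close>-th power of a central element suffices to correct all others.
\<close>

section \<open>Commutators and crossed homomorphisms\<close>

text \<open>The functions from \<open>G\<close> to the prime field form a coinduced module, in which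
  every crossed homomorphism is the difference of a function. Looking for functions instead of
  crossed homomorphisms therefore loses nothing, and it turns the search into one for polynomial
  functions of growing degree.

  An element produced in one degree can be used in the next only if it has order \<open>p\<close>,
  since it must be adjoined to the elementary abelian \<open>A\<close>. The construction only makes
  its \<open>p\<close>-th power central, and this obstacle shapes the proof: the homomorphisms, and
  later the products of homomorphisms, that come from elements of order \<open>p\<close> may form a
  proper subspace. Because the centre is cyclic, the codimension is at most one. A single
  representative then accounts for everything that is missing, and an auxiliary function
  \<open>q\<close> built from it cancels the missing terms. The case distinctions ask how
  \<open>q\<close> can be built: it must be invariant under \<open>Phi\<close>, in the cubic step
  also under \<open>C\<close>, and its own differences must create no new obstruction.\<close>

context group
begin

lemma inv_l_cancel: "x \<in> carrier G \<Longrightarrow> y \<in> carrier G \<Longrightarrow> inv x \<otimes> (x \<otimes> y) = y"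
  by (simp add: m_assoc[symmetric])

lemma inv_r_cancel: "x \<in> carrier G \<Longrightarrow> y \<in> carrier G \<Longrightarrow> x \<otimes> (inv x \<otimes> y) = y"
  by (simp add: m_assoc[symmetric])

lemmas group_word = m_assoc inv_mult_group inv_l_cancel inv_r_cancel

definition cj :: "'a \<Rightarrow> 'a \<Rightarrow> 'a" where
  "cj h a = inv h \<otimes> a \<otimes> h"

text \<open>The automorphism \<open>g \<mapsto> y g y^-1\<close> is \<open>g \<mapsto> g * kap y g\<close>; so \<open>kap y\<close> is the crossed homomorphism
  belonging to conjugation by \<open>y\<close>, and \<open>kap y g\<close> is the commutator of \<open>g^-1\<close> and \<open>y\<close>.\<close>

definition kap :: "'a \<Rightarrow> 'a \<Rightarrow> 'a" where
  "kap y g = inv g \<otimes> y \<otimes> g \<otimes> inv y"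

lemma cj_closed [simp]: "h \<in> carrier G \<Longrightarrow> a \<in> carrier G \<Longrightarrow> cj h a \<in> carrier G"
  by (simp add: cj_def)

lemma kap_closed [simp]: "y \<in> carrier G \<Longrightarrow> g \<in> carrier G \<Longrightarrow> kap y g \<in> carrier G"
  by (simp add: kap_def)

lemma cj_one [simp]: "h \<in> carrier G \<Longrightarrow> cj h \<one> = \<one>" "a \<in> carrier G \<Longrightarrow> cj \<one> a = a"
  by (simp_all add: cj_def)

lemma cj_mult: "h \<in> carrier G \<Longrightarrow> a \<in> carrier G \<Longrightarrow> b \<in> carrier G \<Longrightarrow> cj h (a \<otimes> b) = cj h a \<otimes> cj h b"
  by (simp add: cj_def group_word)

lemma cj_cj: "h \<in> carrier G \<Longrightarrow> g \<in> carrier G \<Longrightarrow> a \<in> carrier G \<Longrightarrow> cj h (cj g a) = cj (g \<otimes> h) a"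
  by (simp add: cj_def group_word)

lemma cj_inv: "h \<in> carrier G \<Longrightarrow> a \<in> carrier G \<Longrightarrow> cj h (inv a) = inv (cj h a)"
  by (simp add: cj_def group_word)

lemma cj_pow: "h \<in> carrier G \<Longrightarrow> a \<in> carrier G \<Longrightarrow> cj h (a [^] (n::nat)) = cj h a [^] n"
  by (induction n) (simp_all add: cj_mult)

lemma cj_int_pow: "h \<in> carrier G \<Longrightarrow> a \<in> carrier G \<Longrightarrow> cj h (a [^] (n::int)) = cj h a [^] n"
  by (cases n rule: int_cases2) (simp_all add: cj_inv cj_pow int_pow_int int_pow_neg_int)

lemma cj_comm: "h \<in> carrier G \<Longrightarrow> a \<in> carrier G \<Longrightarrow> cj h a = a \<longleftrightarrow> a \<otimes> h = h \<otimes> a"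
  by (simp add: cj_def m_assoc inv_solve_left' eq_commute[of a])

lemma cj_eq_kap: "y \<in> carrier G \<Longrightarrow> g \<in> carrier G \<Longrightarrow> cj g y = kap y g \<otimes> y"
  by (simp add: cj_def kap_def group_word)

lemma kap_eq_one: "y \<in> carrier G \<Longrightarrow> g \<in> carrier G \<Longrightarrow> kap y g = \<one> \<longleftrightarrow> y \<otimes> g = g \<otimes> y"
  by (simp add: cj_comm[symmetric] cj_eq_kap)

lemma kap_mult_right:
  "y \<in> carrier G \<Longrightarrow> g \<in> carrier G \<Longrightarrow> h \<in> carrier G \<Longrightarrow> kap y (g \<otimes> h) = cj h (kap y g) \<otimes> kap y h"
  by (simp add: cj_def kap_def group_word)

lemma kap_mult_left:
  "x \<in> carrier G \<Longrightarrow> y \<in> carrier G \<Longrightarrow> g \<in> carrier G \<Longrightarrow>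
   kap (x \<otimes> y) g = kap x g \<otimes> (x \<otimes> kap y g \<otimes> inv x)"
  by (simp add: kap_def group_word)

lemma kap_inv:
  "y \<in> carrier G \<Longrightarrow> g \<in> carrier G \<Longrightarrow> kap y g = inv g \<otimes> y \<otimes> inv (inv g) \<otimes> inv y"
  by (simp add: kap_def)

lemma comm_inv: "a \<in> carrier G \<Longrightarrow> b \<in> carrier G \<Longrightarrow> a \<otimes> b = b \<otimes> a \<Longrightarrow> inv a \<otimes> b = b \<otimes> inv a"
  by (simp add: inv_solve_left' m_assoc[symmetric]) (simp add: m_assoc)

lemma comm_mult:
  "a \<in> carrier G \<Longrightarrow> b \<in> carrier G \<Longrightarrow> c \<in> carrier G \<Longrightarrow> a \<otimes> c = c \<otimes> a \<Longrightarrow> b \<otimes> c = c \<otimes> b \<Longrightarrow>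
   (a \<otimes> b) \<otimes> c = c \<otimes> (a \<otimes> b)"
  by (metis m_assoc)

lemma comm_pow:
  "a \<in> carrier G \<Longrightarrow> b \<in> carrier G \<Longrightarrow> a \<otimes> b = b \<otimes> a \<Longrightarrow> a [^] (n::nat) \<otimes> b = b \<otimes> a [^] n"
  by (induction n) (simp_all add: comm_mult)

lemma comm_int_pow:
  "a \<in> carrier G \<Longrightarrow> b \<in> carrier G \<Longrightarrow> a \<otimes> b = b \<otimes> a \<Longrightarrow> a [^] (n::int) \<otimes> b = b \<otimes> a [^] n"
  by (cases n rule: int_cases2) (simp_all add: comm_pow comm_inv int_pow_int int_pow_neg_int)

lemma centralizer_subgroup: "H \<subseteq> carrier G \<Longrightarrow> subgroup (grp_centralizer G H) G"
  by (intro subgroupI) (auto simp: grp_centralizer_def subset_iff intro!: comm_mult comm_inv)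

lemma center_subgroup: "subgroup (grp_center G) G"
proof -
  have "grp_center G = grp_centralizer G (carrier G)" by (simp add: grp_center_def grp_centralizer_def)
  then show ?thesis using centralizer_subgroup[of "carrier G"] by simp
qed

text \<open>Sorting the factors moves each \<open>y\<close> past the \<open>x\<close>'s to its
  right, at the price of one \<open>k\<close> per exchange, hence \<open>n choose 2\<close> in all.
  For odd \<open>p\<close> the exponent \<open>p choose 2\<close> is a multiple of \<open>p\<close>,
  so that \<open>p\<close>-th powers multiply when \<open>k\<close> has order
  \<open>p\<close>.\<close>

lemma pow_mult_class2:
  assumes x: "x \<in> carrier G" and y: "y \<in> carrier G" and k: "k \<in> carrier G"
    and yx: "y \<otimes> x = x \<otimes> y \<otimes> k" and kx: "k \<otimes> x = x \<otimes> k" and ky: "k \<otimes> y = y \<otimes> k"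
  shows "(x \<otimes> y) [^] (n::nat) = x [^] n \<otimes> y [^] n \<otimes> k [^] (n choose 2)"
proof -
  have yn: "y [^] n \<otimes> x = x \<otimes> y [^] n \<otimes> k [^] n" for n :: nat
  proof (induction n)
    case (Suc n)
    have "y [^] Suc n \<otimes> x = y [^] n \<otimes> (x \<otimes> y \<otimes> k)"
      using x y k by (simp add: m_assoc yx)
    also have "\<dots> = (y [^] n \<otimes> x) \<otimes> (y \<otimes> k)" using x y k by (simp add: m_assoc)
    also have "\<dots> = x \<otimes> y [^] n \<otimes> (k [^] n \<otimes> y) \<otimes> k" using x y k by (simp add: m_assoc Suc)
    also have "\<dots> = x \<otimes> y [^] n \<otimes> (y \<otimes> k [^] n) \<otimes> k" using comm_pow[OF k y ky] by simp
    finally show ?case using x y k by (simp add: m_assoc)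
  qed (use x in simp)
  show ?thesis
  proof (induction n)
    case (Suc n)
    let ?K = "k [^] (n choose 2)"
    have "(x \<otimes> y) [^] Suc n = x [^] n \<otimes> y [^] n \<otimes> (?K \<otimes> (x \<otimes> y))"
      using x y k by (simp add: m_assoc Suc)
    also have "?K \<otimes> (x \<otimes> y) = (x \<otimes> y) \<otimes> ?K"
      using comm_pow[of k "x \<otimes> y" "n choose 2"] comm_mult[of x y k] x y k kx ky by simp
    also have "x [^] n \<otimes> y [^] n \<otimes> ((x \<otimes> y) \<otimes> ?K) = x [^] n \<otimes> (y [^] n \<otimes> x) \<otimes> (y \<otimes> ?K)"
      using x y k by (simp add: m_assoc)
    also have "\<dots> = x [^] n \<otimes> x \<otimes> y [^] n \<otimes> (k [^] n \<otimes> y) \<otimes> ?K"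
      using x y k by (simp add: m_assoc yn)
    also have "k [^] n \<otimes> y = y \<otimes> k [^] n" using comm_pow[OF k y ky] by simp
    also have "x [^] n \<otimes> x \<otimes> y [^] n \<otimes> (y \<otimes> k [^] n) \<otimes> ?K = x [^] Suc n \<otimes> y [^] Suc n \<otimes> (k [^] n \<otimes> ?K)"
      using x y k by (simp add: m_assoc)
    also have "k [^] n \<otimes> ?K = k [^] (Suc n choose 2)"
      using k by (simp add: nat_pow_mult numeral_2_eq_2)
    finally show ?case .
  qed (simp add: numeral_2_eq_2)
qed

text \<open>The rule for products makes \<open>g \<mapsto> g \<otimes> \<delta> g\<close> an
  endomorphism. As \<open>\<delta>\<close> is trivial on its own values, the \<open>k\<close>-th
  iterate is \<open>g \<mapsto> g \<otimes> \<delta> g [^] k\<close>, so that the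
  \<open>p\<close>-th iterate is the identity. This yields bijectivity and the order at
  once.\<close>

lemma auto_of_crossed_hom:
  fixes p :: nat
  assumes fin: "finite (carrier G)" and p: "Factorial_Ring.prime p"
    and noninn: "\<And>\<phi>. \<phi> \<in> auto G \<Longrightarrow> group.ord (AutoGroup G) \<phi> = p \<Longrightarrow> inner_automorphism G \<phi>"
    and d: "\<And>g. g \<in> carrier G \<Longrightarrow> \<delta> g \<in> carrier G"
    and dm: "\<And>g h. g \<in> carrier G \<Longrightarrow> h \<in> carrier G \<Longrightarrow> \<delta> (g \<otimes> h) = cj h (\<delta> g) \<otimes> \<delta> h"
    and dp: "\<And>g. g \<in> carrier G \<Longrightarrow> \<delta> g [^] p = \<one>"
    and dd: "\<And>g. g \<in> carrier G \<Longrightarrow> \<delta> (\<delta> g) = \<one>"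
  shows "\<exists>y \<in> carrier G. \<forall>g \<in> carrier G. \<delta> g = kap y g"
proof (cases "\<forall>g \<in> carrier G. \<delta> g = \<one>")
  case True
  then show ?thesis by (intro bexI[of _ \<one>]) (auto simp: kap_def)
next
  case False
  \<comment> \<open>The restriction makes \<open>f\<close> extensional, as membership in
    \<open>Bij (carrier G)\<close> demands.\<close>
  define f where "f = (\<lambda>g \<in> carrier G. g \<otimes> \<delta> g)"
  have fc: "f g \<in> carrier G" if "g \<in> carrier G" for g using that d by (simp add: f_def)
  have hom: "f (g \<otimes> h) = f g \<otimes> f h" if "g \<in> carrier G" "h \<in> carrier G" for g h
    using that d[of g] d[of h] dm[of g h] by (simp add: f_def cj_def group_word)
  have fd: "f (\<delta> g [^] k) = \<delta> g [^] k" if g: "g \<in> carrier G" for g and k :: nat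
  proof (induction k)
    case 0
    have "f \<one> \<otimes> f \<one> = f \<one>" using hom[of \<one> \<one>] by simp
    then show ?case using fc[of \<one>] by (simp add: l_cancel_one')
  next
    case (Suc k)
    have "f (\<delta> g) = \<delta> g" using g d dd by (simp add: f_def)
    then show ?case using Suc hom[of "\<delta> g [^] k" "\<delta> g"] g d by simp
  qed
  have it: "(f ^^ k) g = g \<otimes> \<delta> g [^] k" if g: "g \<in> carrier G" for g k
  proof (induction k)
    case (Suc k)
    have "(f ^^ Suc k) g = f g \<otimes> f (\<delta> g [^] k)" using Suc hom[of g "\<delta> g [^] k"] g d by simp
    also have "\<dots> = g \<otimes> (\<delta> g \<otimes> \<delta> g [^] k)" using fd[OF g] g d by (simp add: f_def m_assoc)
    also have "\<delta> g \<otimes> \<delta> g [^] k = \<delta> g [^] Suc k" using g d by (simp only: nat_pow_Suc2)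
    finally show ?case .
  qed (use g in simp)
  have itp: "(f ^^ p) g = g" if "g \<in> carrier G" for g using it[OF that] dp that by simp
  have p1: "p = Suc (p - 1)" using p prime_gt_0_nat by fastforce
  have itc: "(f ^^ k) g \<in> carrier G" if "g \<in> carrier G" for g k using it that d by simp
  have bij: "bij_betw f (carrier G) (carrier G)"
  proof (rule bij_betw_byWitness[where f' = "f ^^ (p - 1)"])
    have "(f ^^ Suc (p - 1)) a = a" if "a \<in> carrier G" for a using itp[OF that] p1 by argo
    then show "\<forall>a\<in>carrier G. f ((f ^^ (p - 1)) a) = a"
      and "\<forall>a\<in>carrier G. (f ^^ (p - 1)) (f a) = a" by (simp_all add: funpow_swap1)
  qed (use fc itc in auto)
  have fB: "f \<in> Bij (carrier G)" using bij by (simp add: Bij_def f_def)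
  have fa: "f \<in> auto G" using fB hom fc by (auto simp: auto_def hom_def)
  interpret A: group "AutoGroup G" by (rule AutoGroup)
  have Ac: "carrier (AutoGroup G) = auto G" by (simp add: AutoGroup_def)
  have one: "\<one>\<^bsub>AutoGroup G\<^esub> = (\<lambda>x \<in> carrier G. x)" by (simp add: AutoGroup_def BijGroup_def)
  have mul: "a \<otimes>\<^bsub>AutoGroup G\<^esub> b = compose (carrier G) a b"
    if "a \<in> Bij (carrier G)" "b \<in> Bij (carrier G)" for a b
    using that by (simp add: AutoGroup_def BijGroup_def)
  have pw: "f [^]\<^bsub>AutoGroup G\<^esub> k = (\<lambda>x \<in> carrier G. (f ^^ k) x)" for k :: nat
  proof (induction k)
    case (Suc k)
    have "f [^]\<^bsub>AutoGroup G\<^esub> k \<in> Bij (carrier G)"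
      using A.nat_pow_closed[of f k] fa by (simp add: Ac auto_def)
    then have "f [^]\<^bsub>AutoGroup G\<^esub> Suc k = compose (carrier G) (f [^]\<^bsub>AutoGroup G\<^esub> k) f"
      using fB by (simp only: A.nat_pow_Suc mul)
    also have "\<dots> = (\<lambda>x \<in> carrier G. (f ^^ Suc k) x)"
      unfolding Suc compose_def by (rule restrict_ext) (simp add: fc funpow_swap1)
    finally show ?case .
  qed (simp add: one)
  have "f [^]\<^bsub>AutoGroup G\<^esub> p = \<one>\<^bsub>AutoGroup G\<^esub>" unfolding pw one using itp by (auto intro!: restrict_ext)
  then have "A.ord f dvd p" using A.pow_eq_id[of f p] fa Ac by simp
  moreover have "A.ord f \<noteq> 1"
  proof
    assume "A.ord f = 1"
    then have "f = (\<lambda>x \<in> carrier G. x)" using A.ord_eq_1[of f] fa Ac one by simp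
    then have "f g = g" if "g \<in> carrier G" for g using that by simp
    then have "g \<otimes> \<delta> g = g" if "g \<in> carrier G" for g using that by (simp add: f_def)
    then show False using False d by simp
  qed
  ultimately have "A.ord f = p" using p by (metis prime_nat_iff)
  then have "inner_automorphism G f" using noninn fa by blast
  then obtain y where y: "y \<in> carrier G" and fy: "\<And>x. x \<in> carrier G \<Longrightarrow> f x = y \<otimes> x \<otimes> inv y"
    unfolding inner_automorphism_def by blast
  have "\<delta> g = kap y g" if g: "g \<in> carrier G" for g
  proof -
    have "g \<otimes> \<delta> g = y \<otimes> g \<otimes> inv y" using fy[OF g] g by (simp add: f_def)
    then have "inv g \<otimes> (g \<otimes> \<delta> g) = inv g \<otimes> (y \<otimes> g \<otimes> inv y)" by simp
    then show ?thesis using g y d by (simp add: inv_l_cancel kap_def m_assoc)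
  qed
  with y show ?thesis by blast
qed

text \<open>Class equation for conjugation on \<open>H\<close>: if \<open>\<one>\<close> were its
  only central element, every other orbit in \<open>H\<close> would have length divisible by
  \<open>p\<close>, and \<open>card H\<close> would be 1 modulo \<open>p\<close>, although it is a
  nontrivial power of \<open>p\<close>.\<close>

lemma p_group_normal_meets_center:
  fixes p :: nat
  assumes p: "Factorial_Ring.prime p" and fin: "finite (carrier G)" and ord: "card (carrier G) = p ^ n"
    and H: "subgroup H G" and norm: "\<And>g h. g \<in> carrier G \<Longrightarrow> h \<in> H \<Longrightarrow> cj g h \<in> H"
    and nt: "H \<noteq> {\<one>}"
  shows "\<exists>x \<in> H. x \<noteq> \<one> \<and> x \<in> grp_center G"
proof (rule ccontr)
  assume no: "\<not> ?thesis"
  define \<phi> where "\<phi> = (\<lambda>g. \<lambda>h \<in> carrier G. g \<otimes> h \<otimes> inv g)"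
  interpret act: group_action G "carrier G" \<phi> unfolding \<phi>_def by (rule action_by_conjugation)
  let ?O = "orbit G \<phi>"
  have Hc: "H \<subseteq> carrier G" using H by (rule subgroup.subset)
  have finH: "finite H" using Hc fin finite_subset by blast
  have orb: "?O x \<subseteq> H" if xH: "x \<in> H" for x
  proof
    fix y assume "y \<in> ?O x"
    then obtain g where g: "g \<in> carrier G" "y = g \<otimes> x \<otimes> inv g"
      using subsetD[OF Hc xH] by (auto simp: orbit_def \<phi>_def)
    then have "y = cj (inv g) x" by (simp add: cj_def)
    then show "y \<in> H" using norm g xH by simp
  qed
  have self: "x \<in> ?O x" if "x \<in> H" for x using act.orbit_refl that Hc by blast
  have dvd: "p dvd card (?O x)" if x: "x \<in> H - {\<one>}" for x
  proof -
    have "card (?O x) dvd p ^ n" using act.orbit_stabilizer_theorem[of x] x Hc ord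
      by (metis Diff_iff dvd_triv_left order_def subsetD)
    then obtain k where k: "card (?O x) = p ^ k" using p by (auto simp: divides_primepow_nat)
    have "k \<noteq> 0"
    proof
      assume "k = 0"
      then have c1: "card (?O x) = 1" using k by simp
      then obtain w where w: "?O x = {w}" by (auto simp: card_1_singleton_iff)
      have "g \<otimes> x = x \<otimes> g" if g: "g \<in> carrier G" for g
      proof -
        have "\<phi> g x \<in> ?O x" using g by (auto simp: orbit_def)
        then have "g \<otimes> x \<otimes> inv g = x" using w self[of x] x Hc by (auto simp: \<phi>_def)
        then show ?thesis using g x Hc by (metis Diff_iff inv_solve_right' m_closed subsetD inv_solve_right)
      qed
      then have "x \<in> grp_center G" using x Hc by (auto simp: grp_center_def)
      then show False using no x by auto
    qed
    then show ?thesis using k by (simp add: dvd_power)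
  qed
  have disj: "pairwise disjnt (?O ` (H - {\<one>}))"
  proof (rule pairwiseI)
    fix S T assume "S \<in> ?O ` (H - {\<one>})" "T \<in> ?O ` (H - {\<one>})" "S \<noteq> T"
    then have "S \<in> orbits G (carrier G) \<phi>" "T \<in> orbits G (carrier G) \<phi>"
      using Hc by (auto simp: orbits_def)
    with \<open>S \<noteq> T\<close> show "disjnt S T" using act.disjoint_union by (auto simp: disjnt_def)
  qed
  have finO: "finite S" if "S \<in> ?O ` (H - {\<one>})" for S
    using that orb finite_subset[OF _ finH] by auto
  have "\<Union>(?O ` (H - {\<one>})) = H - {\<one>}"
  proof -
    have "\<one> \<notin> ?O x" if "x \<in> H - {\<one>}" for x
    proof
      assume "\<one> \<in> ?O x"
      have xc: "x \<in> carrier G" using that Hc by auto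
      then obtain g where g: "g \<in> carrier G" "\<one> = g \<otimes> x \<otimes> inv g"
        using xc \<open>\<one> \<in> ?O x\<close> by (auto simp: orbit_def \<phi>_def)
      then have "cj g \<one> = cj g (g \<otimes> x \<otimes> inv g)" by simp
      then have "x = \<one>" using g(1) xc by (simp add: cj_def group_word)
      then show False using that by simp
    qed
    then show ?thesis using orb self by blast
  qed
  then have "card (H - {\<one>}) = sum card (?O ` (H - {\<one>}))"
    using card_Union_disjoint[OF disj finO] by simp
  moreover have "p dvd sum card (?O ` (H - {\<one>}))" using dvd by (intro dvd_sum) auto
  ultimately have a: "p dvd card (H - {\<one>})" by simp
  have oneH: "\<one> \<in> H" using H by (rule subgroup.one_closed)
  have "card H dvd p ^ n" using lagrange[OF H] ord by (metis dvd_triv_right order_def)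
  then obtain k where k: "card H = p ^ k" using p by (auto simp: divides_primepow_nat)
  have "k \<noteq> 0"
  proof
    assume "k = 0"
    then have "card H = 1" using k by simp
    then show False using nt oneH by (metis card_1_singletonE singletonD)
  qed
  then have "p dvd card H" using k by (simp add: dvd_power)
  moreover have "card H = Suc (card (H - {\<one>}))" using oneH finH by (metis card.remove)
  ultimately have "p dvd 1" using a by (metis dvd_add_right_iff plus_1_eq_Suc add.commute)
  then show False using p by (metis not_prime_unit)
qed

end

section \<open>Homomorphisms to the prime field and their quadratic analogues\<close>

text \<open>Functions to the prime field are represented by integer-valued functions, compared modulo \<open>p\<close>.\<close>

definition (in group) fphom :: "nat \<Rightarrow> 'a set \<Rightarrow> ('a \<Rightarrow> int) \<Rightarrow> bool" where
  "fphom p S f \<longleftrightarrow> (\<forall>g \<in> S. \<forall>h \<in> S. [f (g \<otimes> h) = f g + f h] (mod int p))"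

context group
begin

lemma fphomD: "fphom p S f \<Longrightarrow> g \<in> S \<Longrightarrow> h \<in> S \<Longrightarrow> [f (g \<otimes> h) = f g + f h] (mod int p)"
  by (simp add: fphom_def)

lemma fphom_one:
  assumes "fphom p S f" "subgroup S G" shows "[f \<one> = 0] (mod int p)"
proof -
  have "[f (\<one> \<otimes> \<one>) = f \<one> + f \<one>] (mod int p)"
    using assms fphomD subgroup.one_closed by blast
  then show ?thesis unfolding cong_iff_dvd_diff by simp
qed

lemma fphom_inv:
  assumes f: "fphom p S f" and S: "subgroup S G" and g: "g \<in> S"
  shows "[f (inv g) = - f g] (mod int p)"
proof -
  have "[f (g \<otimes> inv g) = f g + f (inv g)] (mod int p)"
    by (rule fphomD[OF f g subgroup.m_inv_closed[OF S g]])
  moreover have e: "g \<otimes> inv g = \<one>" using subgroup.mem_carrier[OF S g] by (rule r_inv)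
  ultimately show ?thesis using fphom_one[OF f S] unfolding e cong_iff_dvd_diff
    by Groebner_Basis.algebra
qed

lemma fphom_pow:
  assumes f: "fphom p S f" and S: "subgroup S G" and g: "g \<in> S"
  shows "[f (g [^] (n::nat)) = int n * f g] (mod int p)"
proof (induction n)
  case (Suc n)
  have "g [^] n \<in> S" using subgroup_int_pow_closed[OF S g, of "int n"] by (simp add: int_pow_int)
  then have "[f (g [^] Suc n) = f (g [^] n) + f g] (mod int p)" using fphomD[OF f, of "g [^] n" g] g by simp
  then show ?case using Suc unfolding cong_iff_dvd_diff of_nat_Suc by Groebner_Basis.algebra
qed (use fphom_one[OF f S] in simp)

lemma fphom_int_pow:
  assumes f: "fphom p S f" and S: "subgroup S G" and g: "g \<in> S"
  shows "[f (g [^] (n::int)) = n * f g] (mod int p)"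
proof (cases n rule: int_cases2)
  case (nonneg k)
  then show ?thesis using fphom_pow[OF assms, of k] by (simp add: int_pow_int)
next
  case (nonpos k)
  have gc: "g \<in> carrier G" using g S subgroup.mem_carrier by fast
  have "inv g \<in> S" using g S subgroup.m_inv_closed by fast
  from fphom_pow[OF f S this, of k] fphom_inv[OF f S g]
  have "[f (inv g [^] k) = int k * - f g] (mod int p)"
    by (meson cong_scalar_left cong_trans)
  moreover have "g [^] n = inv g [^] k" using nonpos gc by (simp add: int_pow_neg_int nat_pow_inv)
  ultimately show ?thesis using nonpos by simp
qed

end

section \<open>Extending quadratic functions from a subgroup\<close>

lemma (in group) int_pow_mem_imp_dvd:
  assumes p: "Factorial_Ring.prime (p::nat)" and L: "subgroup L G"
    and y: "y \<in> carrier G" "y \<notin> L" and yp: "y [^] p \<in> L" and i: "y [^] (i::int) \<in> L"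
  shows "int p dvd i"
proof (rule ccontr)
  assume "\<not> int p dvd i"
  then have "coprime (int p) i" using p by (simp add: prime_imp_coprime)
  then obtain u v where uv: "u * int p + v * i = 1"
    by (metis bezout_int coprime_imp_gcd_eq_1)
  have "y = y [^] (u * int p + v * i)" using y uv by simp
  also have "\<dots> = (y [^] int p) [^] u \<otimes> (y [^] i) [^] v"
    using y by (simp add: int_pow_mult int_pow_pow mult.commute)
  also have "\<dots> \<in> L"
    using L yp i by (simp add: subgroup.m_closed subgroup_int_pow_closed int_pow_int)
  finally show False using y by simp
qed

text \<open>The arithmetic of the product rule for \<open>g = l y^i\<close> and
  \<open>h = m y^j\<close>. Exchanging \<open>y^i\<close> and \<open>m\<close> costs the full term
  \<open>i * wym\<close>; one half of it is the \<open>r * i * wym\<close> contained in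
  \<open>r * wgh\<close>, and the other half cancels against \<open>r * i * wmy\<close> because
  \<open>w\<close> is alternating.\<close>

lemma cong_quadratic_step:
  fixes n :: int
  assumes "[2 * r = 1] (mod n)" "[Fgh = F3 + r * (i + j) * w3 + (i + j) * t] (mod n)"
    "[F3 = Fl + i * wym + Fm + r * wlm] (mod n)" "[w3 = wly + wmy] (mod n)" "[wmy = - wym] (mod n)"
    "[wgh = wlm + j * wly + i * wym] (mod n)"
  shows "[Fgh = (Fl + r * i * wly + i * t) + (Fm + r * j * wmy + j * t) + r * wgh] (mod n)"
proof -
  have "Fgh - ((Fl + r * i * wly + i * t) + (Fm + r * j * wmy + j * t) + r * wgh) =
      (Fgh - (F3 + r * (i + j) * w3 + (i + j) * t)) + (F3 - (Fl + i * wym + Fm + r * wlm))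
      + r * (i + j) * (w3 - (wly + wmy)) + r * i * (wmy - (- wym))
      - i * wym * (2 * r - 1) - r * (wgh - (wlm + j * wly + i * wym))"
    by (simp add: algebra_simps)
  then show ?thesis using assms unfolding cong_iff_dvd_diff by (simp only: dvd_diff dvd_add dvd_mult)
qed

text \<open>The biadditive form \<open>w\<close> prescribes the values on commutators, and \<open>r\<close> is one half modulo \<open>p\<close>. As in Baer's
  correspondence, \<open>F\<close> is a homomorphism for the commutative multiplication \<open>x * y = x y [x, y]^(-1/2)\<close>;
  \<open>w = 0\<close> gives ordinary homomorphisms.\<close>

locale alt_extension = group G for G :: "('a, 'b) monoid_scheme" (structure) +
  fixes p :: nat and \<Gamma> :: "'a set" and w :: "'a \<Rightarrow> 'a \<Rightarrow> int" and r :: int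
  assumes prime_p: "Factorial_Ring.prime p"
    and Gamma: "subgroup \<Gamma> G" and fin: "finite \<Gamma>"
    and w1: "\<And>a. a \<in> \<Gamma> \<Longrightarrow> fphom p \<Gamma> (\<lambda>b. w b a)"
    and w2: "\<And>a. a \<in> \<Gamma> \<Longrightarrow> fphom p \<Gamma> (w a)"
    and half: "[2 * r = 1] (mod int p)"
begin

text \<open>For alternating \<open>w\<close> the values on commutators and \<open>p\<close>-th
  powers are forced by the product rule on all of \<open>\<Gamma>\<close>;
  \<open>admissible_extend\<close> shows that this is the only obstruction to extending
  \<open>F\<close>.\<close>

definition admissible :: "'a set \<Rightarrow> ('a \<Rightarrow> int) \<Rightarrow> bool" where
  "admissible L F \<longleftrightarrow> subgroup L G \<and> L \<subseteq> \<Gamma> \<and>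
     (\<forall>a \<in> \<Gamma>. \<forall>b \<in> \<Gamma>. a \<otimes> b \<otimes> inv a \<otimes> inv b \<in> L \<and> [F (a \<otimes> b \<otimes> inv a \<otimes> inv b) = w a b] (mod int p)) \<and>
     (\<forall>a \<in> \<Gamma>. a [^] p \<in> L \<and> [F (a [^] p) = 0] (mod int p)) \<and>
     (\<forall>l \<in> L. \<forall>m \<in> L. [F (l \<otimes> m) = F l + F m + r * w l m] (mod int p))"

lemma Gc: "a \<in> \<Gamma> \<Longrightarrow> a \<in> carrier G"
  using Gamma subgroup.mem_carrier by fast

lemma Gint: "a \<in> \<Gamma> \<Longrightarrow> a [^] (i::int) \<in> \<Gamma>"
  by (rule subgroup_int_pow_closed[OF Gamma])

lemma Gm: "a \<in> \<Gamma> \<Longrightarrow> b \<in> \<Gamma> \<Longrightarrow> a \<otimes> b \<in> \<Gamma>"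
  using Gamma subgroup.m_closed by fast

lemma Gi: "a \<in> \<Gamma> \<Longrightarrow> inv a \<in> \<Gamma>"
  using Gamma subgroup.m_inv_closed by fast

lemma w_comm:
  assumes "a \<in> \<Gamma>" "b \<in> \<Gamma>" "c \<in> \<Gamma>"
  shows "[w (a \<otimes> b \<otimes> inv a \<otimes> inv b) c = 0] (mod int p)" "[w c (a \<otimes> b \<otimes> inv a \<otimes> inv b) = 0] (mod int p)"
proof -
  have *: "[f (a \<otimes> b \<otimes> inv a \<otimes> inv b) = 0] (mod int p)" if f: "fphom p \<Gamma> f" for f
    using fphomD[OF f, of "a \<otimes> b \<otimes> inv a" "inv b"] fphomD[OF f, of "a \<otimes> b" "inv a"] fphomD[OF f, of a b]
      fphom_inv[OF f Gamma, of a] fphom_inv[OF f Gamma, of b] assms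
    unfolding cong_iff_dvd_diff by (simp add: Gm Gi) Groebner_Basis.algebra
  show "[w (a \<otimes> b \<otimes> inv a \<otimes> inv b) c = 0] (mod int p)" using *[OF w1[OF assms(3)]] .
  show "[w c (a \<otimes> b \<otimes> inv a \<otimes> inv b) = 0] (mod int p)" using *[OF w2[OF assms(3)]] .
qed

text \<open>The commutator of \<open>u\<close> with itself is \<open>\<one>\<close>, so
  \<open>w u u\<close> equals \<open>F \<one>\<close>, which the product rule makes 0. Antisymmetry
  follows by polarization.\<close>

lemma w_alt:
  assumes A: "admissible L F" and a: "a \<in> \<Gamma>" and b: "b \<in> \<Gamma>"
  shows "[w a b = - w b a] (mod int p)" "[w a a = 0] (mod int p)"
proof -
  have L: "subgroup L G" using A by (simp add: admissible_def)
  have W: "[w u u = 0] (mod int p)" if u: "u \<in> \<Gamma>" for u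
  proof -
    have "u \<otimes> u \<otimes> inv u \<otimes> inv u = \<one>" using Gc[OF u] by (simp add: group_word)
    then have "[F \<one> = w u u] (mod int p)"
      using A u unfolding admissible_def by metis
    moreover have "[F (\<one> \<otimes> \<one>) = F \<one> + F \<one> + r * w \<one> \<one>] (mod int p)"
      using A L subgroup.one_closed unfolding admissible_def by blast
    moreover have "\<one> \<in> \<Gamma>" using Gamma subgroup.one_closed by blast
    then have "[w \<one> \<one> = 0] (mod int p)" using fphom_one[OF w2 Gamma] by blast
    ultimately show ?thesis unfolding cong_iff_dvd_diff by simp Groebner_Basis.algebra
  qed
  show "[w a a = 0] (mod int p)" using W[OF a] .
  show "[w a b = - w b a] (mod int p)"
    using W[OF a] W[OF b] W[OF Gm[OF a b]] fphomD[OF w1[OF Gm[OF a b]] a b]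
      fphomD[OF w2[OF a] a b] fphomD[OF w2[OF b] a b]
    unfolding cong_iff_dvd_diff by Groebner_Basis.algebra
qed

text \<open>The product rule leaves no choice but
  \<open>F' (l y^i) = F l + r * i * w l y + i * t\<close>. Since \<open>y \<notin> L\<close> while
  \<open>y [^] p \<in> L\<close>, the exponent \<open>i\<close> is determined modulo
  \<open>p\<close>. Two representatives in \<open>L\<close> thus differ by a \<open>p\<close>-th
  power, where \<open>F\<close> vanishes, so that the value does not depend on the choice of
  \<open>c g\<close>.\<close>

lemma admissible_step:
  assumes A: "admissible L F" and y: "y \<in> \<Gamma>" "y \<notin> L"
  shows "\<exists>L' F'. admissible L' F' \<and> L \<subseteq> L' \<and> y \<in> L' \<and> (\<forall>l \<in> L. [F' l = F l] (mod int p)) \<and> [F' y = t] (mod int p)"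
proof -
  have L: "subgroup L G" and LG: "L \<subseteq> \<Gamma>"
    and cm: "\<And>a b. a \<in> \<Gamma> \<Longrightarrow> b \<in> \<Gamma> \<Longrightarrow> a \<otimes> b \<otimes> inv a \<otimes> inv b \<in> L"
    and Fcm: "\<And>a b. a \<in> \<Gamma> \<Longrightarrow> b \<in> \<Gamma> \<Longrightarrow> [F (a \<otimes> b \<otimes> inv a \<otimes> inv b) = w a b] (mod int p)"
    and pw: "\<And>a. a \<in> \<Gamma> \<Longrightarrow> a [^] p \<in> L"
    and Fpw: "\<And>a. a \<in> \<Gamma> \<Longrightarrow> [F (a [^] p) = 0] (mod int p)"
    and Fm: "\<And>l m. l \<in> L \<Longrightarrow> m \<in> L \<Longrightarrow> [F (l \<otimes> m) = F l + F m + r * w l m] (mod int p)"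
    using A by (auto simp: admissible_def)
  have Lm: "\<And>a b. a \<in> L \<Longrightarrow> b \<in> L \<Longrightarrow> a \<otimes> b \<in> L" using L subgroup.m_closed by fast
  have Li: "\<And>a. a \<in> L \<Longrightarrow> inv a \<in> L" using L subgroup.m_inv_closed by fast
  have yc: "y \<in> carrier G" using y Gc by simp
  define L' where "L' = {g \<in> \<Gamma>. \<exists>i::int. g \<otimes> y [^] (- i) \<in> L}"
  define c where "c g = (SOME i::int. g \<otimes> y [^] (- i) \<in> L)" for g
  have c: "g \<otimes> y [^] (- c g) \<in> L" if "g \<in> L'" for g
    using that unfolding L'_def c_def by (auto intro: someI_ex)
  define val where "val g i = F (g \<otimes> y [^] (- i)) + r * i * w (g \<otimes> y [^] (- i)) y + i * t" for g and i :: int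
  define F' where "F' g = val g (c g)" for g
  have L'G: "L' \<subseteq> \<Gamma>" by (auto simp: L'_def)
  have val: "[F' g = val g i] (mod int p)" if g: "g \<in> \<Gamma>" and i: "g \<otimes> y [^] (- i) \<in> L" for g i
  proof -
    have gL: "g \<in> L'" using g i by (auto simp: L'_def)
    have gc: "g \<in> carrier G" using g Gc by simp
    let ?a = "g \<otimes> y [^] (- c g)" and ?b = "g \<otimes> y [^] (- i)"
    have "inv ?a \<otimes> ?b = y [^] (c g - i)"
      using gc yc by (simp add: inv_mult_group m_assoc inv_l_cancel int_pow_neg int_pow_diff)
    then have "y [^] (c g - i) \<in> L" using Lm[OF Li[OF c[OF gL]] i] by simp
    then have "int p dvd c g - i" using int_pow_mem_imp_dvd[OF prime_p L yc y(2) pw[OF y(1)]] by blast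
    then obtain k where k: "c g - i = int p * k" by blast
    let ?d = "(y [^] k) [^] p"
    have d: "?d \<in> L" using pw Gint y by blast
    have dd: "?d = y [^] (c g - i)" unfolding k using yc
      by (simp add: int_pow_int[symmetric] int_pow_pow mult.commute)
    have b: "?b = ?a \<otimes> ?d"
      unfolding dd using gc yc by (simp add: m_assoc int_pow_mult[symmetric])
    have aG: "?a \<in> \<Gamma>" "?d \<in> \<Gamma>" using c[OF gL] d LG by auto
    have "[F ?b = F ?a + F ?d + r * w ?a ?d] (mod int p)" unfolding b by (rule Fm[OF c[OF gL] d])
    moreover have "[F ?d = 0] (mod int p)" using Fpw Gint y by blast
    moreover have "[w ?a ?d = int p * w ?a (y [^] k)] (mod int p)" by (rule fphom_pow[OF w2[OF aG(1)] Gamma Gint[OF y(1)]])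
    moreover have "[w ?b y = w ?a y + w ?d y] (mod int p)" unfolding b by (rule fphomD[OF w1[OF y(1)] aG])
    moreover have "[w ?d y = int p * w (y [^] k) y] (mod int p)" by (rule fphom_pow[OF w1[OF y(1)] Gamma Gint[OF y(1)]])
    ultimately show ?thesis using k unfolding F'_def val_def cong_iff_dvd_diff by Groebner_Basis.algebra
  qed
  have prod: "g \<otimes> h \<otimes> y [^] (- (i + j)) = l \<otimes> (y [^] i \<otimes> m \<otimes> inv (y [^] i) \<otimes> inv m) \<otimes> m"
    if "g \<in> \<Gamma>" "h \<in> \<Gamma>" "l = g \<otimes> y [^] (- i)" "m = h \<otimes> y [^] (- j)" for g h l m and i j :: int
  proof -
    have gh: "g \<in> carrier G" "h \<in> carrier G" "l \<in> carrier G" "m \<in> carrier G"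
      using that yc Gc by simp_all
    have lg: "g = l \<otimes> y [^] i" "h = m \<otimes> y [^] j"
      using that gh yc by (simp_all add: m_assoc int_pow_mult[symmetric])
    have "y [^] (- (i + j)) = inv (y [^] j) \<otimes> inv (y [^] i)"
      using yc by (simp add: int_pow_neg[symmetric] int_pow_mult[symmetric] algebra_simps)
    then show ?thesis unfolding lg using gh yc by (simp add: m_assoc inv_r_cancel)
  qed
  have mult: "g \<otimes> h \<in> L' \<and> [F' (g \<otimes> h) = F' g + F' h + r * w g h] (mod int p)" if g: "g \<in> L'" and h: "h \<in> L'" for g h
  proof -
    let ?i = "c g" and ?j = "c h"
    let ?l = "g \<otimes> y [^] (- ?i)" and ?m = "h \<otimes> y [^] (- ?j)"
    let ?k = "y [^] ?i \<otimes> ?m \<otimes> inv (y [^] ?i) \<otimes> inv ?m"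
    have gh: "g \<in> \<Gamma>" "h \<in> \<Gamma>" using g h L'G by auto
    have l: "?l \<in> L" "?m \<in> L" using c g h by auto
    have lG: "?l \<in> \<Gamma>" "?m \<in> \<Gamma>" using l LG by auto
    have yi: "y [^] ?i \<in> \<Gamma>" "y [^] ?j \<in> \<Gamma>" using Gint y by auto
    have k: "?k \<in> L" using cm yi lG by blast
    then have kG: "?k \<in> \<Gamma>" using LG by auto
    have e: "g \<otimes> h \<otimes> y [^] (- (?i + ?j)) = ?l \<otimes> ?k \<otimes> ?m" using prod gh by blast
    have mem: "g \<otimes> h \<otimes> y [^] (- (?i + ?j)) \<in> L" unfolding e using l k Lm by blast
    have ghG: "g \<otimes> h \<in> \<Gamma>" using gh Gm by blast
    have "g \<otimes> h \<in> L'" unfolding L'_def using ghG mem by blast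
    moreover have "[F' (g \<otimes> h) = F' g + F' h + r * w g h] (mod int p)"
    proof -
      have gl: "g = ?l \<otimes> y [^] ?i" "h = ?m \<otimes> y [^] ?j"
        using gh Gc yc by (simp_all add: m_assoc int_pow_mult[symmetric])
      have v: "[F' (g \<otimes> h) = F (?l \<otimes> ?k \<otimes> ?m) + r * (?i + ?j) * w (?l \<otimes> ?k \<otimes> ?m) y + (?i + ?j) * t] (mod int p)"
        using val[OF ghG mem] unfolding val_def e .
      have "[F (?l \<otimes> ?k \<otimes> ?m) = F (?l \<otimes> ?k) + F ?m + r * w (?l \<otimes> ?k) ?m] (mod int p)"
        using Fm Lm l k by blast
      moreover have "[F (?l \<otimes> ?k) = F ?l + F ?k + r * w ?l ?k] (mod int p)" using Fm l k by blast
      moreover have "[F ?k = w (y [^] ?i) ?m] (mod int p)" using Fcm yi lG by blast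
      moreover have "[w (y [^] ?i) ?m = ?i * w y ?m] (mod int p)" by (rule fphom_int_pow[OF w1[OF lG(2)] Gamma y(1)])
      moreover have "[w (?l \<otimes> ?k) ?m = w ?l ?m + w ?k ?m] (mod int p)" by (rule fphomD[OF w1[OF lG(2)] lG(1) kG])
      moreover have "[w ?k ?m = 0] (mod int p)" using w_comm yi lG by blast
      moreover have "[w ?l ?k = 0] (mod int p)" using w_comm yi lG by blast
      ultimately have F3: "[F (?l \<otimes> ?k \<otimes> ?m) = F ?l + ?i * w y ?m + F ?m + r * w ?l ?m] (mod int p)"
        unfolding cong_iff_dvd_diff by Groebner_Basis.algebra
      have "[w ?k y = 0] (mod int p)" using w_comm yi lG y by blast
      moreover have "[w (?l \<otimes> ?k \<otimes> ?m) y = w (?l \<otimes> ?k) y + w ?m y] (mod int p)"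
        by (rule fphomD[OF w1[OF y(1)] Gm[OF lG(1) kG] lG(2)])
      moreover have "[w (?l \<otimes> ?k) y = w ?l y + w ?k y] (mod int p)" by (rule fphomD[OF w1[OF y(1)] lG(1) kG])
      ultimately have wy: "[w (?l \<otimes> ?k \<otimes> ?m) y = w ?l y + w ?m y] (mod int p)"
        unfolding cong_iff_dvd_diff by Groebner_Basis.algebra
      have wm: "[w ?m y = - w y ?m] (mod int p)" by (rule w_alt(1)[OF A lG(2) y(1)])
      have "[w y y = 0] (mod int p)" by (rule w_alt(2)[OF A y(1) y(1)])
      moreover have "[w g h = w ?l h + w (y [^] ?i) h] (mod int p)"
        using fphomD[OF w1[OF gh(2)] lG(1) yi(1)] gl(1) by simp
      moreover have "[w ?l h = w ?l ?m + w ?l (y [^] ?j)] (mod int p)"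
        using fphomD[OF w2[OF lG(1)] lG(2) yi(2)] gl(2) by simp
      moreover have "[w (y [^] ?i) h = w (y [^] ?i) ?m + w (y [^] ?i) (y [^] ?j)] (mod int p)"
        using fphomD[OF w2[OF yi(1)] lG(2) yi(2)] gl(2) by simp
      moreover have "[w (y [^] ?i) (y [^] ?j) = ?j * w (y [^] ?i) y] (mod int p)"
        by (rule fphom_int_pow[OF w2[OF yi(1)] Gamma y(1)])
      moreover have "[w (y [^] ?i) y = ?i * w y y] (mod int p)"
        by (rule fphom_int_pow[OF w1[OF y(1)] Gamma y(1)])
      moreover have "[w ?l (y [^] ?j) = ?j * w ?l y] (mod int p)"
        by (rule fphom_int_pow[OF w2[OF lG(1)] Gamma y(1)])
      moreover have "[w (y [^] ?i) ?m = ?i * w y ?m] (mod int p)" by (rule fphom_int_pow[OF w1[OF lG(2)] Gamma y(1)])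
      ultimately have wgh: "[w g h = w ?l ?m + ?j * w ?l y + ?i * w y ?m] (mod int p)"
        unfolding cong_iff_dvd_diff by Groebner_Basis.algebra
      have e': "F' g = F ?l + r * ?i * w ?l y + ?i * t" "F' h = F ?m + r * ?j * w ?m y + ?j * t"
        by (simp_all add: F'_def val_def)
      show ?thesis unfolding e' by (rule cong_quadratic_step[OF half v F3 wy wm wgh])
    qed
    ultimately show ?thesis by blast
  qed
  have LL': "L \<subseteq> L'"
  proof
    fix l assume l: "l \<in> L"
    then have "l \<otimes> y [^] (- (0::int)) \<in> L" using LG Gc by auto
    then show "l \<in> L'" unfolding L'_def using l LG by blast
  qed
  have F'L: "[F' l = F l] (mod int p)" if l: "l \<in> L" for l
  proof -
    have "l \<otimes> y [^] (- (0::int)) \<in> L" "l \<in> \<Gamma>" "l \<in> carrier G" using l LG Gc by auto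
    then show ?thesis using val[of l 0] by (simp add: val_def)
  qed
  have y1: "y \<otimes> y [^] (- (1::int)) = \<one>" using yc by (simp add: int_pow_neg)
  have oneL: "\<one> \<in> L" using L subgroup.one_closed by blast
  have "y \<otimes> y [^] (- (1::int)) \<in> L" unfolding y1 by (rule oneL)
  then have yL: "y \<in> L'" unfolding L'_def using y(1) by blast
  have oneG: "\<one> \<in> \<Gamma>" using oneL LG by auto
  have F'y: "[F' y = t] (mod int p)"
  proof -
    have "[F' y = F \<one> + r * 1 * w \<one> y + 1 * t] (mod int p)"
      using val[of y 1] y1 oneL y(1) unfolding val_def by simp
    moreover have "[w \<one> y = 0] (mod int p)" "[w \<one> \<one> = 0] (mod int p)"
      using fphom_one[OF w1 Gamma] y(1) oneG by blast+
    moreover have "[F (\<one> \<otimes> \<one>) = F \<one> + F \<one> + r * w \<one> \<one>] (mod int p)" using Fm oneL by blast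
    ultimately show ?thesis unfolding cong_iff_dvd_diff by simp Groebner_Basis.algebra
  qed
  have sub: "subgroup L' G"
  proof (rule subgroupI)
    show "L' \<subseteq> carrier G" using L'G Gc by auto
    show "L' \<noteq> {}" using yL by auto
    fix g assume g: "g \<in> L'"
    let ?l = "g \<otimes> y [^] (- c g)"
    have gG: "g \<in> \<Gamma>" and gc: "g \<in> carrier G" using g L'G Gc by auto
    have l: "?l \<in> L" "?l \<in> \<Gamma>" using c[OF g] LG by auto
    have "inv g \<otimes> y [^] (- (- c g)) = (inv (y [^] c g) \<otimes> inv ?l \<otimes> inv (inv (y [^] c g)) \<otimes> inv (inv ?l)) \<otimes> inv ?l"
      using gc yc by (simp add: group_word int_pow_neg)
    moreover have "\<dots> \<in> L" using cm[of "inv (y [^] c g)" "inv ?l"] Gi Gint y(1) l Lm Li by blast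
    ultimately have "inv g \<otimes> y [^] (- (- c g)) \<in> L" by simp
    then show "inv g \<in> L'" unfolding L'_def using gG Gi by blast
  qed (use mult in blast)
  have "admissible L' F'"
    unfolding admissible_def
  proof (intro conjI ballI)
    fix a b assume ab: "a \<in> \<Gamma>" "b \<in> \<Gamma>"
    show "a \<otimes> b \<otimes> inv a \<otimes> inv b \<in> L'" using cm ab LL' by blast
    show "[F' (a \<otimes> b \<otimes> inv a \<otimes> inv b) = w a b] (mod int p)"
      using F'L[OF cm[OF ab]] Fcm[OF ab] cong_trans by blast
  next
    fix a assume a: "a \<in> \<Gamma>"
    show "a [^] p \<in> L'" using pw a LL' by blast
    show "[F' (a [^] p) = 0] (mod int p)" using F'L[OF pw[OF a]] Fpw[OF a] cong_trans by blast
  qed (use sub L'G mult in auto)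
  then show ?thesis using LL' yL F'L F'y by blast
qed

lemma admissible_extend:
  "admissible L F \<Longrightarrow> \<exists>F'. admissible \<Gamma> F' \<and> (\<forall>l \<in> L. [F' l = F l] (mod int p))"
proof (induction "card \<Gamma> - card L" arbitrary: L F rule: less_induct)
  case less
  show ?case
  proof (cases "L = \<Gamma>")
    case True
    then show ?thesis using less.prems by auto
  next
    case False
    have LG: "L \<subseteq> \<Gamma>" using less.prems by (simp add: admissible_def)
    then obtain y where y: "y \<in> \<Gamma>" "y \<notin> L" using False by blast
    obtain L' F' where L': "admissible L' F'" "L \<subseteq> L'" "y \<in> L'" "\<forall>l \<in> L. [F' l = F l] (mod int p)"
      using admissible_step[OF less.prems y] by blast
    have L'G: "L' \<subseteq> \<Gamma>" using L'(1) by (simp add: admissible_def)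
    have "card L < card L'" using L' y psubset_card_mono[of L' L] finite_subset[OF L'G fin] by blast
    moreover have "card L' \<le> card \<Gamma>" using L'G fin card_mono by blast
    ultimately have "card \<Gamma> - card L' < card \<Gamma> - card L" by linarith
    from less.hyps[OF this L'(1)] obtain F'' where "admissible \<Gamma> F''" "\<forall>l \<in> L'. [F'' l = F' l] (mod int p)" by blast
    then show ?thesis using L' by (meson cong_trans subsetD)
  qed
qed

end

text \<open>This is the extension for the zero form. The quotient of \<open>S\<close> by
  \<open>M\<close> is elementary abelian, so the zero function on \<open>M\<close> is admissible;
  the first step prescribes the value 1 at \<open>x\<close>.\<close>

lemma (in group) fphom_separation:
  assumes p: "Factorial_Ring.prime p" and r: "[2 * r = 1] (mod int p)"
    and S: "subgroup S G" and fin: "finite S"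
    and M: "subgroup M G" "M \<subseteq> S"
    and cm: "\<And>a b. a \<in> S \<Longrightarrow> b \<in> S \<Longrightarrow> a \<otimes> b \<otimes> inv a \<otimes> inv b \<in> M"
    and pw: "\<And>a. a \<in> S \<Longrightarrow> a [^] p \<in> M"
    and x: "x \<in> S" "x \<notin> M"
  shows "\<exists>f. fphom p S f \<and> (\<forall>m \<in> M. [f m = 0] (mod int p)) \<and> [f x = 1] (mod int p)"
proof -
  interpret alt_extension G p S "\<lambda>_ _. 0" r
    by (intro alt_extension.intro alt_extension_axioms.intro) (use p S fin r group_axioms in \<open>auto simp: fphom_def\<close>)
  have "admissible M (\<lambda>_. 0)" unfolding admissible_def using M cm pw by auto
  from admissible_step[OF this x, of 1] obtain L F where
    L: "admissible L F" "M \<subseteq> L" "x \<in> L" "\<forall>l \<in> M. [F l = 0] (mod int p)" "[F x = 1] (mod int p)"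
    by blast
  from admissible_extend[OF L(1)] obtain f where
    f: "admissible S f" "\<forall>l \<in> L. [f l = F l] (mod int p)" by blast
  have "fphom p S f" using f(1) by (simp add: admissible_def fphom_def)
  moreover have "[f x = 1] (mod int p)" using f(2) L(3,5) cong_trans by blast
  moreover have "\<forall>m \<in> M. [f m = 0] (mod int p)" using f(2) L(2,4) by (meson cong_trans subsetD)
  ultimately show ?thesis by blast
qed

text \<open>In a finite \<open>p\<close>-group these elements generate the Frattini subgroup, by
  Burnside's description of it. Homomorphisms to the prime field see exactly the quotient by
  it.\<close>

definition (in group) frattini_gens :: "nat \<Rightarrow> 'a set" where
  "frattini_gens p = {a \<otimes> b \<otimes> inv a \<otimes> inv b | a b. a \<in> carrier G \<and> b \<in> carrier G} \<union> {a [^] p | a. a \<in> carrier G}"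

section \<open>Groups all of whose automorphisms of order p are inner\<close>

text \<open>\<open>N\<close> stands for \<open>\<gamma>\<^sub>3(G)G^p\<close>, of which only the listed properties matter. The number \<open>r\<close> is one half
  modulo \<open>p\<close>.\<close>

locale only_inner = group G for G :: "('a, 'b) monoid_scheme" (structure) +
  fixes p :: nat and \<zeta> :: 'a and N :: "'a set" and r :: int
  assumes prime_p: "Factorial_Ring.prime p" and odd_p: "odd p" and half: "[2 * r = 1] (mod int p)"
    and fin: "finite (carrier G)" and order_p: "\<exists>n. card (carrier G) = p ^ n"
    and noncomm: "\<exists>a \<in> carrier G. \<exists>b \<in> carrier G. a \<otimes> b \<noteq> b \<otimes> a"
    and center_cyclic: "\<zeta> \<in> carrier G" "grp_center G = range (\<lambda>i::int. \<zeta> [^] i)"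
    and noninn: "\<And>\<phi>. \<phi> \<in> auto G \<Longrightarrow> group.ord (AutoGroup G) \<phi> = p \<Longrightarrow> inner_automorphism G \<phi>"
    and N_sub: "subgroup N G" and N_cj: "\<And>g n. g \<in> carrier G \<Longrightarrow> n \<in> N \<Longrightarrow> cj g n \<in> N"
    and N_pow: "\<And>g. g \<in> carrier G \<Longrightarrow> g [^] p \<in> N"
    and N_le: "N \<subseteq> generate G (frattini_gens p)"
    and N_kap: "\<And>x g. x \<in> generate G (frattini_gens p) \<Longrightarrow> g \<in> carrier G \<Longrightarrow> kap x g \<in> N"
begin

section \<open>The centre and its element of order p\<close>

abbreviation Z where "Z \<equiv> grp_center G"

definition Phi where "Phi = generate G (frattini_gens p)"

abbreviation cent where "cent \<equiv> grp_centralizer G"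

lemma Z_iff: "c \<in> Z \<longleftrightarrow> c \<in> carrier G \<and> (\<forall>g \<in> carrier G. c \<otimes> g = g \<otimes> c)"
  by (simp add: grp_center_def)

lemma Z_carrier: "c \<in> Z \<Longrightarrow> c \<in> carrier G"
  using Z_iff by blast

lemma Z_comm: "c \<in> Z \<Longrightarrow> g \<in> carrier G \<Longrightarrow> c \<otimes> g = g \<otimes> c"
  using Z_iff by blast

lemma Z_cj: "c \<in> Z \<Longrightarrow> g \<in> carrier G \<Longrightarrow> cj g c = c"
  using Z_comm[of c g] by (simp add: cj_comm Z_carrier)

lemma cent_iff: "x \<in> cent H \<longleftrightarrow> x \<in> carrier G \<and> (\<forall>h \<in> H. x \<otimes> h = h \<otimes> x)"
  by (simp add: grp_centralizer_def)

lemmas Z_subgroup = center_subgroup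

lemma Z_zeta: "c \<in> Z \<longleftrightarrow> (\<exists>i::int. c = \<zeta> [^] i)"
  using center_cyclic by auto

lemma normal_meets_Z:
  assumes "subgroup H G" "\<And>g h. g \<in> carrier G \<Longrightarrow> h \<in> H \<Longrightarrow> cj g h \<in> H" "H \<noteq> {\<one>}"
  shows "\<exists>x \<in> H. x \<noteq> \<one> \<and> x \<in> Z"
  using p_group_normal_meets_center[OF prime_p fin _ assms] order_p by blast

lemma one_closed_Z: "\<one> \<in> Z"
  using Z_subgroup subgroup.one_closed by blast

lemma ord_p_power: "x \<in> carrier G \<Longrightarrow> \<exists>k. ord x = p ^ k"
  using order_p ord_dvd_group_order[of x] prime_p by (auto simp: order_def divides_primepow_nat)

text \<open>If \<open>\<zeta>\<close> has order \<open>p^k\<close>, then \<open>z\<close> is its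
  power with exponent \<open>p^(k-1)\<close>; in a cyclic group this power generates all elements
  whose order divides \<open>p\<close>.\<close>

lemma ex_z:
  "\<exists>z. z \<in> Z \<and> z \<noteq> \<one> \<and> z [^] p = \<one> \<and> (\<forall>c \<in> Z. c [^] p = \<one> \<longrightarrow> (\<exists>i::int. c = z [^] i))"
proof -
  have "carrier G \<noteq> {\<one>}" using noncomm by auto
  then obtain x where x: "x \<noteq> \<one>" "x \<in> Z" using normal_meets_Z[of "carrier G"] subgroup_self by auto
  then have "\<zeta> \<noteq> \<one>" using Z_zeta[of x] by auto
  obtain k where k: "ord \<zeta> = p ^ k" using ord_p_power center_cyclic by blast
  have "k \<noteq> 0" using k \<open>\<zeta> \<noteq> \<one>\<close> ord_eq_1[OF center_cyclic(1)] by (metis power_0)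
  define m where "m = p ^ (k - 1)"
  have om: "ord \<zeta> = m * p" using k \<open>k \<noteq> 0\<close> by (metis m_def mult.commute power_eq_if)
  have m0: "m > 0" using prime_p by (simp add: m_def prime_gt_0_nat)
  define z where "z = \<zeta> [^] m"
  have "z \<in> Z" using Z_zeta[of z] by (metis z_def int_pow_int)
  moreover have "z \<noteq> \<one>"
  proof
    assume "z = \<one>"
    then have "m * p dvd m" using pow_eq_id[OF center_cyclic(1), of m] om by (simp add: z_def)
    then show False using m0 prime_p by (metis dvd_imp_le mult_less_cancel1 mult.right_neutral not_le prime_gt_1_nat mult_le_cancel1 nat_less_le)
  qed
  moreover have "z [^] p = \<one>"
    using center_cyclic(1) pow_ord_eq_1[of \<zeta>] om by (simp add: z_def nat_pow_pow)
  moreover have "\<exists>i::int. c = z [^] i" if c: "c \<in> Z" "c [^] p = \<one>" for c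
  proof -
    obtain a :: int where a: "c = \<zeta> [^] a" using c Z_zeta by blast
    have "\<zeta> [^] (a * int p) = \<one>" using c(2) a center_cyclic(1) by (simp add: int_pow_int[symmetric] int_pow_pow)
    then have "int (m * p) dvd a * int p" using int_pow_eq_id[OF center_cyclic(1)] om by simp
    then have "int m dvd a" using prime_p by (simp add: prime_gt_0_nat)
    then obtain b where "a = int m * b" by blast
    then have "c = z [^] b" using a center_cyclic(1) by (simp add: z_def int_pow_int[symmetric] int_pow_pow)
    then show ?thesis by blast
  qed
  ultimately show ?thesis by blast
qed

definition z where
  "z = (SOME z. z \<in> Z \<and> z \<noteq> \<one> \<and> z [^] p = \<one> \<and> (\<forall>c \<in> Z. c [^] p = \<one> \<longrightarrow> (\<exists>i::int. c = z [^] i)))"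

lemma z_Z: "z \<in> Z" and z_not_one: "z \<noteq> \<one>" and z_pow: "z [^] p = \<one>"
  and Z_order_p: "c \<in> Z \<Longrightarrow> c [^] p = \<one> \<Longrightarrow> \<exists>i::int. c = z [^] i"
  using someI_ex[OF ex_z, folded z_def] by blast+

lemma z_carrier [simp]: "z \<in> carrier G"
  using z_Z Z_carrier by blast

lemma zi_Z: "z [^] (i::int) \<in> Z"
  by (rule subgroup_int_pow_closed[OF Z_subgroup z_Z])

lemma zi_one: "z [^] (i::int) = \<one> \<longleftrightarrow> int p dvd i"
proof
  assume "z [^] i = \<one>"
  then show "int p dvd i"
    using int_pow_mem_imp_dvd[OF prime_p triv_subgroup z_carrier, of i] z_not_one z_pow by simp
next
  assume "int p dvd i"
  then obtain k where "i = int p * k" by blast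
  then have "z [^] i = (z [^] p) [^] k" by (simp add: int_pow_int[symmetric] int_pow_pow)
  then show "z [^] i = \<one>" by (simp add: z_pow)
qed

lemma zi_eq: "z [^] (i::int) = z [^] (j::int) \<longleftrightarrow> [i = j] (mod int p)"
proof -
  have "z [^] i = z [^] j \<longleftrightarrow> z [^] (i - j) = \<one>"
    by (simp add: int_pow_diff inv_solve_right')
  then show ?thesis by (simp add: zi_one cong_iff_dvd_diff)
qed

lemma zi_pow: "(z [^] (i::int)) [^] p = \<one>"
  by (simp add: int_pow_int[symmetric] int_pow_pow zi_one)

text \<open>A cyclic centre has only one subgroup of order \<open>p\<close>. The subgroup
  \<open>H\<close> contains a nontrivial central element, hence a central element of order
  \<open>p\<close>; this is a power of \<open>z\<close> and generates \<open>z\<close> in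
  turn.\<close>

lemma z_in_normal:
  assumes H: "subgroup H G" and cjH: "\<And>g h. g \<in> carrier G \<Longrightarrow> h \<in> H \<Longrightarrow> cj g h \<in> H" and nt: "H \<noteq> {\<one>}"
  shows "z \<in> H"
proof (rule ccontr)
  assume zH: "z \<notin> H"
  obtain x where x: "x \<in> H" "x \<noteq> \<one>" "x \<in> Z" using normal_meets_Z[OF assms] by blast
  have xc: "x \<in> carrier G" using x Z_carrier by blast
  obtain k where k: "ord x = p ^ k" using ord_p_power xc by blast
  have "k \<noteq> 0" using k x ord_eq_1[OF xc] by (metis power_0)
  then have op: "ord x = p ^ (k - 1) * p" using k by (metis mult.commute power_eq_if)
  define y where "y = x [^] (p ^ (k - 1))"
  have y: "y \<in> H" "y \<in> Z"
    using x subgroup_int_pow_closed[OF H, of x] subgroup_int_pow_closed[OF Z_subgroup, of x]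
    unfolding y_def by (metis int_pow_int)+
  have "y [^] p = \<one>" using xc op pow_ord_eq_1[OF xc] by (simp add: y_def nat_pow_pow)
  then obtain i :: int where i: "y = z [^] i" using Z_order_p y by blast
  have "int p dvd i" using int_pow_mem_imp_dvd[OF prime_p H z_carrier zH, of i] z_pow y(1) i H
    by (simp add: subgroup.one_closed)
  then have "y = \<one>" using i zi_one by simp
  then have "p ^ (k - 1) * p dvd p ^ (k - 1)" using pow_eq_id[OF xc, of "p ^ (k - 1)"] op by (simp add: y_def)
  then have "p ^ k dvd p ^ (k - 1)" using op k by simp
  then show False using \<open>k \<noteq> 0\<close> prime_p by (simp add: power_dvd_imp_le prime_gt_1_nat dvd_power_iff_le prime_ge_2_nat)
qed

lemma frattini_gens_carrier: "frattini_gens p \<subseteq> carrier G"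
  by (auto simp: frattini_gens_def)

lemma Phi_sub: "subgroup Phi G"
  unfolding Phi_def by (rule generate_is_subgroup[OF frattini_gens_carrier])

lemma Phi_carrier: "x \<in> Phi \<Longrightarrow> x \<in> carrier G"
  using Phi_sub subgroup.mem_carrier by fast

lemma Phi_comm: "a \<in> carrier G \<Longrightarrow> b \<in> carrier G \<Longrightarrow> a \<otimes> b \<otimes> inv a \<otimes> inv b \<in> Phi"
  unfolding Phi_def frattini_gens_def by (rule generate.incl) blast

lemma Phi_pow: "a \<in> carrier G \<Longrightarrow> a [^] p \<in> Phi"
  unfolding Phi_def frattini_gens_def by (rule generate.incl) blast

lemma Phi_kap: "a \<in> carrier G \<Longrightarrow> b \<in> carrier G \<Longrightarrow> kap a b \<in> Phi"
  using Phi_comm[of "inv b" a] by (simp add: kap_inv)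

lemma Phi_least:
  assumes "subgroup H G" "\<And>a b. a \<in> carrier G \<Longrightarrow> b \<in> carrier G \<Longrightarrow> a \<otimes> b \<otimes> inv a \<otimes> inv b \<in> H"
    "\<And>a. a \<in> carrier G \<Longrightarrow> a [^] p \<in> H"
  shows "Phi \<subseteq> H"
proof -
  have "frattini_gens p \<subseteq> H" using assms(2,3) by (auto simp: frattini_gens_def)
  then show ?thesis unfolding Phi_def by (rule generate_subgroup_incl[OF _ assms(1)])
qed

lemma N_Phi: "n \<in> N \<Longrightarrow> n \<in> Phi"
  using N_le by (auto simp: Phi_def)

lemma N_carrier: "n \<in> N \<Longrightarrow> n \<in> carrier G"
  using N_Phi Phi_carrier by blast

lemma kap_Phi_N: "x \<in> Phi \<Longrightarrow> g \<in> carrier G \<Longrightarrow> kap x g \<in> N"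
  using N_kap by (simp add: Phi_def)

lemma Phi_cj: "g \<in> carrier G \<Longrightarrow> x \<in> Phi \<Longrightarrow> cj g x \<in> Phi"
  using Phi_kap[of x g] Phi_carrier[of x] by (simp add: cj_eq_kap subgroup.m_closed[OF Phi_sub])

lemma z_Phi: "z \<in> Phi"
proof (rule z_in_normal[OF Phi_sub Phi_cj])
  obtain a b where ab: "a \<in> carrier G" "b \<in> carrier G" "a \<otimes> b \<noteq> b \<otimes> a" using noncomm by blast
  then have "kap a b \<noteq> \<one>" by (simp add: kap_eq_one)
  then show "Phi \<noteq> {\<one>}" using Phi_kap ab by blast
qed

section \<open>Homomorphisms to the prime field and the second centre\<close>

abbreviation hm where "hm \<equiv> fphom p (carrier G)"

lemmas hmD = fphomD[where S = "carrier G"]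

lemma hm_Phi:
  assumes f: "hm f" and x: "x \<in> Phi"
  shows "[f x = 0] (mod int p)"
proof -
  let ?K = "{x \<in> carrier G. [f x = 0] (mod int p)}"
  have "subgroup ?K G"
  proof (rule subgroupI)
    show "?K \<noteq> {}" using fphom_one[OF f subgroup_self] by auto
    fix a assume a: "a \<in> ?K"
    then show "inv a \<in> ?K" using fphom_inv[OF f subgroup_self, of a]
      unfolding cong_iff_dvd_diff by simp Groebner_Basis.algebra
    fix b assume b: "b \<in> ?K"
    then show "a \<otimes> b \<in> ?K" using a fphomD[OF f, of a b]
      by (simp add: cong_iff_dvd_diff) Groebner_Basis.algebra
  qed auto
  moreover have "a \<otimes> b \<otimes> inv a \<otimes> inv b \<in> ?K" if "a \<in> carrier G" "b \<in> carrier G" for a b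
    using fphomD[OF f, of "a \<otimes> b \<otimes> inv a" "inv b"] fphomD[OF f, of "a \<otimes> b" "inv a"] fphomD[OF f, of a b]
      fphom_inv[OF f subgroup_self, of a] fphom_inv[OF f subgroup_self, of b] that
    by (simp add: cong_iff_dvd_diff) Groebner_Basis.algebra
  moreover have "a [^] p \<in> ?K" if "a \<in> carrier G" for a
    using fphom_pow[OF f subgroup_self that, of p] that
    by (simp add: cong_iff_dvd_diff) Groebner_Basis.algebra
  ultimately have "Phi \<subseteq> ?K" by (rule Phi_least)
  then show ?thesis using x by blast
qed

lemma hm_separation:
  assumes "x \<in> carrier G" "x \<notin> Phi"
  shows "\<exists>f. hm f \<and> [f x = 1] (mod int p)"
  using fphom_separation[OF prime_p half subgroup_self fin Phi_sub _ Phi_comm Phi_pow assms] Phi_carrier by blast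

text \<open>\<open>lin u f\<close> says that \<open>u\<close> lies in the second centre and that \<open>f\<close> is its commutator homomorphism to \<open>\<langle>z\<rangle>\<close>.\<close>

definition lin :: "'a \<Rightarrow> ('a \<Rightarrow> int) \<Rightarrow> bool" where
  "lin u f \<longleftrightarrow> u \<in> carrier G \<and> (\<forall>g \<in> carrier G. kap u g = z [^] f g)"

lemma lin_carrier: "lin u f \<Longrightarrow> u \<in> carrier G" and lin_kap: "lin u f \<Longrightarrow> g \<in> carrier G \<Longrightarrow> kap u g = z [^] f g"
  by (simp_all add: lin_def)

lemma lin_hm: "lin u f \<Longrightarrow> hm f"
  unfolding fphom_def
proof (intro ballI)
  fix g h assume u: "lin u f" and gh: "g \<in> carrier G" "h \<in> carrier G"
  have "z [^] f (g \<otimes> h) = cj h (kap u g) \<otimes> kap u h"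
    using u gh by (simp add: lin_kap[symmetric] lin_carrier kap_mult_right)
  also have "\<dots> = z [^] (f g + f h)"
    using u gh by (simp add: lin_kap Z_cj[OF zi_Z] int_pow_mult)
  finally show "[f (g \<otimes> h) = f g + f h] (mod int p)" by (simp add: zi_eq)
qed

lemma lin_cong: "lin u f \<Longrightarrow> (\<And>g. g \<in> carrier G \<Longrightarrow> [f g = h g] (mod int p)) \<Longrightarrow> lin u h"
  by (auto simp: lin_def zi_eq)

lemma lin_mult: "lin u f \<Longrightarrow> lin v h \<Longrightarrow> lin (u \<otimes> v) (\<lambda>g. f g + h g)"
  unfolding lin_def
proof (intro conjI ballI; (elim conjE)?)
  fix g assume u: "u \<in> carrier G" "\<forall>g\<in>carrier G. kap u g = z [^] f g"
    and v: "v \<in> carrier G" "\<forall>g\<in>carrier G. kap v g = z [^] h g" and g: "g \<in> carrier G"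
  have "u \<otimes> z [^] h g \<otimes> inv u = z [^] h g"
    unfolding Z_comm[OF zi_Z u(1), of "h g", symmetric] using u(1) by (simp add: m_assoc)
  then show "kap (u \<otimes> v) g = z [^] (f g + h g)"
    using u v g by (simp add: kap_mult_left int_pow_mult)
qed simp

lemma lin_Z: "c \<in> Z \<Longrightarrow> lin c (\<lambda>g. 0)"
  using Z_comm[of c] by (simp add: lin_def Z_carrier kap_eq_one)

lemma lin_pow: "lin u f \<Longrightarrow> lin (u [^] (n::nat)) (\<lambda>g. int n * f g)"
proof (induction n)
  case 0
  show ?case using lin_Z[OF one_closed_Z] by simp
next
  case (Suc n)
  then show ?case using lin_mult[of "u [^] n" "\<lambda>g. int n * f g" u f] by (simp add: algebra_simps)
qed

lemma lin_comm: "lin u f \<Longrightarrow> g \<in> carrier G \<Longrightarrow> u \<otimes> g = g \<otimes> u \<longleftrightarrow> [f g = 0] (mod int p)"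
  using kap_eq_one[of u g] zi_one[of "f g"] by (simp add: lin_def cong_iff_dvd_diff)

lemma lin_cent_Phi: "lin u f \<Longrightarrow> u \<in> cent Phi"
  using lin_comm hm_Phi lin_hm Phi_carrier by (simp add: cent_iff lin_carrier)

lemma lin_self: "lin u f \<Longrightarrow> [f u = 0] (mod int p)"
  using lin_comm lin_carrier by blast

lemma lin_zero_Z: "lin u f \<Longrightarrow> (\<And>g. g \<in> carrier G \<Longrightarrow> [f g = 0] (mod int p)) \<Longrightarrow> u \<in> Z"
  using lin_comm by (auto simp: Z_iff lin_carrier)

lemma lin_pow_Z: "lin u f \<Longrightarrow> u [^] p \<in> Z"
  by (rule lin_zero_Z[OF lin_pow]) (auto simp: cong_iff_dvd_diff)

text \<open>Central values turn the homomorphism \<open>g \<mapsto> z [^] f g\<close> into a crossed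
  one, and it is trivial on its own values because \<open>z\<close> lies in \<open>Phi\<close>,
  where every homomorphism to the prime field vanishes.\<close>

lemma ex_lin:
  assumes f: "hm f" shows "\<exists>u. lin u f"
proof -
  have 1: "[f (z [^] (i::int)) = 0] (mod int p)" for i
    using hm_Phi[OF f] subgroup_int_pow_closed[OF Phi_sub z_Phi] by blast
  have "\<exists>y \<in> carrier G. \<forall>g \<in> carrier G. z [^] f g = kap y g"
  proof (rule auto_of_crossed_hom[OF fin prime_p noninn])
    fix g h assume "g \<in> carrier G" "h \<in> carrier G"
    then show "z [^] f (g \<otimes> h) = cj h (z [^] f g) \<otimes> z [^] f h"
      using hmD[OF f, of g h] by (simp add: Z_cj[OF zi_Z] int_pow_mult[symmetric] zi_eq)
  qed (use 1 zi_pow in \<open>auto simp: zi_one cong_iff_dvd_diff\<close>)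
  then show ?thesis by (auto simp: lin_def)
qed

section \<open>Adjusting p-th powers\<close>

lemma ex_inverse_mod: "\<not> [c = 0] (mod int p) \<Longrightarrow> \<exists>k. [c * k = 1] (mod int p)"
  using prime_p cong_solve_coprime_int[of c "int p"]
  by (metis cong_0_iff coprime_commute prime_imp_coprime prime_nat_int_transfer)

lemma pow_mult_inv_Z:
  assumes x: "x \<in> carrier G" and c: "c \<in> Z" "x [^] p = c [^] p"
  shows "inv c \<in> Z" "(x \<otimes> inv c) [^] p = \<one>"
proof -
  show ic: "inv c \<in> Z" by (rule subgroup.m_inv_closed[OF Z_subgroup c(1)])
  note cc = Z_carrier[OF c(1)]
  have "(x \<otimes> inv c) [^] p = x [^] p \<otimes> (inv c) [^] p"
    by (rule pow_mult_distrib[OF Z_comm[OF ic x, symmetric] x inv_closed[OF cc]])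
  then show "(x \<otimes> inv c) [^] p = \<one>" using c cc by (simp add: nat_pow_inv)
qed

text \<open>In the cyclic centre the \<open>p\<close>-th powers have index at most \<open>p\<close>,
  so the coset of \<open>d\<close> generates the quotient. In terms of exponents of
  \<open>\<zeta>\<close>, the congruence \<open>a + b * i = 0\<close> modulo \<open>p\<close> is
  solved for \<open>i\<close>.\<close>

lemma Z_power_correction:
  assumes c: "c \<in> Z" "d \<in> Z" and d: "\<And>e. e \<in> Z \<Longrightarrow> d \<noteq> e [^] p"
  shows "\<exists>i::nat. \<exists>e \<in> Z. c \<otimes> d [^] i = e [^] p"
proof -
  obtain a b :: int where ab: "c = \<zeta> [^] a" "d = \<zeta> [^] b" using c Z_zeta by blast
  have "\<not> int p dvd b"
  proof
    assume "int p dvd b"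
    then obtain k where "b = int p * k" by blast
    then have "d = (\<zeta> [^] k) [^] p" using ab center_cyclic(1)
      by (simp add: int_pow_int[symmetric] int_pow_pow mult.commute)
    then show False using d Z_zeta by blast
  qed
  then obtain j where j: "[b * j = 1] (mod int p)" using ex_inverse_mod by (auto simp: cong_0_iff)
  define k where "k = - (j * a)"
  have "[b * k = - a] (mod int p)" using j unfolding k_def cong_iff_dvd_diff by Groebner_Basis.algebra
  define i where "i = nat (k mod int p)"
  have ik: "int i = k mod int p" using prime_p by (simp add: i_def prime_gt_0_nat)
  have "[a + b * int i = 0] (mod int p)"
  proof -
    have "[int i = k] (mod int p)" by (simp add: ik)
    then show ?thesis using \<open>[b * k = - a] (mod int p)\<close> unfolding cong_iff_dvd_diff by Groebner_Basis.algebra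
  qed
  then obtain m where "a + b * int i = int p * m" by (auto simp: cong_iff_dvd_diff)
  then have "c \<otimes> d [^] i = (\<zeta> [^] m) [^] p"
    using ab center_cyclic(1) by (simp add: int_pow_int[symmetric] int_pow_pow int_pow_mult[symmetric] mult.commute)
  then show ?thesis using Z_zeta by blast
qed

lemma p_choose_2: "p dvd (p choose 2)"
proof -
  obtain m where "p = Suc (2 * m)" using odd_p by (auto elim: oddE)
  then have "p choose 2 = p * m" by (simp add: choose_two)
  then show ?thesis by simp
qed

lemma pow_p_mult:
  assumes x: "x \<in> carrier G" and v: "v \<in> carrier G" and k: "k \<in> Z" "k [^] p = \<one>" and vx: "v \<otimes> x = x \<otimes> v \<otimes> k"
  shows "(x \<otimes> v) [^] p = x [^] p \<otimes> v [^] p"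
proof -
  have kc: "k \<in> carrier G" using k Z_carrier by blast
  obtain m where m: "p choose 2 = p * m" using p_choose_2 by blast
  have "k [^] (p choose 2) = \<one>" unfolding m using kc k by (simp add: nat_pow_pow[symmetric])
  then show ?thesis using pow_mult_class2[OF x v kc vx Z_comm[OF k(1) x] Z_comm[OF k(1) v], of p] x v by simp
qed

text \<open>Since the centre is cyclic, all elements with central \<open>p\<close>-th power can be brought to order \<open>p\<close> by means of a
  single \<open>v\<close> for which this fails.\<close>

lemma power_correction:
  assumes x: "x \<in> carrier G" "x [^] p \<in> Z" and v: "v \<in> carrier G" "v [^] p \<in> Z"
    and vp: "\<And>e. e \<in> Z \<Longrightarrow> v [^] p \<noteq> e [^] p" and vx: "v \<otimes> x = x \<otimes> v \<otimes> z [^] (j::int)"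
  shows "\<exists>i::nat. \<exists>c \<in> Z. (x \<otimes> v [^] i \<otimes> c) [^] p = \<one>"
proof -
  obtain i e where i: "e \<in> Z" "x [^] p \<otimes> (v [^] p) [^] (i::nat) = e [^] p"
    using Z_power_correction[OF x(2) v(2) vp] by blast
  have ec: "e \<in> carrier G" using i Z_carrier by blast
  have vi: "v [^] n \<otimes> x = x \<otimes> v [^] n \<otimes> z [^] (j * int n)" for n :: nat
  proof (induction n)
    case (Suc n)
    have "v [^] Suc n \<otimes> x = v [^] n \<otimes> (v \<otimes> x)" using x v by (simp add: m_assoc)
    also have "\<dots> = (v [^] n \<otimes> x) \<otimes> (v \<otimes> z [^] j)" unfolding vx using x v by (simp add: m_assoc)
    also have "\<dots> = x \<otimes> v [^] n \<otimes> (z [^] (j * int n) \<otimes> v) \<otimes> z [^] j" unfolding Suc using x v by (simp add: m_assoc)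
    also have "\<dots> = x \<otimes> v [^] n \<otimes> (v \<otimes> z [^] (j * int n)) \<otimes> z [^] j" using Z_comm[OF zi_Z v(1)] by simp
    also have "\<dots> = x \<otimes> v [^] Suc n \<otimes> (z [^] (j * int n) \<otimes> z [^] j)" using x v by (simp add: m_assoc)
    also have "z [^] (j * int n) \<otimes> z [^] j = z [^] (j * int (Suc n))"
      by (simp add: int_pow_mult[symmetric] algebra_simps)
    finally show ?case .
  qed (use x in simp)
  have "(x \<otimes> v [^] i) [^] p = x [^] p \<otimes> (v [^] i) [^] p"
    by (rule pow_p_mult[OF x(1) _ zi_Z zi_pow vi]) (use v in simp)
  also have "\<dots> = e [^] p" using i(2) v by (simp add: nat_pow_pow mult.commute)
  finally have 1: "(x \<otimes> v [^] i) [^] p = e [^] p" .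
  have ie: "inv e \<in> Z" using Z_subgroup i subgroup.m_inv_closed by fast
  have "(x \<otimes> v [^] i \<otimes> inv e) [^] p = (x \<otimes> v [^] i) [^] p \<otimes> (inv e) [^] p"
    by (rule pow_p_mult[OF _ _ one_closed_Z]) (use x v ec Z_comm[OF ie] in auto)
  also have "\<dots> = \<one>" unfolding 1 using ec by (simp add: nat_pow_inv)
  finally show ?thesis using ie by blast
qed

section \<open>Elementary abelian normal subgroups as modules of functions\<close>

text \<open>If \<open>func A l\<close> holds, then mapping \<open>a\<close> to the function \<open>x \<mapsto> l (x^-1 a x)\<close> embeds the elementary abelian normal
  subgroup \<open>A\<close> into the functions from \<open>G\<close> to the prime field, because every nontrivial normal subgroup contains
  \<open>z\<close>; \<open>rep B l\<close> singles out the functions that come from \<open>B\<close>.\<close>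

definition elem :: "'a set \<Rightarrow> bool" where
  "elem A \<longleftrightarrow> subgroup A G \<and> (\<forall>g \<in> carrier G. \<forall>a \<in> A. cj g a \<in> A) \<and> (\<forall>a \<in> A. \<forall>b \<in> A. a \<otimes> b = b \<otimes> a)
     \<and> (\<forall>a \<in> A. a [^] p = \<one>) \<and> z \<in> A"

definition func :: "'a set \<Rightarrow> ('a \<Rightarrow> int) \<Rightarrow> bool" where
  "func A l \<longleftrightarrow> elem A \<and> fphom p A l \<and> [l z = 1] (mod int p)"

definition rep :: "'a set \<Rightarrow> ('a \<Rightarrow> int) \<Rightarrow> ('a \<Rightarrow> int) \<Rightarrow> bool" where
  "rep A l F \<longleftrightarrow> (\<exists>a \<in> A. \<forall>x \<in> carrier G. [F x = l (cj x a)] (mod int p))"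

lemma elem_sub: "elem A \<Longrightarrow> subgroup A G" and elem_cj: "elem A \<Longrightarrow> g \<in> carrier G \<Longrightarrow> a \<in> A \<Longrightarrow> cj g a \<in> A"
  and elem_comm: "elem A \<Longrightarrow> a \<in> A \<Longrightarrow> b \<in> A \<Longrightarrow> a \<otimes> b = b \<otimes> a"
  and elem_pow: "elem A \<Longrightarrow> a \<in> A \<Longrightarrow> a [^] p = \<one>" and elem_z: "elem A \<Longrightarrow> z \<in> A"
  unfolding elem_def by blast+

lemma elem_carrier: "elem A \<Longrightarrow> a \<in> A \<Longrightarrow> a \<in> carrier G"
  using elem_sub subgroup.mem_carrier by fast

lemma elem_m: "elem A \<Longrightarrow> a \<in> A \<Longrightarrow> b \<in> A \<Longrightarrow> a \<otimes> b \<in> A"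
  using elem_sub subgroup.m_closed by fast

lemma elem_inv: "elem A \<Longrightarrow> a \<in> A \<Longrightarrow> inv a \<in> A"
  using elem_sub subgroup.m_inv_closed by fast

lemma elem_int_pow: "elem A \<Longrightarrow> a \<in> A \<Longrightarrow> a [^] (i::int) \<in> A"
  using elem_sub subgroup_int_pow_closed by blast

lemma func_elem: "func A l \<Longrightarrow> elem A" and func_hom: "func A l \<Longrightarrow> fphom p A l" and func_z: "func A l \<Longrightarrow> [l z = 1] (mod int p)"
  by (simp_all add: func_def)

lemma ex_func:
  assumes A: "elem A" shows "\<exists>l. func A l"
proof -
  have finA: "finite A" using elem_carrier[OF A] fin by (meson finite_subset subsetI)
  have "\<exists>f. fphom p A f \<and> (\<forall>m \<in> {\<one>}. [f m = 0] (mod int p)) \<and> [f z = 1] (mod int p)"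
  proof (rule fphom_separation[OF prime_p half elem_sub[OF A] finA triv_subgroup])
    show "{\<one>} \<subseteq> A" using elem_sub[OF A] subgroup.one_closed by blast
    fix a b assume "a \<in> A" "b \<in> A"
    then have "a \<otimes> b \<otimes> inv a \<otimes> inv b = (b \<otimes> a) \<otimes> inv a \<otimes> inv b" "a \<in> carrier G" "b \<in> carrier G"
      using elem_comm[OF A] elem_carrier[OF A] by auto
    then show "a \<otimes> b \<otimes> inv a \<otimes> inv b \<in> {\<one>}" by (simp add: m_assoc inv_r_cancel)
  qed (use elem_pow[OF A] z_not_one elem_z[OF A] in auto)
  then show ?thesis using A by (auto simp: func_def)
qed

lemma func_cj_mult:
  assumes l: "func A l" and a: "a \<in> A" "b \<in> A" and x: "x \<in> carrier G"
  shows "[l (cj x (a \<otimes> b)) = l (cj x a) + l (cj x b)] (mod int p)"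
  using fphomD[OF func_hom[OF l] elem_cj[OF func_elem[OF l] x a(1)] elem_cj[OF func_elem[OF l] x a(2)]]
    elem_carrier[OF func_elem[OF l]] a x by (simp add: cj_mult)

lemma func_cj_int_pow:
  assumes l: "func A l" and a: "a \<in> A" and x: "x \<in> carrier G"
  shows "[l (cj x (a [^] (i::int))) = i * l (cj x a)] (mod int p)"
  using fphom_int_pow[OF func_hom[OF l] elem_sub[OF func_elem[OF l]] elem_cj[OF func_elem[OF l] x a]]
    elem_carrier[OF func_elem[OF l]] a x by (simp add: cj_int_pow)

lemma func_cj_inv:
  assumes l: "func A l" and a: "a \<in> A" and x: "x \<in> carrier G"
  shows "[l (cj x (inv a)) = - l (cj x a)] (mod int p)"
  using fphom_inv[OF func_hom[OF l] elem_sub[OF func_elem[OF l]] elem_cj[OF func_elem[OF l] x a]]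
    elem_carrier[OF func_elem[OF l]] a x by (simp add: cj_inv)

lemma func_zi:
  assumes l: "func A l" and x: "x \<in> carrier G"
  shows "[l (cj x (z [^] (i::int))) = i] (mod int p)"
  using func_cj_int_pow[OF l elem_z[OF func_elem[OF l]] x, of i, unfolded Z_cj[OF z_Z x]] func_z[OF l]
  unfolding cong_iff_dvd_diff by Groebner_Basis.algebra

lemma one_not_cong: "\<not> [(1::int) = 0] (mod int p)"
  using prime_gt_1_nat[OF prime_p] by (simp add: cong_0_iff)

lemma func_inj:
  assumes l: "func A l" and a: "a \<in> A" and a0: "\<And>x. x \<in> carrier G \<Longrightarrow> [l (cj x a) = 0] (mod int p)"
  shows "a = \<one>"
proof -
  note A = func_elem[OF l]
  let ?B = "{b \<in> A. \<forall>x \<in> carrier G. [l (cj x b) = 0] (mod int p)}"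
  have Bs: "subgroup ?B G"
  proof (rule subgroupI)
    show "?B \<subseteq> carrier G" using elem_carrier[OF A] by blast
    show "?B \<noteq> {}" using a a0 by blast
    fix b assume b: "b \<in> ?B"
    show "inv b \<in> ?B"
    proof (intro CollectI conjI ballI)
      show "inv b \<in> A" using elem_inv[OF A] b by simp
      fix x assume x: "x \<in> carrier G"
      have bA: "b \<in> A" and "[l (cj x b) = 0] (mod int p)" using b x by blast+
      then have "[- l (cj x b) = 0] (mod int p)" by (simp add: cong_0_iff)
      then show "[l (cj x (inv b)) = 0] (mod int p)" by (rule cong_trans[OF func_cj_inv[OF l bA x]])
    qed
    fix c assume c: "c \<in> ?B"
    show "b \<otimes> c \<in> ?B"
    proof (intro CollectI conjI ballI)
      show "b \<otimes> c \<in> A" using elem_m[OF A] b c by simp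
      fix x assume x: "x \<in> carrier G"
      have bc: "b \<in> A" "c \<in> A" and "[l (cj x b) = 0] (mod int p)" "[l (cj x c) = 0] (mod int p)" using b c x by blast+
      then have "[l (cj x b) + l (cj x c) = 0] (mod int p)" by (simp add: cong_0_iff)
      then show "[l (cj x (b \<otimes> c)) = 0] (mod int p)" by (rule cong_trans[OF func_cj_mult[OF l bc x]])
    qed
  qed
  have Bc: "cj g b \<in> ?B" if g: "g \<in> carrier G" and b: "b \<in> ?B" for g b
  proof (intro CollectI conjI ballI)
    have bA: "b \<in> A" using b by blast
    show "cj g b \<in> A" using elem_cj[OF A g bA] .
    fix x assume x: "x \<in> carrier G"
    show "[l (cj x (cj g b)) = 0] (mod int p)"
      unfolding cj_cj[OF x g elem_carrier[OF A bA]] using b m_closed[OF g x] by blast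
  qed
  have "z \<notin> ?B"
  proof
    assume "z \<in> ?B"
    then have "[l (cj \<one> z) = 0] (mod int p)" by blast
    then have "[l z = 0] (mod int p)" by simp
    then show False using cong_trans[OF cong_sym[OF func_z[OF l]]] one_not_cong by blast
  qed
  then have "?B = {\<one>}" using z_in_normal[OF Bs Bc] by blast
  moreover have "a \<in> ?B" using a a0 by simp
  ultimately show ?thesis by blast
qed

lemma func_eq:
  assumes l: "func A l" and ab: "a \<in> A" "b \<in> A"
    and eq: "\<And>x. x \<in> carrier G \<Longrightarrow> [l (cj x a) = l (cj x b)] (mod int p)"
  shows "a = b"
proof -
  note A = func_elem[OF l]
  have "a \<otimes> inv b = \<one>"
  proof (rule func_inj[OF l elem_m[OF A ab(1) elem_inv[OF A ab(2)]]])
    fix x assume x: "x \<in> carrier G"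
    show "[l (cj x (a \<otimes> inv b)) = 0] (mod int p)"
      using func_cj_mult[OF l ab(1) elem_inv[OF A ab(2)] x] func_cj_inv[OF l ab(2) x] eq[OF x]
      unfolding cong_iff_dvd_diff by Groebner_Basis.algebra
  qed
  then show ?thesis using elem_carrier[OF A] ab by (simp add: inv_solve_right')
qed

lemma rep_cong: "rep A l F \<Longrightarrow> (\<And>x. x \<in> carrier G \<Longrightarrow> [H x = F x] (mod int p)) \<Longrightarrow> rep A l H"
  unfolding rep_def by (meson cong_trans)

lemma rep_add:
  assumes l: "func A l" and B: "subgroup B G" "B \<subseteq> A" and F: "rep B l F" and H: "rep B l H"
  shows "rep B l (\<lambda>x. F x + H x)"
proof -
  obtain a b where ab: "a \<in> B" "\<forall>x \<in> carrier G. [F x = l (cj x a)] (mod int p)"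
    "b \<in> B" "\<forall>x \<in> carrier G. [H x = l (cj x b)] (mod int p)"
    using F H unfolding rep_def by blast
  have aA: "a \<in> A" "b \<in> A" using ab B by auto
  have "[F x + H x = l (cj x (a \<otimes> b))] (mod int p)" if x: "x \<in> carrier G" for x
    by (rule cong_trans[OF cong_add[OF bspec[OF ab(2) x] bspec[OF ab(4) x]] cong_sym[OF func_cj_mult[OF l aA x]]])
  moreover have "a \<otimes> b \<in> B" using ab B subgroup.m_closed by fast
  ultimately show ?thesis unfolding rep_def by blast
qed

lemma rep_scale:
  assumes l: "func A l" and B: "subgroup B G" "B \<subseteq> A" and F: "rep B l F"
  shows "rep B l (\<lambda>x. c * F x)"
proof -
  obtain a where a: "a \<in> B" "\<forall>x \<in> carrier G. [F x = l (cj x a)] (mod int p)"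
    using F unfolding rep_def by blast
  have aA: "a \<in> A" using a B by auto
  have "[c * F x = l (cj x (a [^] c))] (mod int p)" if x: "x \<in> carrier G" for x
    by (rule cong_trans[OF cong_scalar_left[OF bspec[OF a(2) x]] cong_sym[OF func_cj_int_pow[OF l aA x]]])
  moreover have "a [^] c \<in> B" by (rule subgroup_int_pow_closed[OF B(1) a(1)])
  ultimately show ?thesis unfolding rep_def by blast
qed

lemma rep_const:
  assumes l: "func A l" and B: "subgroup B G" "z \<in> B" shows "rep B l (\<lambda>x. c)"
  unfolding rep_def using cong_sym[OF func_zi[OF l]] subgroup_int_pow_closed[OF B]
  by (intro bexI[of _ "z [^] c"] ballI) auto

lemma lin_func:
  assumes l: "func A l" and u: "lin u f" "u \<in> A" and x: "x \<in> carrier G"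
  shows "[l (cj x u) = f x + l u] (mod int p)"
proof -
  have "cj x u = z [^] f x \<otimes> u" using u x by (simp add: cj_eq_kap lin_kap lin_carrier)
  moreover have "[l (z [^] f x) = f x] (mod int p)" using func_zi[OF l one_closed, of "f x"] by simp
  moreover have "[l (z [^] f x \<otimes> u) = l (z [^] f x) + l u] (mod int p)"
    by (rule fphomD[OF func_hom[OF l] elem_int_pow[OF func_elem[OF l] elem_z[OF func_elem[OF l]]] u(2)])
  ultimately show ?thesis by (metis cong_add_rcancel cong_trans)
qed

lemma rep_lin:
  assumes l: "func A l" and B: "subgroup B G" "B \<subseteq> A" "z \<in> B" and u: "lin u f" "u \<in> B"
  shows "rep B l f"
proof -
  have "rep B l (\<lambda>x. l (cj x u))" unfolding rep_def using u by (intro bexI[of _ u]) auto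
  then have "rep B l (\<lambda>x. l (cj x u) + (- l u))" using rep_add[OF l B(1,2)] rep_const[OF l B(1,3)] by blast
  then show ?thesis
  proof (rule rep_cong)
    fix x assume x: "x \<in> carrier G"
    have "u \<in> A" using u B by blast
    from lin_func[OF l u(1) this x] show "[f x = l (cj x u) + - l u] (mod int p)"
      unfolding cong_iff_dvd_diff by Groebner_Basis.algebra
  qed
qed

text \<open>Splitting \<open>F (g h x) - F x\<close> at \<open>F (h x)\<close> is the crossed
  homomorphism rule, carried back to \<open>A\<close> by the injectivity of the embedding.
  Invariance under \<open>A\<close> says that elements of \<open>A\<close> have zero difference,
  which is the condition \<open>d (d g) = \<one>\<close>.\<close>

lemma crossed_hom_of_function:
  assumes l: "func A l" and F: "\<And>g. g \<in> carrier G \<Longrightarrow> rep A l (\<lambda>x. F (g \<otimes> x) - F x)"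
    and FA: "\<And>a x. a \<in> A \<Longrightarrow> x \<in> carrier G \<Longrightarrow> [F (a \<otimes> x) = F x] (mod int p)"
  shows "\<exists>y \<in> carrier G. \<forall>g \<in> carrier G. kap y g \<in> A \<and>
    (\<forall>x \<in> carrier G. [F (g \<otimes> x) - F x = l (cj x (kap y g))] (mod int p))"
proof -
  note A = func_elem[OF l]
  obtain d where d: "\<And>g. g \<in> carrier G \<Longrightarrow> d g \<in> A"
    and dF: "\<And>g x. g \<in> carrier G \<Longrightarrow> x \<in> carrier G \<Longrightarrow> [F (g \<otimes> x) - F x = l (cj x (d g))] (mod int p)"
    using F unfolding rep_def by metis
  have "\<exists>y \<in> carrier G. \<forall>g \<in> carrier G. d g = kap y g"
  proof (rule auto_of_crossed_hom[OF fin prime_p noninn])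
    fix g assume g: "g \<in> carrier G"
    show "d g \<in> carrier G" using elem_carrier[OF A d[OF g]] .
    show "d g [^] p = \<one>" using elem_pow[OF A d[OF g]] .
    show "d (d g) = \<one>"
    proof (rule func_inj[OF l d[OF elem_carrier[OF A d[OF g]]]])
      fix x assume x: "x \<in> carrier G"
      show "[l (cj x (d (d g))) = 0] (mod int p)"
        using dF[OF elem_carrier[OF A d[OF g]] x] FA[OF d[OF g] x]
        unfolding cong_iff_dvd_diff by Groebner_Basis.algebra
    qed
    fix h assume h: "h \<in> carrier G"
    have c: "cj h (d g) \<in> A" by (rule elem_cj[OF A h d[OF g]])
    show "d (g \<otimes> h) = cj h (d g) \<otimes> d h"
    proof (rule func_eq[OF l d elem_m[OF A c d[OF h]]])
      fix x assume x: "x \<in> carrier G"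
      have "[l (cj x (cj h (d g))) = F (g \<otimes> (h \<otimes> x)) - F (h \<otimes> x)] (mod int p)"
        using dF[OF g m_closed[OF h x]] elem_carrier[OF A d[OF g]] h x by (simp add: cj_cj cong_sym_eq)
      moreover have "[F (g \<otimes> (h \<otimes> x)) - F x = l (cj x (d (g \<otimes> h)))] (mod int p)"
        using dF[OF m_closed[OF g h] x] g h x by (simp add: m_assoc)
      ultimately show "[l (cj x (d (g \<otimes> h))) = l (cj x (cj h (d g) \<otimes> d h))] (mod int p)"
        using func_cj_mult[OF l c d[OF h] x] dF[OF h x]
        unfolding cong_iff_dvd_diff by Groebner_Basis.algebra
    qed (use g h in simp)
  qed
  then obtain y where y: "y \<in> carrier G" "\<And>g. g \<in> carrier G \<Longrightarrow> d g = kap y g" by blast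
  show ?thesis
    by (intro bexI[OF _ y(1)] ballI conjI) (use y(2) d dF in auto)
qed

lemma elem_zi: "elem (range (\<lambda>i::int. z [^] i))"
proof -
  have "z \<in> range (\<lambda>i::int. z [^] i)" by (intro range_eqI[of _ _ 1]) simp
  moreover have "subgroup (range (\<lambda>i::int. z [^] i)) G"
  proof (rule subgroupI)
    fix a assume "a \<in> range (\<lambda>i::int. z [^] i)"
    then obtain i :: int where "a = z [^] i" by blast
    then have "inv a = z [^] (- i)" by (simp add: int_pow_neg)
    then show "inv a \<in> range (\<lambda>i::int. z [^] i)" by blast
    fix b assume "b \<in> range (\<lambda>i::int. z [^] i)"
    then obtain j :: int where "b = z [^] j" by blast
    then have "a \<otimes> b = z [^] (i + j)" using \<open>a = _\<close> by (simp add: int_pow_mult)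
    then show "a \<otimes> b \<in> range (\<lambda>i::int. z [^] i)" by blast
  qed auto
  moreover have "cj g a \<in> range (\<lambda>i::int. z [^] i)" if "g \<in> carrier G" "a \<in> range (\<lambda>i::int. z [^] i)" for g a
    using that Z_cj[OF zi_Z] by auto
  moreover have "a \<otimes> b = b \<otimes> a" if "a \<in> range (\<lambda>i::int. z [^] i)" "b \<in> range (\<lambda>i::int. z [^] i)" for a b
    using that Z_comm zi_Z Z_carrier by blast
  moreover have "a [^] p = \<one>" if "a \<in> range (\<lambda>i::int. z [^] i)" for a
    using that zi_pow by blast
  ultimately show ?thesis unfolding elem_def by blast
qed

text \<open>By this lemma an element obtained from functions of one degree enters the module used in
  the next degree. The condition \<open>w [^] p = \<one>\<close> is the reason why so much of what
  follows is concerned with correcting orders.\<close>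

lemma elem_adjoin:
  assumes A: "elem A" and w: "w \<in> carrier G" "w [^] p = \<one>" and wA: "\<And>a. a \<in> A \<Longrightarrow> w \<otimes> a = a \<otimes> w"
    and kw: "\<And>g. g \<in> carrier G \<Longrightarrow> kap w g \<in> A"
  shows "elem {a \<otimes> w [^] (i::int) | a i. a \<in> A}" (is "elem ?B")
proof -
  have wi: "w [^] (i::int) \<otimes> a = a \<otimes> w [^] i" if "a \<in> A" for a i
    using comm_int_pow[OF w(1) elem_carrier[OF A that] wA[OF that]] .
  have mult: "(a \<otimes> w [^] i) \<otimes> (b \<otimes> w [^] j) = (a \<otimes> b) \<otimes> w [^] (i + j)"
    if "a \<in> A" "b \<in> A" for a b and i j :: int
  proof -
    have "(a \<otimes> w [^] i) \<otimes> (b \<otimes> w [^] j) = a \<otimes> (w [^] i \<otimes> b) \<otimes> w [^] j"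
      using that elem_carrier[OF A] w by (simp add: m_assoc)
    then show ?thesis unfolding wi[OF that(2)] using that elem_carrier[OF A] w by (simp add: m_assoc int_pow_mult)
  qed
  have one: "\<one> \<in> A" using elem_sub[OF A] subgroup.one_closed by blast
  have "subgroup ?B G"
  proof (rule subgroupI)
    show "?B \<subseteq> carrier G" using elem_carrier[OF A] w by auto
    show "?B \<noteq> {}" using one by blast
    fix b assume "b \<in> ?B"
    then obtain a i where b: "b = a \<otimes> w [^] (i::int)" "a \<in> A" by blast
    have "inv b = w [^] (- i) \<otimes> inv a" using b elem_carrier[OF A] w by (simp add: inv_mult_group int_pow_neg)
    then have "inv b = inv a \<otimes> w [^] (- i)" using wi elem_inv[OF A b(2)] by simp
    then show "inv b \<in> ?B" using elem_inv[OF A b(2)] by blast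
    fix c assume "c \<in> ?B"
    then obtain a' j where c: "c = a' \<otimes> w [^] (j::int)" "a' \<in> A" by blast
    then show "b \<otimes> c \<in> ?B" using mult[OF b(2) c(2)] b elem_m[OF A b(2) c(2)] by blast
  qed
  moreover have "cj g b \<in> ?B" if g: "g \<in> carrier G" and bB: "b \<in> ?B" for g b
  proof -
    obtain a i where b: "b = a \<otimes> w [^] (i::int)" "a \<in> A" using bB by blast
    have "cj g (w [^] i) = (kap w g \<otimes> w) [^] i" using w g by (simp add: cj_int_pow cj_eq_kap[symmetric])
    also have "\<dots> = kap w g [^] i \<otimes> w [^] i"
      using wA[OF kw[OF g]] w g by (intro int_pow_mult_distrib) auto
    finally have "cj g b = (cj g a \<otimes> kap w g [^] i) \<otimes> w [^] i"
      using b elem_carrier[OF A] w g by (simp add: cj_mult m_assoc)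
    moreover have "cj g a \<otimes> kap w g [^] i \<in> A"
      using elem_m[OF A elem_cj[OF A g b(2)] elem_int_pow[OF A kw[OF g]]] .
    ultimately show ?thesis by blast
  qed
  moreover have "b \<otimes> c = c \<otimes> b" if bB: "b \<in> ?B" and cB: "c \<in> ?B" for b c
  proof -
    obtain a i where b: "b = a \<otimes> w [^] (i::int)" "a \<in> A" using bB by blast
    obtain a' j where c: "c = a' \<otimes> w [^] (j::int)" "a' \<in> A" using cB by blast
    show ?thesis unfolding b(1) c(1) mult[OF b(2) c(2)] mult[OF c(2) b(2)]
      using elem_comm[OF A b(2) c(2)] by (simp add: add.commute)
  qed
  moreover have "b [^] p = \<one>" if bB: "b \<in> ?B" for b
  proof -
    obtain a i where b: "b = a \<otimes> w [^] (i::int)" "a \<in> A" using bB by blast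
    have "b [^] p = a [^] p \<otimes> (w [^] i) [^] p"
      unfolding b(1) using wi[OF b(2)] elem_carrier[OF A b(2)] w by (intro pow_mult_distrib) auto
    also have "(w [^] i) [^] p = (w [^] p) [^] i"
      using w(1) by (simp only: int_pow_int[symmetric] int_pow_pow mult.commute)
    finally show ?thesis using elem_pow[OF A b(2)] w by simp
  qed
  moreover have "z \<in> ?B"
  proof -
    have "z = z \<otimes> w [^] (0::int)" by simp
    then show ?thesis using elem_z[OF A] by blast
  qed
  ultimately show ?thesis unfolding elem_def by blast
qed

lemma adjoin_sup: "elem A \<Longrightarrow> w \<in> carrier G \<Longrightarrow> A \<subseteq> {a \<otimes> w [^] (i::int) | a i. a \<in> A}"
proof
  fix a assume a: "elem A" "w \<in> carrier G" "a \<in> A"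
  have "a = a \<otimes> w [^] (0::int)" using elem_carrier[OF a(1,3)] by simp
  then show "a \<in> {a \<otimes> w [^] (i::int) | a i. a \<in> A}" using a(3) by blast
qed

lemma adjoin_mem: "elem A \<Longrightarrow> w \<in> carrier G \<Longrightarrow> w \<in> {a \<otimes> w [^] (i::int) | a i. a \<in> A}"
proof -
  assume a: "elem A" "w \<in> carrier G"
  have "w = \<one> \<otimes> w [^] (1::int)" using a(2) by simp
  then show "w \<in> {a \<otimes> w [^] (i::int) | a i. a \<in> A}" using elem_sub[OF a(1)] subgroup.one_closed by blast
qed

section \<open>The centralizer of the Frattini subgroup\<close>

lemma hm_scale:
  assumes f: "hm f" and g: "g \<in> carrier G" "\<not> [f g = 0] (mod int p)"
  shows "\<exists>h \<in> carrier G. [f h = 1] (mod int p)"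
proof -
  obtain k where "[f g * k = 1] (mod int p)" using ex_inverse_mod[OF g(2)] by blast
  then have "[k * f g = 1] (mod int p)" by (simp add: mult.commute)
  then have "[f (g [^] k) = 1] (mod int p)" by (rule cong_trans[OF fphom_int_pow[OF f subgroup_self g(1)]])
  then show ?thesis by (rule bexI) (use g in simp)
qed

lemma square_mem:
  assumes H: "subgroup H G" and u: "u \<in> carrier G" "u [^] p = \<one>" and i: "(u \<otimes> u) \<otimes> z [^] (i::int) \<in> H" and zH: "z \<in> H"
  shows "u \<in> H"
proof (rule ccontr)
  assume uH: "u \<notin> H"
  have "((u \<otimes> u) \<otimes> z [^] i) \<otimes> z [^] (- i) \<in> H"
    by (rule subgroup.m_closed[OF H i subgroup_int_pow_closed[OF H zH]])
  moreover have "((u \<otimes> u) \<otimes> z [^] i) \<otimes> z [^] (- i) = u \<otimes> u"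
    using u by (simp add: m_assoc int_pow_neg)
  moreover have "u [^] (2::int) = u \<otimes> u" using u int_pow_mult[of u 1 1] by simp
  ultimately have "u [^] (2::int) \<in> H" by simp
  then have "int p dvd 2" using int_pow_mem_imp_dvd[OF prime_p H u(1) uH, of 2] u H by (simp add: subgroup.one_closed)
  then have "p \<le> 2" using zdvd_imp_le by fastforce
  then have "p = 2" using prime_ge_2_nat[OF prime_p] by simp
  then show False using odd_p by simp
qed

text \<open>The function is the square of \<open>f\<close>. Its difference
  \<open>2 * f g * f x + f g * f g\<close> is represented by the power of \<open>u\<close> with
  exponent \<open>2 * f g\<close>, up to a power of \<open>z\<close>, so \<open>u\<close> must
  belong to \<open>A\<close> and therefore have order \<open>p\<close>. On \<open>Phi\<close> the
  difference vanishes, whence \<open>y\<close> centralizes \<open>Phi\<close>.\<close>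

lemma lin_square_kap:
  assumes u: "lin u f" "u [^] p = \<one>" and g0: "g0 \<in> carrier G" "[f g0 = 1] (mod int p)"
  shows "\<exists>y \<in> cent Phi. \<exists>i::int. kap y g0 = (u \<otimes> u) \<otimes> z [^] i"
proof -
  let ?Z = "range (\<lambda>i::int. z [^] i)"
  let ?A = "{a \<otimes> u [^] (i::int) | a i. a \<in> ?Z}"
  note uc = lin_carrier[OF u(1)] and f = lin_hm[OF u(1)]
  have A: "elem ?A"
    by (rule elem_adjoin[OF elem_zi uc u(2)]) (use Z_comm[OF zi_Z uc] lin_kap[OF u(1)] in auto)
  obtain l where l: "func ?A l" using ex_func[OF A] by blast
  have uA: "u \<in> ?A" by (rule adjoin_mem[OF elem_zi uc])
  have repf: "rep ?A l f" by (rule rep_lin[OF l elem_sub[OF A] subset_refl elem_z[OF A] u(1) uA])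
  define F where "F x = f x * f x" for x
  have dF: "[F (g \<otimes> x) - F x = (2 * f g) * f x + f g * f g] (mod int p)" if "g \<in> carrier G" "x \<in> carrier G" for g x
    using fphomD[OF f that] unfolding F_def cong_iff_dvd_diff by Groebner_Basis.algebra
  have "\<exists>y \<in> carrier G. \<forall>g \<in> carrier G. kap y g \<in> ?A \<and>
    (\<forall>x \<in> carrier G. [F (g \<otimes> x) - F x = l (cj x (kap y g))] (mod int p))"
  proof (rule crossed_hom_of_function[OF l])
    fix g assume g: "g \<in> carrier G"
    have "rep ?A l (\<lambda>x. (2 * f g) * f x + f g * f g)"
      by (intro rep_add[OF l elem_sub[OF A] subset_refl] rep_scale[OF l elem_sub[OF A] subset_refl] repf
        rep_const[OF l elem_sub[OF A] elem_z[OF A]])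
    then show "rep ?A l (\<lambda>x. F (g \<otimes> x) - F x)" using dF[OF g] by (rule rep_cong)
  next
    fix a x assume a: "a \<in> ?A" and x: "x \<in> carrier G"
    then obtain i j :: int where a': "a = z [^] j \<otimes> u [^] i" by auto
    have "[f (z [^] j) = 0] (mod int p)" using hm_Phi[OF f] subgroup_int_pow_closed[OF Phi_sub z_Phi] by blast
    moreover have "[f (u [^] i) = i * f u] (mod int p)" using fphom_int_pow[OF f subgroup_self uc] .
    moreover have "[f u = 0] (mod int p)" by (rule lin_self[OF u(1)])
    moreover have "[f a = f (z [^] j) + f (u [^] i)] (mod int p)" unfolding a' using fphomD[OF f] uc by simp
    ultimately have "[f a = 0] (mod int p)" unfolding cong_iff_dvd_diff by Groebner_Basis.algebra
    then show "[F (a \<otimes> x) = F x] (mod int p)"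
      using fphomD[OF f elem_carrier[OF A a] x] unfolding F_def cong_iff_dvd_diff by Groebner_Basis.algebra
  qed
  then obtain y where y: "y \<in> carrier G" and yA: "\<And>g. g \<in> carrier G \<Longrightarrow> kap y g \<in> ?A"
    and yF: "\<And>g x. g \<in> carrier G \<Longrightarrow> x \<in> carrier G \<Longrightarrow> [F (g \<otimes> x) - F x = l (cj x (kap y g))] (mod int p)"
    by blast
  have "kap y g = \<one>" if g: "g \<in> Phi" for g
  proof (rule func_inj[OF l yA])
    fix x assume x: "x \<in> carrier G"
    show "[l (cj x (kap y g)) = 0] (mod int p)"
      using yF[OF Phi_carrier[OF g] x] dF[OF Phi_carrier[OF g] x] hm_Phi[OF f g]
      unfolding cong_iff_dvd_diff by Groebner_Basis.algebra
  qed (use g Phi_carrier in blast)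
  then have yc: "y \<in> cent Phi" using y Phi_carrier by (auto simp: cent_iff kap_eq_one)
  \<comment> \<open>The element \<open>u \<otimes> u\<close> is represented by
    \<open>2 * f x + 2 * l u\<close>, whereas the difference at \<open>g0\<close> is
    \<open>2 * f x + 1\<close>; the power of \<open>z\<close> makes up for the constant.\<close>
  let ?b = "(u \<otimes> u) \<otimes> z [^] (1 - 2 * l u)"
  have uu: "u \<otimes> u \<in> ?A" "z [^] (1 - 2 * l u) \<in> ?A"
    using elem_m[OF A uA uA] elem_int_pow[OF A elem_z[OF A]] by blast+
  have "kap y g0 = ?b"
  proof (rule func_eq[OF l yA[OF g0(1)] elem_m[OF A uu]])
    fix x assume x: "x \<in> carrier G"
    show "[l (cj x (kap y g0)) = l (cj x ?b)] (mod int p)"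
      using func_cj_mult[OF l uu x] func_cj_mult[OF l uA uA x] func_zi[OF l x, of "1 - 2 * l u"]
        lin_func[OF l u(1) uA x] yF[OF g0(1) x] dF[OF g0(1) x] g0(2)
      unfolding cong_iff_dvd_diff by Groebner_Basis.algebra
  qed
  then show ?thesis using yc by blast
qed

text \<open>Up to a power of \<open>z\<close> the square of \<open>u\<close> is a commutator, and
  for odd \<open>p\<close> an element of order \<open>p\<close> is a power of its square. If
  \<open>f\<close> vanishes, then \<open>u\<close> is itself a power of \<open>z\<close>.\<close>

lemma lin_order_p_Phi:
  assumes u: "lin u f" "u [^] p = \<one>" shows "u \<in> Phi"
proof (cases "\<exists>g \<in> carrier G. \<not> [f g = 0] (mod int p)")
  case True
  then obtain g0 where g0: "g0 \<in> carrier G" "[f g0 = 1] (mod int p)" using hm_scale[OF lin_hm[OF u(1)]] by blast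
  then obtain y i where y: "y \<in> cent Phi" "kap y g0 = (u \<otimes> u) \<otimes> z [^] (i::int)"
    using lin_square_kap[OF u] by blast
  then have "(u \<otimes> u) \<otimes> z [^] i \<in> Phi" using Phi_kap[of y g0] g0 by (simp add: cent_iff)
  then show ?thesis using square_mem[OF Phi_sub lin_carrier[OF u(1)] u(2)] z_Phi by blast
next
  case False
  then have "u \<in> Z" using lin_zero_Z[OF u(1)] by blast
  then obtain i :: int where "u = z [^] i" using Z_order_p u by blast
  then show ?thesis using subgroup_int_pow_closed[OF Phi_sub z_Phi] by simp
qed

lemma lin_order_correction:
  assumes u: "lin u f" and c: "c \<in> Z" "u [^] p = c [^] p"
  shows "lin (u \<otimes> inv c) f" "(u \<otimes> inv c) [^] p = \<one>"
proof -
  note ic = pow_mult_inv_Z[OF lin_carrier[OF u] c]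
  show "lin (u \<otimes> inv c) f" using lin_mult[OF u lin_Z[OF ic(1)]] by simp
  show "(u \<otimes> inv c) [^] p = \<one>" by (rule ic)
qed

lemma lin_comm_rel:
  assumes u: "lin u f" and v: "v \<in> carrier G"
  shows "u \<otimes> v = v \<otimes> u \<otimes> z [^] f v"
proof -
  have "cj v u = z [^] f v \<otimes> u" using u v by (simp add: cj_eq_kap lin_kap lin_carrier)
  then have "v \<otimes> cj v u = v \<otimes> (z [^] f v \<otimes> u)" by simp
  then show ?thesis using lin_carrier[OF u] v Z_comm[OF zi_Z lin_carrier[OF u], of "f v"]
    by (simp add: cj_def m_assoc inv_r_cancel)
qed

text \<open>If \<open>c\<close> centralizes \<open>Phi\<close> without lying in it, there is
  \<open>u\<close> in the second centre with \<open>kap u c = z\<close>, and neither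
  \<open>u\<close> nor its central multiples lie in \<open>Phi\<close>. So the order of
  \<open>u\<close> cannot be corrected by the centre, and therefore \<open>u\<close> corrects the
  order of any \<open>v\<close> with \<open>lin v m\<close>. With \<open>m u = 1\<close> this gives
  an element of order \<open>p\<close>, hence of \<open>Phi\<close>, which does not commute with
  \<open>u\<close>, although \<open>u\<close> centralizes \<open>Phi\<close>.\<close>

lemma cent_Phi_le: "cent Phi \<subseteq> Phi"
proof
  fix c assume c: "c \<in> cent Phi"
  show "c \<in> Phi"
  proof (rule ccontr)
    assume nc: "c \<notin> Phi"
    have cc: "c \<in> carrier G" using c by (simp add: cent_iff)
    obtain f where f: "hm f" "[f c = 1] (mod int p)" using hm_separation[OF cc nc] by blast
    note n1 = one_not_cong
    obtain u where u: "lin u f" using ex_lin[OF f(1)] by blast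
    have uPhi: "x \<notin> Phi" if "lin x h" "[h c = 1] (mod int p)" for x h
    proof
      assume "x \<in> Phi"
      then have "c \<otimes> x = x \<otimes> c" using c by (simp add: cent_iff)
      then have "[h c = 0] (mod int p)" using lin_comm[OF that(1) cc] by simp
      then show False using that(2) n1 cong_trans cong_sym by blast
    qed
    have up: "u [^] p \<noteq> e [^] p" if "e \<in> Z" for e
      using lin_order_correction[OF u that] uPhi[where h = f, OF _ f(2)] lin_order_p_Phi by blast
    obtain m where m: "hm m" "[m u = 1] (mod int p)" using hm_separation[OF lin_carrier[OF u] uPhi[OF u f(2)]] by blast
    obtain v where v: "lin v m" using ex_lin[OF m(1)] by blast
    obtain i e where ie: "e \<in> Z" "(v \<otimes> u [^] (i::nat) \<otimes> e) [^] p = \<one>"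
      using power_correction[OF lin_carrier[OF v] lin_pow_Z[OF v] lin_carrier[OF u] lin_pow_Z[OF u] up
        lin_comm_rel[OF u lin_carrier[OF v]]] by blast
    let ?w = "v \<otimes> u [^] i \<otimes> e"
    have w: "lin ?w (\<lambda>g. (m g + int i * f g) + 0)" by (intro lin_mult lin_pow lin_Z u v ie)
    have "?w \<in> Phi" by (rule lin_order_p_Phi[OF w ie(2)])
    then have "u \<otimes> ?w = ?w \<otimes> u" using lin_cent_Phi[OF u] by (simp add: cent_iff)
    then have "[m u + int i * f u + 0 = 0] (mod int p)" using lin_comm[OF w lin_carrier[OF u]] by simp
    then have "[(1::int) = 0] (mod int p)" using m(2) lin_self[OF u] unfolding cong_iff_dvd_diff by Groebner_Basis.algebra
    then show False using n1 by simp
  qed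
qed

lemma lin_Phi: "lin u f \<Longrightarrow> u \<in> Phi"
  using lin_cent_Phi cent_Phi_le by blast

end

section \<open>Quadratic functions\<close>

locale large_centralizer = only_inner +
  assumes large: "\<not> grp_centralizer G N \<subseteq> N"
begin

abbreviation C where "C \<equiv> cent N"

lemma C_carrier: "x \<in> C \<Longrightarrow> x \<in> carrier G"
  by (simp add: cent_iff)

lemma C_comm: "x \<in> C \<Longrightarrow> n \<in> N \<Longrightarrow> x \<otimes> n = n \<otimes> x"
  by (simp add: cent_iff)

lemma C_sub: "subgroup C G"
  by (rule centralizer_subgroup) (use N_carrier in blast)

lemma cent_Phi_C: "x \<in> cent Phi \<Longrightarrow> x \<in> C"
  using N_Phi by (simp add: cent_iff)

lemma ex_hm: "\<exists>f. hm f \<and> (\<exists>g \<in> carrier G. [f g = 1] (mod int p))"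
proof (rule ccontr)
  assume no: "\<not> ?thesis"
  have P: "x \<in> Phi" if "x \<in> carrier G" for x
  proof (rule ccontr)
    assume "x \<notin> Phi"
    from hm_separation[OF that this] show False using no that by blast
  qed
  have "Phi \<subseteq> N"
  proof (rule Phi_least[OF N_sub])
    fix a b assume ab: "a \<in> carrier G" "b \<in> carrier G"
    then have "kap b (inv a) \<in> N" using kap_Phi_N[OF P] by simp
    then show "a \<otimes> b \<otimes> inv a \<otimes> inv b \<in> N" using ab by (simp add: kap_def)
  qed (rule N_pow)
  then show False using large P C_carrier by blast
qed

lemma z_N: "z \<in> N"
proof -
  obtain f g where f: "hm f" "g \<in> carrier G" "[f g = 1] (mod int p)" using ex_hm by blast
  obtain u where u: "lin u f" using ex_lin[OF f(1)] by blast
  have "kap u g \<in> N" using kap_Phi_N[OF lin_Phi[OF u] f(2)] .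
  also have "kap u g = z [^] (1::int)" unfolding lin_kap[OF u f(2)] zi_eq by (rule f(3))
  finally show ?thesis by simp
qed

lemma zi_N: "z [^] (i::int) \<in> N"
  by (rule subgroup_int_pow_closed[OF N_sub z_N])

text \<open>Now that \<open>cent Phi\<close> is known to lie in \<open>Phi\<close>, the element
  \<open>y\<close> of \<open>lin_square_kap\<close> lies in \<open>Phi\<close>, and its commutators
  lie in \<open>N\<close>; this sharpens \<open>lin_order_p_Phi\<close>.\<close>

lemma lin_order_p_N:
  assumes u: "lin u f" "u [^] p = \<one>" shows "u \<in> N"
proof (cases "\<exists>g \<in> carrier G. \<not> [f g = 0] (mod int p)")
  case True
  then obtain g0 where g0: "g0 \<in> carrier G" "[f g0 = 1] (mod int p)" using hm_scale[OF lin_hm[OF u(1)]] by blast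
  then obtain y i where y: "y \<in> cent Phi" "kap y g0 = (u \<otimes> u) \<otimes> z [^] (i::int)"
    using lin_square_kap[OF u] by blast
  then have "(u \<otimes> u) \<otimes> z [^] i \<in> N" using kap_Phi_N[of y g0] g0 cent_Phi_le by auto
  then show ?thesis using square_mem[OF N_sub lin_carrier[OF u(1)] u(2)] z_N by blast
next
  case False
  then have "u \<in> Z" using lin_zero_Z[OF u(1)] by blast
  then obtain i :: int where "u = z [^] i" using Z_order_p u by blast
  then show ?thesis using zi_N by simp
qed

section \<open>Second-centre elements of order p\<close>

text \<open>Every homomorphism \<open>f\<close> satisfies \<open>lin u f\<close> for some \<open>u\<close>; \<open>H1\<close> consists of those for which \<open>u\<close> can be chosen of
  order \<open>p\<close>. It is everything or a hyperplane.\<close>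

definition H1 :: "('a \<Rightarrow> int) \<Rightarrow> bool" where
  "H1 f \<longleftrightarrow> (\<exists>u. lin u f \<and> u [^] p = \<one>)"

definition Omega :: "'a set" where
  "Omega = {u. u [^] p = \<one> \<and> (\<exists>f. lin u f)}"

lemma lin_lin_comm: "lin u f \<Longrightarrow> lin v h \<Longrightarrow> u \<otimes> v = v \<otimes> u"
  using lin_cent_Phi[of u f] lin_Phi[of v h] by (simp add: cent_iff)

lemma H1_hm: "H1 f \<Longrightarrow> hm f"
  using lin_hm by (auto simp: H1_def)

lemma H1_cong: "H1 f \<Longrightarrow> (\<And>g. g \<in> carrier G \<Longrightarrow> [f g = h g] (mod int p)) \<Longrightarrow> H1 h"
  unfolding H1_def using lin_cong by blast

lemma lin_mult_order_p:
  assumes "lin u f" "u [^] p = \<one>" "lin v h" "v [^] p = \<one>" shows "(u \<otimes> v) [^] p = \<one>"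
  using assms lin_lin_comm[OF assms(1,3)] pow_mult_distrib[of u v p] by (simp add: lin_carrier)

lemma H1_add: "H1 f \<Longrightarrow> H1 h \<Longrightarrow> H1 (\<lambda>x. f x + h x)"
  unfolding H1_def using lin_mult lin_mult_order_p by blast

lemma lin_int_pow: "lin u f \<Longrightarrow> \<exists>n::nat. lin (u [^] n) (\<lambda>g. c * f g)"
proof -
  assume u: "lin u f"
  let ?n = "nat (c mod int p)"
  have "int ?n = c mod int p" using prime_gt_0_nat[OF prime_p] by simp
  then have n: "[int ?n = c] (mod int p)" by simp
  have "lin (u [^] ?n) (\<lambda>g. c * f g)"
    by (rule lin_cong[OF lin_pow[OF u, of ?n]]) (rule cong_scalar_right[OF n])
  then show ?thesis by blast
qed

lemma H1_scale: "H1 f \<Longrightarrow> H1 (\<lambda>x. c * f x)"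
proof -
  assume "H1 f"
  then obtain u where u: "lin u f" "u [^] p = \<one>" by (auto simp: H1_def)
  obtain n :: nat where n: "lin (u [^] n) (\<lambda>g. c * f g)" using lin_int_pow[OF u(1)] by blast
  have "(u [^] n) [^] p = (u [^] p) [^] n" using lin_carrier[OF u(1)] by (simp add: nat_pow_pow mult.commute)
  then show ?thesis using n u unfolding H1_def by auto
qed

text \<open>The element of order \<open>p\<close> that belongs to \<open>f\<close> lies in
  \<open>N\<close>, so \<open>C\<close> commutes with it. Conversely, a homomorphism that is nonzero
  somewhere on \<open>C\<close> cannot be in \<open>H1\<close>.\<close>

lemma H1_C: "H1 f \<Longrightarrow> c \<in> C \<Longrightarrow> [f c = 0] (mod int p)"
proof -
  assume "H1 f" and c: "c \<in> C"
  then obtain u where u: "lin u f" "u [^] p = \<one>" by (auto simp: H1_def)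
  have "c \<otimes> u = u \<otimes> c" using C_comm[OF c lin_order_p_N[OF u]] .
  then show ?thesis using lin_comm[OF u(1) C_carrier[OF c]] by simp
qed

lemma not_H1_power:
  assumes e: "\<not> H1 e" and u: "lin u e" and c: "c \<in> Z" shows "u [^] p \<noteq> c [^] p"
  using lin_order_correction[OF u c] e by (auto simp: H1_def)

lemma H1_dichotomy:
  assumes e: "hm e" "\<not> H1 e" and m: "hm m"
  shows "\<exists>i::int. H1 (\<lambda>x. m x + i * e x)"
proof -
  obtain u v where u: "lin u e" and v: "lin v m" using ex_lin e m by blast
  have rel: "u \<otimes> v = v \<otimes> u \<otimes> z [^] (0::int)" using lin_lin_comm[OF u v] u v by (simp add: lin_carrier)
  obtain i d where d: "d \<in> Z" "(v \<otimes> u [^] (i::nat) \<otimes> d) [^] p = \<one>"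
    using power_correction[OF lin_carrier[OF v] lin_pow_Z[OF v] lin_carrier[OF u] lin_pow_Z[OF u]
      not_H1_power[OF e(2) u] rel] by blast
  have "lin (v \<otimes> u [^] i \<otimes> d) (\<lambda>g. (m g + int i * e g) + 0)" by (intro lin_mult lin_pow lin_Z u v d)
  then have "H1 (\<lambda>x. m x + int i * e x)" using d unfolding H1_def by auto
  then show ?thesis by blast
qed

lemma H1_multiple:
  assumes e: "\<not> H1 e" and i: "H1 (\<lambda>x. i * e x)" shows "[i = 0] (mod int p)"
proof (rule ccontr)
  assume "\<not> [i = 0] (mod int p)"
  then obtain k where k: "[i * k = 1] (mod int p)" using ex_inverse_mod by blast
  have "H1 e"
  proof (rule H1_cong[OF H1_scale[OF i, of k]])
    fix g
    show "[k * (i * e g) = e g] (mod int p)" using cong_scalar_right[OF k, of "e g"] by (simp add: mult_ac)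
  qed
  then show False using e by blast
qed

lemma Omega_sub: "subgroup Omega G"
proof (rule subgroupI)
  show "Omega \<subseteq> carrier G" by (auto simp: Omega_def lin_carrier)
  have "\<one> \<in> Omega" unfolding Omega_def using lin_Z[OF one_closed_Z] nat_pow_one by blast
  then show "Omega \<noteq> {}" by blast
  fix u assume "u \<in> Omega"
  then obtain f where u: "u [^] p = \<one>" "lin u f" by (auto simp: Omega_def)
  have "u [^] (p - 1) \<otimes> u = \<one>"
    using u lin_carrier[OF u(2)] prime_gt_0_nat[OF prime_p] by (metis Suc_pred' nat_pow_Suc)
  then have "inv u = u [^] (p - 1)" using lin_carrier[OF u(2)] by (intro inv_equality) auto
  moreover have "(u [^] (p - 1)) [^] p = (u [^] p) [^] (p - 1)"
    using lin_carrier[OF u(2)] by (simp add: nat_pow_pow mult.commute)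
  ultimately show "inv u \<in> Omega" using lin_pow[OF u(2), of "p - 1"] u(1) by (auto simp: Omega_def)
  fix v assume "v \<in> Omega"
  then show "u \<otimes> v \<in> Omega" using u lin_mult lin_mult_order_p unfolding Omega_def by blast
qed

lemma Omega_N: "u \<in> Omega \<Longrightarrow> u \<in> N"
  using lin_order_p_N by (auto simp: Omega_def)

lemma Omega_lin: "u \<in> Omega \<Longrightarrow> \<exists>f. lin u f \<and> H1 f"
  by (auto simp: Omega_def H1_def)

lemma Omega_zi: "z [^] (i::int) \<in> Omega"
  using lin_Z[OF zi_Z] zi_pow by (auto simp: Omega_def)

lemma Omega_elem: "elem Omega"
  unfolding elem_def
proof (intro conjI ballI)
  show "subgroup Omega G" by (rule Omega_sub)
  show "z \<in> Omega" using Omega_zi[of 1] by simp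
  fix u assume "u \<in> Omega"
  then obtain f where u: "u [^] p = \<one>" "lin u f" by (auto simp: Omega_def)
  show "u [^] p = \<one>" by (rule u)
  { fix v assume "v \<in> Omega"
    then show "u \<otimes> v = v \<otimes> u" using lin_lin_comm[OF u(2)] by (auto simp: Omega_def) }
  fix g assume g: "g \<in> carrier G"
  then have "cj g u = z [^] f g \<otimes> u" using u by (simp add: cj_eq_kap lin_kap lin_carrier)
  then show "cj g u \<in> Omega" using subgroup.m_closed[OF Omega_sub Omega_zi \<open>u \<in> Omega\<close>] by simp
qed

lemma H1_rep:
  assumes l: "func A l" and B: "subgroup B G" "B \<subseteq> A" "Omega \<subseteq> B" and h: "H1 h"
  shows "rep B l h"
proof -
  obtain u where "lin u h" "u \<in> Omega" using h by (auto simp: H1_def Omega_def)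
  moreover have "z \<in> B" using Omega_zi[of 1] B by auto
  ultimately show ?thesis using rep_lin[OF l B(1,2)] B by blast
qed

text \<open>The product of \<open>e\<close> and \<open>k\<close> would also have \<open>k\<close>
  among its differences, and \<open>k\<close> need not be in \<open>H1\<close>. Replacing it by
  \<open>k1 = k + i * e\<close> in \<open>H1\<close> creates the surplus
  \<open>i * e g * e x\<close>, which is the difference of \<open>r * i\<close> times the square of
  \<open>e\<close>, up to a constant.\<close>

lemma H1_compensation:
  assumes e: "hm e" "\<not> H1 e" and k: "hm k"
  shows "\<exists>q. (\<forall>a \<in> Phi. \<forall>x \<in> carrier G. [q (a \<otimes> x) = q x] (mod int p)) \<and>
    (\<forall>g \<in> carrier G. \<exists>h c. H1 h \<and> (\<forall>x \<in> carrier G. [q (g \<otimes> x) - q x = k g * e x + h x + c] (mod int p)))"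
proof -
  obtain i where i: "H1 (\<lambda>x. k x + i * e x)" using H1_dichotomy[OF e k] by blast
  define k1 where "k1 x = k x + i * e x" for x
  have k1: "H1 k1" using i by (simp add: k1_def[abs_def])
  define q where "q x = e x * k1 x - r * i * (e x * e x)" for x
  have "[q (a \<otimes> x) = q x] (mod int p)" if a: "a \<in> Phi" and x: "x \<in> carrier G" for a x
  proof -
    have "[e (a \<otimes> x) = e x] (mod int p)" "[k1 (a \<otimes> x) = k1 x] (mod int p)"
      using hmD[OF e(1) Phi_carrier[OF a] x] hm_Phi[OF e(1) a]
        hmD[OF H1_hm[OF k1] Phi_carrier[OF a] x] hm_Phi[OF H1_hm[OF k1] a]
      unfolding cong_iff_dvd_diff by Groebner_Basis.algebra+
    then show ?thesis unfolding q_def by (intro cong_diff cong_mult cong_refl)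
  qed
  moreover have "\<exists>h c. H1 h \<and> (\<forall>x \<in> carrier G. [q (g \<otimes> x) - q x = k g * e x + h x + c] (mod int p))"
    if g: "g \<in> carrier G" for g
  proof (intro exI conjI ballI)
    show "H1 (\<lambda>x. e g * k1 x)" by (rule H1_scale[OF k1])
    fix x assume x: "x \<in> carrier G"
    have "q (g \<otimes> x) - q x - (k g * e x + e g * k1 x + (e g * k1 g - r * i * (e g * e g))) =
       (e (g \<otimes> x) - (e g + e x)) * (k1 (g \<otimes> x) - r * i * (e (g \<otimes> x) + e g + e x)) +
       (e g + e x) * (k1 (g \<otimes> x) - (k1 g + k1 x)) - i * e g * e x * (2 * r - 1)"
      unfolding q_def k1_def by (simp add: algebra_simps)
    then show "[q (g \<otimes> x) - q x = k g * e x + e g * k1 x + (e g * k1 g - r * i * (e g * e g))] (mod int p)"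
      using hmD[OF e(1) g x] hmD[OF H1_hm[OF k1] g x] half
      unfolding cong_iff_dvd_diff by (simp only: dvd_diff dvd_add dvd_mult dvd_mult2)
  qed
  ultimately show ?thesis by blast
qed

text \<open>For \<open>w\<close> in \<open>Quad\<close> the function \<open>x \<mapsto> l (x^-1 w x)\<close> has degree at most two: its differences are affine.\<close>

definition Quad :: "'a set" where
  "Quad = {w \<in> C. \<forall>g \<in> carrier G. kap w g \<in> Omega}"

lemma Quad_C: "w \<in> Quad \<Longrightarrow> w \<in> C" and Quad_kap: "w \<in> Quad \<Longrightarrow> g \<in> carrier G \<Longrightarrow> kap w g \<in> Omega"
  by (auto simp: Quad_def)

lemma Quad_carrier: "w \<in> Quad \<Longrightarrow> w \<in> carrier G"
  using Quad_C C_carrier by blast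

lemma kap_Quad_mult:
  assumes w: "w \<in> Quad" and v: "v \<in> Quad" and g: "g \<in> carrier G"
  shows "kap (w \<otimes> v) g = kap w g \<otimes> kap v g"
proof -
  have n: "kap v g \<in> carrier G" using Quad_carrier[OF v] g by simp
  have "w \<otimes> kap v g \<otimes> inv w = kap v g"
    using C_comm[OF Quad_C[OF w] Omega_N[OF Quad_kap[OF v g]]] Quad_carrier[OF w] n by (simp add: m_assoc)
  then show ?thesis using Quad_carrier[OF w] Quad_carrier[OF v] g by (simp add: kap_mult_left)
qed

lemma Quad_mult: "w \<in> Quad \<Longrightarrow> v \<in> Quad \<Longrightarrow> w \<otimes> v \<in> Quad"
  using kap_Quad_mult[of w v] subgroup.m_closed[OF Omega_sub] subgroup.m_closed[OF C_sub]
  by (simp add: Quad_def)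

lemma Quad_lin: "lin u f \<Longrightarrow> u \<in> Quad"
  using lin_cent_Phi[THEN cent_Phi_C] by (simp add: Quad_def lin_kap Omega_zi)

lemma Quad_Z: "c \<in> Z \<Longrightarrow> c \<in> Quad"
  using Quad_lin[OF lin_Z] .

lemma Quad_pow:
  assumes w: "w \<in> Quad"
  shows "w [^] (n::nat) \<in> Quad \<and> (\<forall>g \<in> carrier G. kap (w [^] n) g = kap w g [^] n)"
proof (induction n)
  case 0
  then show ?case using Quad_Z[OF one_closed_Z] by (auto simp: kap_def)
next
  case (Suc n)
  then show ?case using Quad_mult[of "w [^] n" w] kap_Quad_mult[of "w [^] n" w] w by simp
qed

lemma Quad_pow_Z: "w \<in> Quad \<Longrightarrow> w [^] p \<in> Z"
  using Quad_pow[of w p] elem_pow[OF Omega_elem Quad_kap[of w]] Quad_carrier[of w]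
  by (auto simp: Z_iff kap_eq_one[symmetric])

text \<open>The quadratic function is the extension \<open>F\<close> of \<open>f\<close> with \<open>F (g h) = F g + F h + f [g, h] / 2\<close>, corrected by
  \<open>H1_compensation\<close> if its differences are not in \<open>H1\<close>.\<close>

lemma ex_Quad:
  assumes f: "fphom p Phi f" and fN: "\<And>n. n \<in> N \<Longrightarrow> [f n = 0] (mod int p)"
  shows "\<exists>w \<in> Quad. \<forall>x \<in> Phi. kap w x = z [^] f x"
proof -
  define om where "om a b = f (a \<otimes> b \<otimes> inv a \<otimes> inv b)" for a b
  have fcj: "[f (cj g x) = f x] (mod int p)" if x: "x \<in> Phi" and g: "g \<in> carrier G" for g x
  proof -
    have k: "kap x g \<in> N" using kap_Phi_N[OF x g] .
    have "[f (kap x g \<otimes> x) = f (kap x g) + f x] (mod int p)" by (rule fphomD[OF f N_Phi[OF k] x])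
    then show ?thesis using fN[OF k] unfolding cj_eq_kap[OF Phi_carrier[OF x] g] cong_iff_dvd_diff
      by Groebner_Basis.algebra
  qed
  have om1: "hm (\<lambda>b. om b a)" if a: "a \<in> carrier G" for a
    unfolding fphom_def
  proof (intro ballI)
    fix g h assume gh: "g \<in> carrier G" "h \<in> carrier G"
    have e: "g \<otimes> h \<otimes> a \<otimes> inv (g \<otimes> h) \<otimes> inv a =
      cj (inv g) (h \<otimes> a \<otimes> inv h \<otimes> inv a) \<otimes> (g \<otimes> a \<otimes> inv g \<otimes> inv a)"
      using gh a by (simp add: cj_def group_word)
    have P: "h \<otimes> a \<otimes> inv h \<otimes> inv a \<in> Phi" "g \<otimes> a \<otimes> inv g \<otimes> inv a \<in> Phi" using Phi_comm gh a by auto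
    show "[om (g \<otimes> h) a = om g a + om h a] (mod int p)"
      using fphomD[OF f Phi_cj[OF inv_closed[OF gh(1)] P(1)] P(2)] fcj[OF P(1) inv_closed[OF gh(1)]]
      unfolding om_def e cong_iff_dvd_diff by Groebner_Basis.algebra
  qed
  have om2: "hm (om a)" if a: "a \<in> carrier G" for a
    unfolding fphom_def
  proof (intro ballI)
    fix g h assume gh: "g \<in> carrier G" "h \<in> carrier G"
    have e: "a \<otimes> (g \<otimes> h) \<otimes> inv a \<otimes> inv (g \<otimes> h) =
      (a \<otimes> g \<otimes> inv a \<otimes> inv g) \<otimes> cj (inv g) (a \<otimes> h \<otimes> inv a \<otimes> inv h)"
      using gh a by (simp add: cj_def group_word)
    have P: "a \<otimes> h \<otimes> inv a \<otimes> inv h \<in> Phi" "a \<otimes> g \<otimes> inv a \<otimes> inv g \<in> Phi" using Phi_comm gh a by auto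
    show "[om a (g \<otimes> h) = om a g + om a h] (mod int p)"
      using fphomD[OF f P(2) Phi_cj[OF inv_closed[OF gh(1)] P(1)]] fcj[OF P(1) inv_closed[OF gh(1)]]
      unfolding om_def e cong_iff_dvd_diff by Groebner_Basis.algebra
  qed
  interpret ext: alt_extension G p "carrier G" om r
    by (intro alt_extension.intro alt_extension_axioms.intro)
      (use prime_p subgroup_self fin om1 om2 half group_axioms in auto)
  have "ext.admissible Phi f"
    unfolding ext.admissible_def
  proof (intro conjI ballI)
    show "subgroup Phi G" by (rule Phi_sub)
    show "Phi \<subseteq> carrier G" using Phi_carrier by blast
    fix a b assume ab: "a \<in> carrier G" "b \<in> carrier G"
    show "a \<otimes> b \<otimes> inv a \<otimes> inv b \<in> Phi" by (rule Phi_comm[OF ab])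
    show "[f (a \<otimes> b \<otimes> inv a \<otimes> inv b) = om a b] (mod int p)" by (simp add: om_def)
  next
    fix a assume a: "a \<in> carrier G"
    show "a [^] p \<in> Phi" by (rule Phi_pow[OF a])
    show "[f (a [^] p) = 0] (mod int p)" by (rule fN[OF N_pow[OF a]])
  next
    fix a b assume ab: "a \<in> Phi" "b \<in> Phi"
    have "[om a b = 0] (mod int p)" by (rule hm_Phi[OF om2[OF Phi_carrier[OF ab(1)]] ab(2)])
    then show "[f (a \<otimes> b) = f a + f b + r * om a b] (mod int p)" using fphomD[OF f ab]
      unfolding cong_iff_dvd_diff by Groebner_Basis.algebra
  qed
  from ext.admissible_extend[OF this] obtain F where F: "ext.admissible (carrier G) F"
    and FP: "\<And>x. x \<in> Phi \<Longrightarrow> [F x = f x] (mod int p)" by blast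
  have Fm: "[F (a \<otimes> b) = F a + F b + r * om a b] (mod int p)" if "a \<in> carrier G" "b \<in> carrier G" for a b
    using F that unfolding ext.admissible_def by blast
  obtain l where l: "func Omega l" using ex_func[OF Omega_elem] by blast
  note R = rep_add[OF l Omega_sub subset_refl] rep_scale[OF l Omega_sub subset_refl]
    rep_const[OF l Omega_sub elem_z[OF Omega_elem]] H1_rep[OF l Omega_sub subset_refl subset_refl]
  have "\<exists>q. (\<forall>a \<in> Phi. \<forall>x \<in> carrier G. [q (a \<otimes> x) = q x] (mod int p)) \<and>
     (\<forall>g \<in> carrier G. \<exists>h c. H1 h \<and> (\<forall>x \<in> carrier G. [om g x - (q (g \<otimes> x) - q x) = h x + c] (mod int p)))"
  proof (cases "\<forall>e. hm e \<longrightarrow> H1 e")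
    case True
    have "\<exists>h c. H1 h \<and> (\<forall>x \<in> carrier G. [om g x - (0 - 0) = h x + c] (mod int p))" if "g \<in> carrier G" for g
      using om2[OF that] True by (intro exI[of _ "om g"] exI[of _ 0]) simp
    then show ?thesis
      by - (rule exI[of _ "\<lambda>_. 0"], simp)
  next
    case False
    then obtain e where e: "hm e" "\<not> H1 e" by blast
    have "\<exists>k. \<forall>g \<in> carrier G. H1 (\<lambda>x. om g x + k g * e x)"
      using H1_dichotomy[OF e om2] by metis
    then obtain k where k: "\<And>g. g \<in> carrier G \<Longrightarrow> H1 (\<lambda>x. om g x + k g * e x)" by blast
    \<comment> \<open>Since \<open>e\<close> is not in \<open>H1\<close>, the coefficient
      \<open>k g\<close> of \<open>e\<close> in \<open>om g\<close> modulo \<open>H1\<close> is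
      unique modulo \<open>p\<close>, up to sign; it inherits additivity from the first argument of
      \<open>om\<close>.\<close>
    have "hm k"
      unfolding fphom_def
    proof (intro ballI)
      fix g h assume gh: "g \<in> carrier G" "h \<in> carrier G"
      have "H1 (\<lambda>x. (om (g \<otimes> h) x + k (g \<otimes> h) * e x) + (- 1) * ((om g x + k g * e x) + (om h x + k h * e x)))"
        using H1_add[OF k[OF m_closed[OF gh]] H1_scale[OF H1_add[OF k[OF gh(1)] k[OF gh(2)]]]] .
      then have "H1 (\<lambda>x. (k (g \<otimes> h) - (k g + k h)) * e x)"
      proof (rule H1_cong)
        fix x assume x: "x \<in> carrier G"
        show "[om (g \<otimes> h) x + k (g \<otimes> h) * e x + - 1 * (om g x + k g * e x + (om h x + k h * e x)) =
            (k (g \<otimes> h) - (k g + k h)) * e x] (mod int p)"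
          using fphomD[OF om1[OF x] gh] unfolding cong_iff_dvd_diff by Groebner_Basis.algebra
      qed
      then have "[k (g \<otimes> h) - (k g + k h) = 0] (mod int p)" by (rule H1_multiple[OF e(2)])
      then show "[k (g \<otimes> h) = k g + k h] (mod int p)" by (simp add: cong_iff_dvd_diff)
    qed
    from H1_compensation[OF e this] obtain q where
      q1: "\<And>a x. a \<in> Phi \<Longrightarrow> x \<in> carrier G \<Longrightarrow> [q (a \<otimes> x) = q x] (mod int p)" and
      q2: "\<And>g. g \<in> carrier G \<Longrightarrow> \<exists>h c. H1 h \<and> (\<forall>x \<in> carrier G. [q (g \<otimes> x) - q x = k g * e x + h x + c] (mod int p))"
      by blast
    show ?thesis
    proof (rule exI[of _ "\<lambda>x. - q x"], intro conjI ballI)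
      fix a x assume "a \<in> Phi" "x \<in> carrier G"
      then show "[- q (a \<otimes> x) = - q x] (mod int p)" using q1[of a x] unfolding cong_iff_dvd_diff by Groebner_Basis.algebra
    next
      fix g assume g: "g \<in> carrier G"
      obtain h c where h: "H1 h" "\<And>x. x \<in> carrier G \<Longrightarrow> [q (g \<otimes> x) - q x = k g * e x + h x + c] (mod int p)"
        using q2[OF g] by blast
      have "[om g x - (- q (g \<otimes> x) - - q x) = ((om g x + k g * e x) + h x) + c] (mod int p)" if "x \<in> carrier G" for x
        using h(2)[OF that] unfolding cong_iff_dvd_diff by Groebner_Basis.algebra
      moreover have "H1 (\<lambda>x. (om g x + k g * e x) + h x)" by (rule H1_add[OF k[OF g] h(1)])
      ultimately show "\<exists>h c. H1 h \<and> (\<forall>x \<in> carrier G. [om g x - (- q (g \<otimes> x) - - q x) = h x + c] (mod int p))"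
        by blast
    qed
  qed
  then obtain q where q1: "\<And>a x. a \<in> Phi \<Longrightarrow> x \<in> carrier G \<Longrightarrow> [q (a \<otimes> x) = q x] (mod int p)"
    and q2: "\<And>g. g \<in> carrier G \<Longrightarrow> \<exists>h c. H1 h \<and> (\<forall>x \<in> carrier G. [om g x - (q (g \<otimes> x) - q x) = h x + c] (mod int p))"
    by blast
  \<comment> \<open>The factor \<open>r\<close> is the one in front of \<open>om g x\<close> in the
    difference of \<open>F\<close>; only \<open>q\<close> has to be invariant under
    \<open>Phi\<close>, so that on \<open>Phi\<close> the differences are still given by
    \<open>f\<close>.\<close>
  define F' where "F' x = F x - r * q x" for x
  have FPhi: "[F' (a \<otimes> x) - F' x = f a] (mod int p)" if a: "a \<in> Phi" and x: "x \<in> carrier G" for a x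
    using Fm[OF Phi_carrier[OF a] x] FP[OF a] hm_Phi[OF om1[OF x] a] q1[OF a x]
    unfolding F'_def cong_iff_dvd_diff by Groebner_Basis.algebra
  have "\<exists>y \<in> carrier G. \<forall>g \<in> carrier G. kap y g \<in> Omega \<and>
    (\<forall>x \<in> carrier G. [F' (g \<otimes> x) - F' x = l (cj x (kap y g))] (mod int p))"
  proof (rule crossed_hom_of_function[OF l])
    fix g assume g: "g \<in> carrier G"
    obtain h c where h: "H1 h" "\<And>x. x \<in> carrier G \<Longrightarrow> [om g x - (q (g \<otimes> x) - q x) = h x + c] (mod int p)"
      using q2[OF g] by blast
    have "rep Omega l (\<lambda>x. F g + r * (h x + c))" by (intro R h)
    then show "rep Omega l (\<lambda>x. F' (g \<otimes> x) - F' x)"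
    proof (rule rep_cong)
      fix x assume x: "x \<in> carrier G"
      show "[F' (g \<otimes> x) - F' x = F g + r * (h x + c)] (mod int p)"
        using h(2)[OF x] Fm[OF g x] unfolding F'_def cong_iff_dvd_diff by Groebner_Basis.algebra
    qed
  next
    fix a x assume a: "a \<in> Omega" and x: "x \<in> carrier G"
    then show "[F' (a \<otimes> x) = F' x] (mod int p)"
      using FPhi[OF N_Phi[OF Omega_N[OF a]] x] fN[OF Omega_N[OF a]] unfolding cong_iff_dvd_diff by Groebner_Basis.algebra
  qed
  then obtain y where y: "y \<in> carrier G" and yO: "\<And>g. g \<in> carrier G \<Longrightarrow> kap y g \<in> Omega"
    and yF: "\<And>g x. g \<in> carrier G \<Longrightarrow> x \<in> carrier G \<Longrightarrow> [F' (g \<otimes> x) - F' x = l (cj x (kap y g))] (mod int p)"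
    by blast
  have ky: "kap y x = z [^] f x" if x: "x \<in> Phi" for x
  proof (rule func_eq[OF l yO[OF Phi_carrier[OF x]] Omega_zi])
    fix a assume a: "a \<in> carrier G"
    show "[l (cj a (kap y x)) = l (cj a (z [^] f x))] (mod int p)"
      using yF[OF Phi_carrier[OF x] a] FPhi[OF x a] func_zi[OF l a, of "f x"]
      unfolding cong_iff_dvd_diff by Groebner_Basis.algebra
  qed
  have "kap y n = \<one>" if n: "n \<in> N" for n
    unfolding ky[OF N_Phi[OF n]] zi_one using fN[OF n] by (simp add: cong_0_iff)
  then have "y \<in> C" using y N_carrier by (simp add: cent_iff kap_eq_one)
  then have "y \<in> Quad" using yO by (simp add: Quad_def)
  then show ?thesis using ky by blast
qed

lemma Quad_separation:
  assumes x: "x \<in> Phi" "x \<notin> N" shows "\<exists>w \<in> Quad. kap w x = z"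
proof -
  have "\<exists>f. fphom p Phi f \<and> (\<forall>m \<in> N. [f m = 0] (mod int p)) \<and> [f x = 1] (mod int p)"
  proof (rule fphom_separation[OF prime_p half Phi_sub _ N_sub _ _ _ x])
    show "finite Phi" using fin Phi_carrier by (meson finite_subset subsetI)
    show "N \<subseteq> Phi" using N_Phi by blast
    fix a assume a: "a \<in> Phi"
    then show "a [^] p \<in> N" using N_pow Phi_carrier by blast
    fix b assume b: "b \<in> Phi"
    have "kap b (inv a) \<in> N" using kap_Phi_N[OF b] Phi_carrier[OF a] by simp
    then show "a \<otimes> b \<otimes> inv a \<otimes> inv b \<in> N" using Phi_carrier[OF a] by (simp add: kap_def)
  qed
  then obtain f where f: "fphom p Phi f" "\<And>m. m \<in> N \<Longrightarrow> [f m = 0] (mod int p)" "[f x = 1] (mod int p)" by blast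
  obtain w where w: "w \<in> Quad" "kap w x = z [^] f x" using ex_Quad[OF f(1,2)] x by blast
  have "z [^] f x = z [^] (1::int)" unfolding zi_eq by (rule f(3))
  then show ?thesis using w by auto
qed

end

section \<open>Cubic functions\<close>

context large_centralizer
begin

text \<open>Since \<open>N\<close> lies in \<open>Phi\<close>, the subgroup \<open>Y\<close> lies in
  \<open>C\<close> and is therefore part of the centre of \<open>C\<close>; by
  \<open>cent_Phi_le\<close> it also lies in \<open>Phi\<close>. Its elements commute with every
  \<open>w\<close> in \<open>Quad\<close>, so that such a \<open>w\<close> of order \<open>p\<close>
  can be adjoined to \<open>A\<close>.\<close>

definition Y :: "'a set" where "Y = cent (C \<union> Phi)"

definition A :: "'a set" where "A = {a \<in> Y. a [^] p = \<one>}"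

lemma Y_iff: "y \<in> Y \<longleftrightarrow> y \<in> carrier G \<and> (\<forall>c \<in> C. y \<otimes> c = c \<otimes> y) \<and> (\<forall>x \<in> Phi. y \<otimes> x = x \<otimes> y)"
  by (auto simp: Y_def cent_iff)

lemma Y_sub: "subgroup Y G"
  unfolding Y_def by (rule centralizer_subgroup) (use C_carrier Phi_carrier in blast)

lemma Y_carrier: "y \<in> Y \<Longrightarrow> y \<in> carrier G"
  by (simp add: Y_iff)

lemma Y_cent_Phi: "y \<in> Y \<Longrightarrow> y \<in> cent Phi"
  unfolding Y_iff cent_iff by blast

lemma Y_Phi: "y \<in> Y \<Longrightarrow> y \<in> Phi"
  using Y_cent_Phi cent_Phi_le by blast

lemma Y_comm: "x \<in> Y \<Longrightarrow> y \<in> Y \<Longrightarrow> x \<otimes> y = y \<otimes> x"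
  using Y_Phi Y_iff by blast

lemma Y_cent_C: "y \<in> Y \<Longrightarrow> c \<in> C \<Longrightarrow> y \<otimes> c = c \<otimes> y"
  using Y_iff by blast

lemma Y_C: "y \<in> Y \<Longrightarrow> y \<in> C"
  using Y_cent_Phi cent_Phi_C by blast

lemma cj_cent:
  assumes H: "\<And>g x. g \<in> carrier G \<Longrightarrow> x \<in> H \<Longrightarrow> cj g x \<in> H" "H \<subseteq> carrier G"
    and g: "g \<in> carrier G" and y: "y \<in> cent H"
  shows "cj g y \<in> cent H"
  unfolding cent_iff
proof (intro conjI ballI)
  have yc: "y \<in> carrier G" using y by (simp add: cent_iff)
  show "cj g y \<in> carrier G" using yc g by simp
  fix x assume x: "x \<in> H"
  have xc: "x \<in> carrier G" using x H by blast
  let ?x = "cj (inv g) x"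
  have "y \<otimes> ?x = ?x \<otimes> y" using y H(1)[OF inv_closed[OF g] x] by (simp add: cent_iff)
  then have "cj g (y \<otimes> ?x) = cj g (?x \<otimes> y)" by simp
  moreover have "cj g ?x = x" using g xc by (simp add: cj_cj)
  ultimately show "cj g y \<otimes> x = x \<otimes> cj g y" using g xc yc by (simp add: cj_mult)
qed

lemma C_cj: "g \<in> carrier G \<Longrightarrow> c \<in> C \<Longrightarrow> cj g c \<in> C"
  by (rule cj_cent) (use N_cj N_carrier in auto)

lemma Y_cj: "g \<in> carrier G \<Longrightarrow> y \<in> Y \<Longrightarrow> cj g y \<in> Y"
  unfolding Y_def by (rule cj_cent) (use C_cj Phi_cj C_carrier Phi_carrier in auto)

lemma Z_Y: "c \<in> Z \<Longrightarrow> c \<in> Y"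
  unfolding Y_iff using Z_comm C_carrier Phi_carrier Z_carrier by blast

lemma A_Y: "a \<in> A \<Longrightarrow> a \<in> Y" and A_pow: "a \<in> A \<Longrightarrow> a [^] p = \<one>"
  by (auto simp: A_def)

lemma A_sub: "subgroup A G"
proof (rule subgroupI)
  show "A \<subseteq> carrier G" using A_Y Y_carrier by blast
  show "A \<noteq> {}" using Z_Y[OF z_Z] z_pow by (auto simp: A_def)
  fix a assume a: "a \<in> A"
  have ac: "a \<in> carrier G" using A_Y[OF a] Y_carrier by blast
  have "inv a [^] p = \<one>" using A_pow[OF a] ac by (simp add: nat_pow_inv)
  then show "inv a \<in> A" using subgroup.m_inv_closed[OF Y_sub A_Y[OF a]] by (simp add: A_def)
  fix b assume b: "b \<in> A"
  have bc: "b \<in> carrier G" using A_Y[OF b] Y_carrier by blast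
  have "(a \<otimes> b) [^] p = a [^] p \<otimes> b [^] p"
    by (rule pow_mult_distrib[OF Y_comm[OF A_Y[OF a] A_Y[OF b]] ac bc])
  then show "a \<otimes> b \<in> A" using A_pow[OF a] A_pow[OF b] subgroup.m_closed[OF Y_sub A_Y[OF a] A_Y[OF b]]
    by (simp add: A_def)
qed

lemma A_elem: "elem A"
  unfolding elem_def
proof (intro conjI ballI)
  show "subgroup A G" by (rule A_sub)
  show "z \<in> A" using Z_Y[OF z_Z] z_pow by (simp add: A_def)
  fix a assume a: "a \<in> A"
  show "a [^] p = \<one>" by (rule A_pow[OF a])
  have ac: "a \<in> carrier G" using A_Y[OF a] Y_carrier by blast
  { fix b assume b: "b \<in> A"
    show "a \<otimes> b = b \<otimes> a" by (rule Y_comm[OF A_Y[OF a] A_Y[OF b]]) }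
  fix g assume g: "g \<in> carrier G"
  have "cj g a [^] p = \<one>" unfolding cj_pow[OF g ac, symmetric] A_pow[OF a] by (rule cj_one(1)[OF g])
  then show "cj g a \<in> A" using Y_cj[OF g A_Y[OF a]] by (simp add: A_def)
qed

lemma Omega_A: "Omega \<subseteq> A"
proof
  fix u assume u: "u \<in> Omega"
  then obtain f where f: "lin u f" using Omega_lin by blast
  have "u \<otimes> x = x \<otimes> u" if "x \<in> Phi" for x using lin_cent_Phi[OF f] that unfolding cent_iff by blast
  then have "u \<in> Y" unfolding Y_iff using lin_carrier[OF f] C_comm[OF _ Omega_N[OF u]] by (intro conjI ballI) simp_all
  moreover have "u [^] p = \<one>" using u by (simp add: Omega_def)
  ultimately show "u \<in> A" by (simp add: A_def)
qed

end

text \<open>The form \<open>h\<close> is the polar form of the quadratic function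
  \<open>x \<mapsto> l (cj x w)\<close>: replacing \<open>x\<close> by \<open>g \<otimes> x\<close>
  adds \<open>h g x\<close> and a constant. The functional is defined on \<open>A\<close> extended
  by \<open>w\<close>, so that this function becomes representable.\<close>

locale quad_element = large_centralizer +
  fixes w :: 'a and l :: "'a \<Rightarrow> int" and h :: "'a \<Rightarrow> 'a \<Rightarrow> int"
  assumes w: "w \<in> Quad" and wp: "w [^] p = \<one>" and wPhi: "w \<notin> cent Phi"
    and l: "func {a \<otimes> w [^] (i::int) | a i. a \<in> A} l"
    and h: "\<And>g. g \<in> carrier G \<Longrightarrow> lin (kap w g) (h g)"
begin

definition A2 :: "'a set" where "A2 = {a \<otimes> w [^] (i::int) | a i. a \<in> A}"

lemma l2: "func A2 l" using l by (simp add: A2_def)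

lemma wc: "w \<in> carrier G" by (rule Quad_carrier[OF w])

lemma A_A2: "A \<subseteq> A2" unfolding A2_def by (rule adjoin_sup[OF A_elem wc])

lemma w_A2: "w \<in> A2" unfolding A2_def by (rule adjoin_mem[OF A_elem wc])

lemma A2_C: "b \<in> A2 \<Longrightarrow> b \<in> C"
proof -
  assume "b \<in> A2"
  then obtain a i where b: "b = a \<otimes> w [^] (i::int)" "a \<in> A" unfolding A2_def by blast
  show "b \<in> C" unfolding b(1)
    by (rule subgroup.m_closed[OF C_sub Y_C[OF A_Y[OF b(2)]] subgroup_int_pow_closed[OF C_sub Quad_C[OF w]]])
qed

lemma lA: "func A l"
  using l2 A_elem A_A2 unfolding func_def fphom_def by blast

abbreviation I :: "('a \<Rightarrow> int) \<Rightarrow> bool" where "I F \<equiv> rep A l F"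

lemmas I_add = rep_add[OF lA A_sub subset_refl]
lemmas I_scale = rep_scale[OF lA A_sub subset_refl]
lemmas I_const = rep_const[OF lA A_sub elem_z[OF A_elem]]
lemmas I_H1 = H1_rep[OF lA A_sub subset_refl Omega_A]

lemma h_H1: "g \<in> carrier G \<Longrightarrow> H1 (h g)"
  using h[of g] Quad_kap[OF w, of g] unfolding H1_def Omega_def by blast

lemma lin_unique: "lin u f \<Longrightarrow> lin u f' \<Longrightarrow> x \<in> carrier G \<Longrightarrow> [f x = f' x] (mod int p)"
  using lin_kap[of u f x] lin_kap[of u f' x] zi_eq[of "f x" "f' x"] by simp

lemma h_mult:
  assumes g: "g \<in> carrier G" "g' \<in> carrier G" and x: "x \<in> carrier G"
  shows "[h (g \<otimes> g') x = h g x + h g' x] (mod int p)"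
proof -
  have "kap w (g \<otimes> g') = (z [^] h g g' \<otimes> kap w g) \<otimes> kap w g'"
    using g wc h by (simp add: kap_mult_right cj_eq_kap lin_kap)
  then have "lin (kap w (g \<otimes> g')) (\<lambda>x. (0 + h g x) + h g' x)"
    using lin_mult[OF lin_mult[OF lin_Z[OF zi_Z, of "h g g'"] h[OF g(1)]] h[OF g(2)]] by simp
  from lin_unique[OF h[OF m_closed[OF g]] this x] show ?thesis by simp
qed

lemma h_self: "x \<in> carrier G \<Longrightarrow> [h w x = 0] (mod int p)"
proof -
  have "kap w w = \<one>" using kap_eq_one[OF wc wc] by simp
  then have "lin (kap w w) (\<lambda>_. 0)" using lin_Z[OF one_closed_Z] by simp
  then show "x \<in> carrier G \<Longrightarrow> [h w x = 0] (mod int p)" using lin_unique[OF h[OF wc]] by blast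
qed

text \<open>In \<open>kap w (a \<otimes> b) = z [^] h a b \<otimes> kap w a \<otimes> kap w
  b\<close> the last two factors commute, so the antisymmetric part of \<open>h\<close> measures the
  action of \<open>w\<close> on commutators. For symmetric \<open>h\<close> all commutators would
  commute with \<open>w\<close>, as do the \<open>p\<close>-th powers, which lie in
  \<open>N\<close>; then \<open>w\<close> would centralize \<open>Phi\<close>.\<close>

lemma h_not_symmetric:
  "\<exists>a \<in> carrier G. \<exists>b \<in> carrier G. \<not> [h a b = h b a] (mod int p)"
proof (rule ccontr)
  assume "\<not> ?thesis"
  then have sym: "[h a b = h b a] (mod int p)" if "a \<in> carrier G" "b \<in> carrier G" for a b using that by blast
  have K: "subgroup (cent {w}) G" by (rule centralizer_subgroup) (use wc in simp)
  have "Phi \<subseteq> cent {w}"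
  proof (rule Phi_least[OF K])
    fix a assume a: "a \<in> carrier G"
    show "a [^] p \<in> cent {w}" using C_comm[OF Quad_C[OF w] N_pow[OF a]] a by (simp add: cent_iff)
    fix b assume b: "b \<in> carrier G"
    have k: "kap w (c \<otimes> d) = z [^] h c d \<otimes> kap w c \<otimes> kap w d" if "c \<in> carrier G" "d \<in> carrier G" for c d
      using that wc h by (simp add: kap_mult_right cj_eq_kap lin_kap)
    have "kap w a \<otimes> kap w b = kap w b \<otimes> kap w a" by (rule lin_lin_comm[OF h[OF a] h[OF b]])
    moreover have "z [^] h a b = z [^] h b a" unfolding zi_eq by (rule sym[OF a b])
    ultimately have "kap w (a \<otimes> b) = kap w (b \<otimes> a)"
      unfolding k[OF a b] k[OF b a] using a b wc by (simp add: m_assoc)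
    then have "cj (a \<otimes> b) w = cj (b \<otimes> a) w" using a b wc by (simp add: cj_eq_kap)
    then have "cj (inv (b \<otimes> a)) (cj (a \<otimes> b) w) = cj (inv (b \<otimes> a)) (cj (b \<otimes> a) w)" by simp
    then have "cj (a \<otimes> b \<otimes> inv (b \<otimes> a)) w = w" using a b wc by (simp add: cj_cj)
    moreover have "a \<otimes> b \<otimes> inv (b \<otimes> a) = a \<otimes> b \<otimes> inv a \<otimes> inv b" using a b by (simp add: inv_mult_group m_assoc)
    ultimately have "w \<otimes> (a \<otimes> b \<otimes> inv a \<otimes> inv b) = (a \<otimes> b \<otimes> inv a \<otimes> inv b) \<otimes> w"
      using a b wc by (simp add: cj_comm)
    then show "a \<otimes> b \<otimes> inv a \<otimes> inv b \<in> cent {w}" using a b by (simp add: cent_iff)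
  qed
  then have "w \<in> cent Phi" using wc unfolding cent_iff subset_iff by (metis singletonI)
  then show False using wPhi by blast
qed

lemma h_nonzero: "\<exists>a \<in> carrier G. \<exists>b \<in> carrier G. [h a b = 1] (mod int p)"
proof -
  have "\<exists>a \<in> carrier G. \<exists>b \<in> carrier G. \<not> [h a b = 0] (mod int p)"
    using h_not_symmetric by (metis cong_sym cong_trans)
  then show ?thesis using hm_scale[OF H1_hm[OF h_H1]] by blast
qed

text \<open>The cubic function is the product of \<open>lam\<close> with the quadratic function of \<open>w\<close>, minus a correction \<open>q\<close> which takes
  care of the products \<open>h g * lam\<close> that do not come from elements of order \<open>p\<close>.\<close>

lemma kap_of_function:
  assumes lam: "H1 lam" and g1: "g1 \<in> carrier G" "\<not> [lam g1 = 0] (mod int p)"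
    and qinv: "\<And>b x. b \<in> Phi \<union> C \<Longrightarrow> x \<in> carrier G \<Longrightarrow> [q (b \<otimes> x) = q x] (mod int p)"
    and q: "\<And>g. g \<in> carrier G \<Longrightarrow> I (\<lambda>x. h g x * lam x - (q (g \<otimes> x) - q x))"
  shows "\<exists>y \<in> C. \<exists>g \<in> carrier G. \<exists>a \<in> A. kap y g = w \<otimes> a"
proof -
  define P where "P x = l (cj x w)" for x
  define F where "F x = P x * lam x - q x" for x
  have lm: "[lam (a \<otimes> b) = lam a + lam b] (mod int p)" if "a \<in> carrier G" "b \<in> carrier G" for a b
    using hmD[OF H1_hm[OF lam] that] .
  have P: "[P (g \<otimes> x) = P x + h g x + l (kap w g)] (mod int p)" if g: "g \<in> carrier G" and x: "x \<in> carrier G" for g x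
  proof -
    have kA: "kap w g \<in> A2" using Quad_kap[OF w g] Omega_A A_A2 by blast
    have e: "cj (g \<otimes> x) w = cj x (kap w g \<otimes> w)" using g x wc by (simp add: cj_cj[symmetric] cj_eq_kap[of w g])
    show ?thesis unfolding P_def e
      using func_cj_mult[OF l2 kA w_A2 x] lin_func[OF l2 h[OF g] kA x]
      unfolding cong_iff_dvd_diff by Groebner_Basis.algebra
  qed
  \<comment> \<open>A Leibniz rule: apart from \<open>h g x * lam x\<close>, which \<open>q\<close>
    has to compensate, and terms in \<open>I\<close>, only \<open>lam g * P x\<close> remains. It is
    represented by a power of \<open>w\<close>, and by \<open>w\<close> itself once
    \<open>lam g = 1\<close>.\<close>
  have dF: "[F (g \<otimes> x) - F x = lam g * P x + (lam g * h g x + lam g * l (kap w g) + l (kap w g) * lam x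
      + (h g x * lam x - (q (g \<otimes> x) - q x)))] (mod int p)" if g: "g \<in> carrier G" and x: "x \<in> carrier G" for g x
  proof -
    have "F (g \<otimes> x) - F x - (lam g * P x + (lam g * h g x + lam g * l (kap w g) + l (kap w g) * lam x
      + (h g x * lam x - (q (g \<otimes> x) - q x)))) =
      (P (g \<otimes> x) - (P x + h g x + l (kap w g))) * lam (g \<otimes> x) +
      (P x + h g x + l (kap w g)) * (lam (g \<otimes> x) - (lam g + lam x))"
      unfolding F_def by (simp add: algebra_simps)
    then show ?thesis using P[OF g x] lm[OF g x] unfolding cong_iff_dvd_diff
      by (simp only: dvd_add dvd_mult dvd_mult2)
  qed
  have rest: "I (\<lambda>x. lam g * h g x + lam g * l (kap w g) + l (kap w g) * lam x
      + (h g x * lam x - (q (g \<otimes> x) - q x)))" if g: "g \<in> carrier G" for g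
    by (intro I_add I_scale I_H1 I_const lam h_H1 g q)
  have A2s: "subgroup A2 G" by (rule elem_sub[OF func_elem[OF l2]])
  have IA2: "rep A2 l H" if "I H" for H using that A_A2 unfolding rep_def by blast
  have repP: "rep A2 l P" unfolding rep_def P_def using w_A2 by (intro bexI[of _ w]) auto
  have fix_w: "[P (b \<otimes> x) = P x] (mod int p)" if "b \<in> carrier G" "w \<otimes> b = b \<otimes> w" "x \<in> carrier G" for b x
  proof -
    have "cj b w = w" using that wc by (simp add: cj_comm)
    then have "cj (b \<otimes> x) w = cj x w" using that wc cj_cj[of x b w] by simp
    then show ?thesis by (simp add: P_def)
  qed
  have inv: "[F (b \<otimes> x) - F x = 0] (mod int p)"
    if b: "b \<in> carrier G" "w \<otimes> b = b \<otimes> w" "b \<in> Phi \<union> C" and x: "x \<in> carrier G" for b x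
  proof -
    have "[lam b = 0] (mod int p)" using b(3) hm_Phi[OF H1_hm[OF lam]] H1_C[OF lam] by blast
    then have "[lam (b \<otimes> x) = lam x] (mod int p)" using lm[OF b(1) x] unfolding cong_iff_dvd_diff
      by Groebner_Basis.algebra
    then have "[F (b \<otimes> x) = F x] (mod int p)" unfolding F_def
      by (intro cong_diff cong_mult fix_w b x qinv)
    then show ?thesis by (simp add: cong_iff_dvd_diff)
  qed
  have "\<exists>y \<in> carrier G. \<forall>g \<in> carrier G. kap y g \<in> A2 \<and>
    (\<forall>x \<in> carrier G. [F (g \<otimes> x) - F x = l (cj x (kap y g))] (mod int p))"
  proof (rule crossed_hom_of_function[OF l2])
    fix g assume g: "g \<in> carrier G"
    have "rep A2 l (\<lambda>x. lam g * P x + (lam g * h g x + lam g * l (kap w g) + l (kap w g) * lam x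
      + (h g x * lam x - (q (g \<otimes> x) - q x))))"
      by (rule rep_add[OF l2 A2s subset_refl rep_scale[OF l2 A2s subset_refl repP] IA2[OF rest[OF g]]])
    then show "rep A2 l (\<lambda>x. F (g \<otimes> x) - F x)" by (rule rep_cong) (rule dF[OF g])
  next
    fix a x assume a: "a \<in> A2" and x: "x \<in> carrier G"
    have "[F (a \<otimes> x) - F x = 0] (mod int p)"
      using inv[OF elem_carrier[OF func_elem[OF l2] a] elem_comm[OF func_elem[OF l2] w_A2 a] _ x] A2_C[OF a] by blast
    then show "[F (a \<otimes> x) = F x] (mod int p)" by (simp add: cong_iff_dvd_diff)
  qed
  then obtain y where y: "y \<in> carrier G" and yA: "\<And>g. g \<in> carrier G \<Longrightarrow> kap y g \<in> A2"
    and yF: "\<And>g x. g \<in> carrier G \<Longrightarrow> x \<in> carrier G \<Longrightarrow> [F (g \<otimes> x) - F x = l (cj x (kap y g))] (mod int p)"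
    by blast
  have "kap y n = \<one>" if n: "n \<in> N" for n
  proof (rule func_inj[OF l2 yA[OF N_carrier[OF n]]])
    fix x assume x: "x \<in> carrier G"
    show "[l (cj x (kap y n)) = 0] (mod int p)"
      using cong_trans[OF cong_sym[OF yF[OF N_carrier[OF n] x]] inv[OF N_carrier[OF n] C_comm[OF Quad_C[OF w] n] _ x]]
        N_Phi[OF n] by blast
  qed
  then have yC: "y \<in> C" using y N_carrier by (simp add: cent_iff kap_eq_one)
  obtain g where g: "g \<in> carrier G" "[lam g = 1] (mod int p)" using hm_scale[OF H1_hm[OF lam] g1] by blast
  obtain a where a: "a \<in> A" "\<And>x. x \<in> carrier G \<Longrightarrow> [lam g * h g x + lam g * l (kap w g) + l (kap w g) * lam x
      + (h g x * lam x - (q (g \<otimes> x) - q x)) = l (cj x a)] (mod int p)"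
    using rest[OF g(1)] unfolding rep_def by blast
  have aA: "a \<in> A2" using a A_A2 by blast
  have "kap y g = w \<otimes> a"
  proof (rule func_eq[OF l2 yA[OF g(1)] elem_m[OF func_elem[OF l2] w_A2 aA]])
    fix x assume x: "x \<in> carrier G"
    have "[F (g \<otimes> x) - F x = lam g * P x + l (cj x a)] (mod int p)"
      by (rule cong_trans[OF dF[OF g(1) x] cong_add[OF cong_refl a(2)[OF x]]])
    moreover have "[lam g * P x = P x] (mod int p)" using cong_scalar_right[OF g(2), of "P x"] by simp
    ultimately show "[l (cj x (kap y g)) = l (cj x (w \<otimes> a))] (mod int p)"
      using yF[OF g(1) x] func_cj_mult[OF l2 w_A2 aA x] unfolding P_def cong_iff_dvd_diff by Groebner_Basis.algebra
  qed
  then show ?thesis using yC g(1) a(1) by blast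
qed

section \<open>Products of homomorphisms and the order of their elements\<close>

text \<open>Unlike in \<open>I F\<close>, the element \<open>y\<close> representing \<open>F\<close> need not have order \<open>p\<close>; its \<open>p\<close>-th power is central, so
  that the functions with \<open>J\<close> form an extension of those with \<open>I\<close> by at most one dimension.\<close>

definition J :: "'a \<Rightarrow> ('a \<Rightarrow> int) \<Rightarrow> bool" where
  "J y F \<longleftrightarrow> y \<in> Y \<and> (\<forall>g \<in> carrier G. kap y g \<in> A \<and>
     (\<forall>x \<in> carrier G. [F (g \<otimes> x) - F x = l (cj x (kap y g))] (mod int p)))"

lemma kap_Y_mult: "x \<in> Y \<Longrightarrow> y \<in> Y \<Longrightarrow> g \<in> carrier G \<Longrightarrow> kap y g \<in> A \<Longrightarrow> kap (x \<otimes> y) g = kap x g \<otimes> kap y g"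
proof -
  assume xy: "x \<in> Y" "y \<in> Y" and g: "g \<in> carrier G" and k: "kap y g \<in> A"
  have "x \<otimes> kap y g \<otimes> inv x = kap y g"
    using Y_comm[OF xy(1) A_Y[OF k]] xy g by (simp add: m_assoc Y_carrier)
  then show ?thesis using xy g by (simp add: kap_mult_left Y_carrier)
qed

lemma J_mult: "J x F \<Longrightarrow> J y H \<Longrightarrow> J (x \<otimes> y) (\<lambda>x. F x + H x)"
  unfolding J_def
proof (intro conjI ballI; (elim conjE)?)
  assume "x \<in> Y" "y \<in> Y"
  then show "x \<otimes> y \<in> Y" using subgroup.m_closed[OF Y_sub] by blast
next
  fix g assume g: "g \<in> carrier G" and xy: "x \<in> Y" "y \<in> Y" and
    x: "\<forall>g\<in>carrier G. kap x g \<in> A \<and> (\<forall>xa\<in>carrier G. [F (g \<otimes> xa) - F xa = l (cj xa (kap x g))] (mod int p))" and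
    y: "\<forall>g\<in>carrier G. kap y g \<in> A \<and> (\<forall>xa\<in>carrier G. [H (g \<otimes> xa) - H xa = l (cj xa (kap y g))] (mod int p))"
  have k: "kap x g \<in> A" "kap y g \<in> A" using x y g by auto
  have e: "kap (x \<otimes> y) g = kap x g \<otimes> kap y g" by (rule kap_Y_mult[OF xy g k(2)])
  show "kap (x \<otimes> y) g \<in> A" unfolding e by (rule elem_m[OF A_elem k])
  fix t assume t: "t \<in> carrier G"
  have "[F (g \<otimes> t) - F t = l (cj t (kap x g))] (mod int p)" "[H (g \<otimes> t) - H t = l (cj t (kap y g))] (mod int p)"
    using x y g t by blast+
  then show "[F (g \<otimes> t) + H (g \<otimes> t) - (F t + H t) = l (cj t (kap (x \<otimes> y) g))] (mod int p)"
    using func_cj_mult[OF lA k t] unfolding e cong_iff_dvd_diff by Groebner_Basis.algebra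
qed

lemma J_Z: "c \<in> Z \<Longrightarrow> J c (\<lambda>_. 0)"
proof -
  assume c: "c \<in> Z"
  have k: "kap c g = \<one>" if "g \<in> carrier G" for g
    using c that Z_comm[of c g] by (simp add: kap_eq_one Z_carrier)
  have "\<one> \<in> A" using subgroup.one_closed[OF A_sub] .
  moreover have "[0 = l \<one>] (mod int p)" using cong_sym[OF fphom_one[OF func_hom[OF lA] A_sub]] .
  ultimately show ?thesis using Z_Y[OF c] k by (simp add: J_def)
qed

lemma J_pow: "J y F \<Longrightarrow> J (y [^] (n::nat)) (\<lambda>x. int n * F x) \<and> (\<forall>g \<in> carrier G. kap (y [^] n) g = kap y g [^] n)"
proof (induction n)
  case 0
  then show ?case using J_Z[OF one_closed_Z] by (auto simp: kap_def)
next
  case (Suc n)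
  then have IH: "J (y [^] n) (\<lambda>x. int n * F x)" "\<forall>g \<in> carrier G. kap (y [^] n) g = kap y g [^] n" by blast+
  have "kap (y [^] n \<otimes> y) g = kap (y [^] n) g \<otimes> kap y g" if "g \<in> carrier G" for g
    using kap_Y_mult[OF _ _ that] IH(1) Suc.prems that by (simp add: J_def)
  moreover have "J (y [^] n \<otimes> y) (\<lambda>x. int n * F x + F x)" by (rule J_mult[OF IH(1) Suc.prems])
  ultimately show ?case using IH(2) by (simp add: algebra_simps)
qed

lemma J_pow_Z: "J y F \<Longrightarrow> y [^] p \<in> Z"
proof -
  assume J: "J y F"
  then have yc: "y \<in> carrier G" by (simp add: J_def Y_carrier)
  have "kap (y [^] p) g = \<one>" if "g \<in> carrier G" for g
    using J_pow[OF J, of p] A_pow J that by (simp add: J_def)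
  then show ?thesis using yc by (simp add: Z_iff kap_eq_one)
qed

text \<open>If \<open>y\<close> has order \<open>p\<close>, it lies in \<open>A\<close>; then
  \<open>F\<close> and \<open>x \<mapsto> l (cj x y)\<close> have the same differences, so they
  differ by a constant.\<close>

lemma J_order_p: "J y F \<Longrightarrow> y [^] p = \<one> \<Longrightarrow> I F"
proof -
  assume J: "J y F" and "y [^] p = \<one>"
  then have yA: "y \<in> A" by (simp add: J_def A_def)
  have yc: "y \<in> carrier G" using J by (simp add: J_def Y_carrier)
  have "I (\<lambda>x. l (cj x y) + (F \<one> - l y))"
    by (rule I_add[OF _ I_const]) (use yA in \<open>auto simp: rep_def intro!: bexI[of _ y]\<close>)
  then show "I F"
  proof (rule rep_cong)
    fix g assume g: "g \<in> carrier G"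
    have k: "kap y g \<in> A" and "[F (g \<otimes> \<one>) - F \<one> = l (cj \<one> (kap y g))] (mod int p)"
      using J g one_closed unfolding J_def by blast+
    then have "[F g - F \<one> = l (kap y g)] (mod int p)" using g yc by simp
    moreover have "[l (cj g y) = l (kap y g) + l y] (mod int p)"
      unfolding cj_eq_kap[OF yc g] by (rule fphomD[OF func_hom[OF lA] k yA])
    ultimately show "[F g = l (cj g y) + (F \<one> - l y)] (mod int p)"
      unfolding cong_iff_dvd_diff by Groebner_Basis.algebra
  qed
qed

lemma J_correct:
  assumes F: "J y F" and c: "c \<in> Z" "y [^] p = c [^] p" shows "I F"
proof -
  have yc: "y \<in> carrier G" using F by (simp add: J_def Y_carrier)
  note ic = pow_mult_inv_Z[OF yc c]
  from J_order_p[OF J_mult[OF F J_Z[OF ic(1)]] ic(2)] show ?thesis by simp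
qed

lemma J_dichotomy:
  assumes F0: "J y0 F0" "\<not> I F0" and F: "J y F"
  shows "\<exists>i::int. I (\<lambda>x. F x + i * F0 x)"
proof -
  have Y: "y0 \<in> Y" "y \<in> Y" using F0 F by (simp_all add: J_def)
  have yc: "y0 \<in> carrier G" "y \<in> carrier G" using Y Y_carrier by auto
  have ne: "y0 [^] p \<noteq> e [^] p" if "e \<in> Z" for e using J_correct[OF F0(1) that] F0(2) by blast
  have rel: "y0 \<otimes> y = y \<otimes> y0 \<otimes> z [^] (0::int)" using Y_comm[OF Y] yc by simp
  obtain i d where d: "d \<in> Z" "(y \<otimes> y0 [^] (i::nat) \<otimes> d) [^] p = \<one>"
    using power_correction[OF yc(2) J_pow_Z[OF F] yc(1) J_pow_Z[OF F0(1)] ne rel] by blast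
  have "J (y \<otimes> y0 [^] i \<otimes> d) (\<lambda>x. (F x + int i * F0 x) + 0)"
    by (intro J_mult F J_pow[THEN conjunct1] F0 J_Z d)
  from J_order_p[OF this d(2)] show ?thesis by (intro exI[of _ "int i"]) simp
qed

text \<open>The differences of \<open>s * t\<close> are affine in \<open>s\<close> and
  \<open>t\<close>, hence represented in \<open>A\<close>, which contains \<open>Omega\<close>. As
  \<open>s\<close> and \<open>t\<close> vanish on \<open>C\<close> and on \<open>Phi\<close>, the
  resulting element centralizes both, which puts it into \<open>Y\<close>.\<close>

lemma J_prod:
  assumes s: "H1 s" and t: "H1 t" shows "\<exists>y. J y (\<lambda>x. s x * t x)"
proof -
  have dF: "[s (g \<otimes> x) * t (g \<otimes> x) - s x * t x = s g * t x + t g * s x + s g * t g] (mod int p)"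
    if "g \<in> carrier G" "x \<in> carrier G" for g x
    using hmD[OF H1_hm[OF s] that] hmD[OF H1_hm[OF t] that] unfolding cong_iff_dvd_diff by Groebner_Basis.algebra
  have z0: "[s (b \<otimes> x) * t (b \<otimes> x) - s x * t x = 0] (mod int p)"
    if b: "b \<in> carrier G" "b \<in> C \<union> Phi" and x: "x \<in> carrier G" for b x
  proof -
    have "[s b = 0] (mod int p)" "[t b = 0] (mod int p)"
      using b hm_Phi[OF H1_hm[OF s]] hm_Phi[OF H1_hm[OF t]] H1_C[OF s] H1_C[OF t] by blast+
    then show ?thesis using dF[OF b(1) x] unfolding cong_iff_dvd_diff by Groebner_Basis.algebra
  qed
  have "\<exists>y \<in> carrier G. \<forall>g \<in> carrier G. kap y g \<in> A \<and>
    (\<forall>x \<in> carrier G. [s (g \<otimes> x) * t (g \<otimes> x) - s x * t x = l (cj x (kap y g))] (mod int p))"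
  proof (rule crossed_hom_of_function[OF lA, where F = "\<lambda>x. s x * t x"])
    fix g assume g: "g \<in> carrier G"
    have "I (\<lambda>x. s g * t x + t g * s x + s g * t g)" by (intro I_add I_scale I_H1 I_const s t)
    then show "I (\<lambda>x. s (g \<otimes> x) * t (g \<otimes> x) - s x * t x)" by (rule rep_cong) (rule dF[OF g])
  next
    fix a x assume a: "a \<in> A" and x: "x \<in> carrier G"
    have "[s (a \<otimes> x) * t (a \<otimes> x) - s x * t x = 0] (mod int p)"
      using z0[OF _ _ x, of a] Y_Phi[OF A_Y[OF a]] Phi_carrier by blast
    then show "[s (a \<otimes> x) * t (a \<otimes> x) = s x * t x] (mod int p)" by (simp add: cong_iff_dvd_diff)
  qed
  then obtain y where y: "y \<in> carrier G" and yA: "\<And>g. g \<in> carrier G \<Longrightarrow> kap y g \<in> A" and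
    yF: "\<And>g x. g \<in> carrier G \<Longrightarrow> x \<in> carrier G \<Longrightarrow> [s (g \<otimes> x) * t (g \<otimes> x) - s x * t x = l (cj x (kap y g))] (mod int p)"
    by blast
  have "kap y b = \<one>" if b: "b \<in> C \<union> Phi" for b
  proof -
    have bc: "b \<in> carrier G" using b C_carrier Phi_carrier by blast
    show ?thesis
      by (rule func_inj[OF lA yA[OF bc]]) (rule cong_trans[OF cong_sym[OF yF[OF bc]] z0[OF bc b]])
  qed
  then have "y \<in> Y" using y C_carrier Phi_carrier kap_eq_one unfolding Y_iff by blast
  then show ?thesis using yA yF by (auto simp: J_def)
qed

section \<open>Compensating the products in the cubic function\<close>

lemma I_cancel:
  assumes "\<not> I F0" and "I (\<lambda>x. c * F0 x)" shows "[c = 0] (mod int p)"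
proof (rule ccontr)
  assume "\<not> [c = 0] (mod int p)"
  then obtain k where k: "[c * k = 1] (mod int p)" using ex_inverse_mod by blast
  have "I F0"
  proof (rule rep_cong[OF I_scale[OF assms(2), of k]])
    fix g
    show "[F0 g = k * (c * F0 g)] (mod int p)" using cong_sym[OF cong_scalar_right[OF k, of "F0 g"]] by (simp add: mult_ac)
  qed
  then show False using assms(1) by blast
qed

text \<open>As no multiple of \<open>F0\<close> by a unit is in \<open>I\<close>, the coefficient
  \<open>k g\<close> is unique modulo \<open>p\<close>, and the additivity of \<open>h\<close> in
  its first argument passes to \<open>k\<close>. From \<open>h w = 0\<close> comes
  \<open>k w = 0\<close>; this is why it suffices later to control the homomorphisms that vanish at
  \<open>w\<close>.\<close>

lemma I_coefficient_hm:
  assumes F0: "\<not> I F0" and k: "\<And>g. g \<in> carrier G \<Longrightarrow> I (\<lambda>x. h g x * lam x + k g * F0 x)"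
  shows "hm k" "[k w = 0] (mod int p)"
proof -
  show "hm k"
    unfolding fphom_def
  proof (intro ballI)
    fix a b assume ab: "a \<in> carrier G" "b \<in> carrier G"
    have "I (\<lambda>x. (h (a \<otimes> b) x * lam x + k (a \<otimes> b) * F0 x) + (- 1) * ((h a x * lam x + k a * F0 x) + (h b x * lam x + k b * F0 x)))"
      by (intro I_add I_scale k m_closed ab)
    then have "I (\<lambda>x. (k (a \<otimes> b) - (k a + k b)) * F0 x)"
    proof (rule rep_cong)
      fix x assume x: "x \<in> carrier G"
      show "[(k (a \<otimes> b) - (k a + k b)) * F0 x = h (a \<otimes> b) x * lam x + k (a \<otimes> b) * F0 x + - 1 * (h a x * lam x + k a * F0 x + (h b x * lam x + k b * F0 x))] (mod int p)"
        using h_mult[OF ab x] unfolding cong_iff_dvd_diff by Groebner_Basis.algebra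
    qed
    from I_cancel[OF F0 this] show "[k (a \<otimes> b) = k a + k b] (mod int p)" by (simp add: cong_iff_dvd_diff)
  qed
  have "I (\<lambda>x. k w * F0 x)"
  proof (rule rep_cong[OF k[OF wc]])
    fix x assume "x \<in> carrier G"
    then show "[k w * F0 x = h w x * lam x + k w * F0 x] (mod int p)"
      using h_self[of x] unfolding cong_iff_dvd_diff by Groebner_Basis.algebra
  qed
  then show "[k w = 0] (mod int p)" by (rule I_cancel[OF F0])
qed

lemma lin_J:
  assumes "lin v e" "v \<in> Y" shows "J v e"
proof -
  have "z [^] i \<in> A" for i :: int by (rule elem_int_pow[OF A_elem elem_z[OF A_elem]])
  moreover have "[e (g \<otimes> x) - e x = l (cj x (z [^] e g))] (mod int p)" if "g \<in> carrier G" "x \<in> carrier G" for g x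
    using hmD[OF lin_hm[OF assms(1)] that] func_zi[OF lA that(2), of "e g"] unfolding cong_iff_dvd_diff
    by Groebner_Basis.algebra
  ultimately show ?thesis using assms by (simp add: J_def lin_kap)
qed

text \<open>Comparing the differences of \<open>e\<close> with those of
  \<open>x \<mapsto> l (cj x a)\<close> gives \<open>kap a g = z [^] e g\<close>, and
  \<open>a\<close> has order \<open>p\<close>. Thus a homomorphism outside \<open>H1\<close> is
  outside \<open>I\<close> too and can represent what \<open>I\<close> misses.\<close>

lemma I_imp_H1:
  assumes e: "hm e" and I: "I e" shows "H1 e"
proof -
  obtain a where a: "a \<in> A" "\<And>x. x \<in> carrier G \<Longrightarrow> [e x = l (cj x a)] (mod int p)" using I unfolding rep_def by blast
  have ac: "a \<in> carrier G" using a A_Y Y_carrier by blast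
  have "kap a g = z [^] e g" if g: "g \<in> carrier G" for g
  proof -
    have "kap a g = cj g a \<otimes> inv a" using g ac by (simp add: cj_eq_kap m_assoc)
    then have k: "kap a g \<in> A" using elem_m[OF A_elem elem_cj[OF A_elem g a(1)] elem_inv[OF A_elem a(1)]] by simp
    show ?thesis
    proof (rule func_eq[OF lA k elem_int_pow[OF A_elem elem_z[OF A_elem]]])
      fix x assume x: "x \<in> carrier G"
      have "cj (g \<otimes> x) a = cj x (kap a g \<otimes> a)" using g x ac by (simp add: cj_cj[symmetric] cj_eq_kap[of a g])
      then have "[l (cj (g \<otimes> x) a) = l (cj x (kap a g)) + l (cj x a)] (mod int p)"
        using func_cj_mult[OF lA k a(1) x] by simp
      then show "[l (cj x (kap a g)) = l (cj x (z [^] e g))] (mod int p)"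
        using a(2)[OF x] a(2)[OF m_closed[OF g x]] hmD[OF e g x] func_zi[OF lA x, of "e g"]
        unfolding cong_iff_dvd_diff by Groebner_Basis.algebra
    qed
  qed
  then have "lin a e" using ac by (simp add: lin_def)
  then show ?thesis using A_pow[OF a(1)] by (auto simp: H1_def)
qed

lemma I_square_prod:
  assumes s: "I (\<lambda>x. s x * s x)" and t: "I (\<lambda>x. t x * t x)" and st: "I (\<lambda>x. (s x + t x) * (s x + t x))"
  shows "I (\<lambda>x. s x * t x)"
proof -
  have "I (\<lambda>x. r * ((s x + t x) * (s x + t x) + ((- 1) * (s x * s x) + (- 1) * (t x * t x))))"
    by (intro I_scale I_add s t st)
  then show ?thesis
  proof (rule rep_cong)
    fix x
    have "s x * t x - r * ((s x + t x) * (s x + t x) + ((- 1) * (s x * s x) + (- 1) * (t x * t x)))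
      = s x * t x * (- (2 * r - 1))" by (simp add: algebra_simps)
    then show "[s x * t x = r * ((s x + t x) * (s x + t x) + ((- 1) * (s x * s x) + (- 1) * (t x * t x)))] (mod int p)"
      using half unfolding cong_iff_dvd_diff by (simp only: dvd_mult dvd_minus_iff)
  qed
qed

text \<open>Here \<open>e\<close> itself spans \<open>J\<close> modulo \<open>I\<close>: its element
  \<open>v\<close> centralizes \<open>Phi\<close>, hence also \<open>C\<close>, and lies in
  \<open>Y\<close>. Every product \<open>h g * lam\<close> is then a multiple of \<open>e\<close>
  modulo \<open>I\<close>, which the quadratic function of \<open>H1_compensation\<close> cancels.
  The inclusion of \<open>C\<close> in \<open>Phi\<close> also makes that function invariant under
  \<open>C\<close>.\<close>

lemma kap_of_linear_obstruction:
  assumes CP: "C \<subseteq> Phi" and e: "hm e" "\<not> H1 e"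
  shows "\<exists>y \<in> C. \<exists>g \<in> carrier G. \<exists>a \<in> A. kap y g = w \<otimes> a"
proof -
  obtain v where v: "lin v e" using ex_lin[OF e(1)] by blast
  have vP: "v \<otimes> x = x \<otimes> v" if "x \<in> Phi" for x using lin_cent_Phi[OF v] that unfolding cent_iff by blast
  then have "v \<in> Y" unfolding Y_iff using lin_carrier[OF v] CP by blast
  then have J: "J v e" by (rule lin_J[OF v])
  have eI: "\<not> I e" using I_imp_H1[OF e(1)] e(2) by blast
  obtain g0 g1 where g: "g0 \<in> carrier G" "g1 \<in> carrier G" "[h g0 g1 = 1] (mod int p)" using h_nonzero by blast
  let ?lam = "h g0"
  have lam: "H1 ?lam" "\<not> [?lam g1 = 0] (mod int p)"
    using h_H1[OF g(1)] cong_trans[OF cong_sym[OF g(3)]] one_not_cong by blast+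
  have "\<exists>i. I (\<lambda>x. h g x * ?lam x + i * e x)" if "g \<in> carrier G" for g
    using J_prod[OF h_H1[OF that] lam(1)] J_dichotomy[OF J eI] by blast
  then obtain k where k: "\<And>g. g \<in> carrier G \<Longrightarrow> I (\<lambda>x. h g x * ?lam x + k g * e x)" by metis
  obtain q where q1: "\<And>b x. b \<in> Phi \<Longrightarrow> x \<in> carrier G \<Longrightarrow> [q (b \<otimes> x) = q x] (mod int p)" and
    q2: "\<And>g. g \<in> carrier G \<Longrightarrow> \<exists>h c. H1 h \<and> (\<forall>x \<in> carrier G. [q (g \<otimes> x) - q x = k g * e x + h x + c] (mod int p))"
    using H1_compensation[OF e I_coefficient_hm(1)[OF eI k]] by blast
  show ?thesis
  proof (rule kap_of_function[OF lam(1) g(2) lam(2), where q = "\<lambda>x. - q x"])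
    fix b x assume "b \<in> Phi \<union> C" "x \<in> carrier G"
    then have "[q (b \<otimes> x) = q x] (mod int p)" using q1 CP by blast
    then show "[- q (b \<otimes> x) = - q x] (mod int p)" unfolding cong_iff_dvd_diff by Groebner_Basis.algebra
  next
    fix g assume g: "g \<in> carrier G"
    obtain t c where t: "H1 t" "\<And>x. x \<in> carrier G \<Longrightarrow> [q (g \<otimes> x) - q x = k g * e x + t x + c] (mod int p)"
      using q2[OF g] by blast
    have "I (\<lambda>x. (h g x * ?lam x + k g * e x) + (t x + c))" by (intro I_add k g I_H1 t I_const)
    then show "I (\<lambda>x. h g x * ?lam x - (- q (g \<otimes> x) - - q x))"
    proof (rule rep_cong)
      fix x assume x: "x \<in> carrier G"
      from t(2)[OF x] show "[h g x * ?lam x - (- q (g \<otimes> x) - - q x) = (h g x * ?lam x + k g * e x) + (t x + c)] (mod int p)"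
        unfolding cong_iff_dvd_diff by Groebner_Basis.algebra
    qed
  qed
qed

lemma kap_of_products:
  assumes lam: "H1 lam" and g1: "g1 \<in> carrier G" "\<not> [lam g1 = 0] (mod int p)"
    and I: "\<And>g. g \<in> carrier G \<Longrightarrow> I (\<lambda>x. h g x * lam x)"
  shows "\<exists>y \<in> C. \<exists>g \<in> carrier G. \<exists>a \<in> A. kap y g = w \<otimes> a"
  by (rule kap_of_function[OF lam g1, where q = "\<lambda>_. 0"]) (use I in simp_all)

text \<open>Here \<open>s^2\<close> spans the functions with \<open>J\<close> modulo those with \<open>I\<close>. Modulo the latter, the differences of \<open>s^2 k'\<close> and
  \<open>s t^2\<close> are the multiples \<open>k' g * s^2\<close> and \<open>- \<tau> s g * s^2\<close>, which suffice to compensate \<open>h g * s\<close>.\<close>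

lemma kap_of_compensated_square:
  assumes H: "\<And>m. hm m \<Longrightarrow> [m w = 0] (mod int p) \<Longrightarrow> H1 m"
    and s: "H1 s" "\<not> I (\<lambda>x. s x * s x)" and t: "H1 t" "I (\<lambda>x. t x * s x)" "\<not> I (\<lambda>x. t x * t x)"
    and dich: "\<And>t u. H1 t \<Longrightarrow> H1 u \<Longrightarrow> \<exists>i. I (\<lambda>x. t x * u x + i * (s x * s x))"
  shows "\<exists>y \<in> C. \<exists>g \<in> carrier G. \<exists>a \<in> A. kap y g = w \<otimes> a"
proof -
  have "\<exists>g1 \<in> carrier G. \<not> [s g1 = 0] (mod int p)"
  proof (rule ccontr)
    assume no: "\<not> ?thesis"
    have "I (\<lambda>x. s x * s x)"
    proof (rule rep_cong[OF I_const[of 0]])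
      fix x assume "x \<in> carrier G"
      then have "[s x = 0] (mod int p)" using no by blast
      then show "[s x * s x = 0] (mod int p)" unfolding cong_iff_dvd_diff by Groebner_Basis.algebra
    qed
    then show False using s by blast
  qed
  then obtain g1 where g1: "g1 \<in> carrier G" "\<not> [s g1 = 0] (mod int p)" by blast
  obtain k where k: "\<And>g. g \<in> carrier G \<Longrightarrow> I (\<lambda>x. h g x * s x + k g * (s x * s x))"
    using dich[OF h_H1 s(1)] by metis
  have kH: "H1 k" by (rule H[OF I_coefficient_hm[OF s(2) k]])
  obtain c where c: "I (\<lambda>x. k x * s x + c * (s x * s x))" using dich[OF kH s(1)] by blast
  \<comment> \<open>The shift by \<open>c * s\<close> brings \<open>s * k'\<close> into
    \<open>I\<close>, so that the mixed term in the difference of \<open>s^2 k'\<close> does no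
    harm.\<close>
  define k' where "k' x = k x + c * s x" for x
  have k'H: "H1 k'" unfolding k'_def by (intro H1_add H1_scale kH s)
  have sk': "I (\<lambda>x. s x * k' x)" by (rule rep_cong[OF c]) (simp add: k'_def algebra_simps)
  obtain \<tau> where \<tau>: "I (\<lambda>x. t x * t x + \<tau> * (s x * s x))" using dich[OF t(1) t(1)] by blast
  have "\<not> [\<tau> = 0] (mod int p)"
  proof
    assume "[\<tau> = 0] (mod int p)"
    then have "I (\<lambda>x. t x * t x)"
      using rep_cong[OF \<tau>, of "\<lambda>x. t x * t x"] unfolding cong_iff_dvd_diff by simp
    then show False using t by blast
  qed
  then obtain m where m: "[\<tau> * m = 1] (mod int p)" using ex_inverse_mod by blast
  \<comment> \<open>Replacing \<open>k\<close> by \<open>k'\<close> overcompensates by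
    \<open>c * s g * s^2\<close>. The second summand takes this back: its differences involve
    \<open>t^2\<close>, which is \<open>- \<tau> * s^2\<close> modulo \<open>I\<close>, and
    \<open>m\<close> inverts \<open>\<tau>\<close>.\<close>
  define q where "q x = - (s x * s x * k' x) - c * m * (s x * (t x * t x))" for x
  show ?thesis
  proof (rule kap_of_function[OF s(1) g1, where q = q])
    fix b x assume b: "b \<in> Phi \<union> C" and x: "x \<in> carrier G"
    then have bc: "b \<in> carrier G" using Phi_carrier C_carrier by blast
    have "[f (b \<otimes> x) = f x] (mod int p)" if f: "H1 f" for f
    proof -
      have "[f b = 0] (mod int p)" using b hm_Phi[OF H1_hm[OF f]] H1_C[OF f] by blast
      then show ?thesis using hmD[OF H1_hm[OF f] bc x] unfolding cong_iff_dvd_diff by Groebner_Basis.algebra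
    qed
    note * = this[OF s(1)] this[OF t(1)] this[OF k'H]
    show "[q (b \<otimes> x) = q x] (mod int p)" unfolding q_def
      by (intro cong_diff cong_mult cong_refl *, subst cong_minus_minus_iff, intro cong_mult *)
  next
    fix g assume g: "g \<in> carrier G"
    let ?a = "s g" and ?b = "k' g" and ?d = "t g"
    let ?R = "\<lambda>x. (h g x * s x + k g * (s x * s x)) + (((2 * ?a) * (s x * k' x) + ((2 * ?a * ?b) * s x + ((?a * ?a) * k' x + ?a * ?a * ?b)))
      + (c * m) * (((2 * ?d) * (t x * s x) + ((?d * ?d) * s x + ((2 * ?a * ?d) * t x + ?a * ?d * ?d)))
        + ?a * (t x * t x + \<tau> * (s x * s x))))"
    have "I ?R" by (intro I_add I_scale I_H1 I_const k g sk' s t \<tau> k'H)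
    then show "I (\<lambda>x. h g x * s x - (q (g \<otimes> x) - q x))"
    proof (rule rep_cong)
      fix x assume x: "x \<in> carrier G"
      have e: "[s (g \<otimes> x) = ?a + s x] (mod int p)" "[t (g \<otimes> x) = ?d + t x] (mod int p)" "[k' (g \<otimes> x) = ?b + k' x] (mod int p)"
        using hmD[OF H1_hm[OF s(1)] g x] hmD[OF H1_hm[OF t(1)] g x] hmD[OF H1_hm[OF k'H] g x] by auto
      let ?S = "?a + s x" and ?T = "?d + t x" and ?K = "?b + k' x"
      have "[q (g \<otimes> x) = - (?S * ?S * ?K) - c * m * (?S * (?T * ?T))] (mod int p)" unfolding q_def
        by (intro cong_diff cong_mult cong_refl e, subst cong_minus_minus_iff, intro cong_mult e)
      then have 1: "[h g x * s x - (q (g \<otimes> x) - q x) =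
         h g x * s x - ((- (?S * ?S * ?K) - c * m * (?S * (?T * ?T))) - q x)] (mod int p)"
        by (intro cong_diff cong_refl)
      have "h g x * s x - ((- (?S * ?S * ?K) - c * m * (?S * (?T * ?T))) - q x) - ?R x =
        - (c * ?a * (s x * s x)) * (\<tau> * m - 1)"
        unfolding q_def k'_def by (simp add: algebra_simps)
      then have "[h g x * s x - ((- (?S * ?S * ?K) - c * m * (?S * (?T * ?T))) - q x) = ?R x] (mod int p)"
        using m unfolding cong_iff_dvd_diff by (simp only: dvd_mult)
      with 1 show "[h g x * s x - (q (g \<otimes> x) - q x) = ?R x] (mod int p)" by (rule cong_trans)
    qed
  qed
qed

text \<open>Modulo \<open>I\<close> the products of functions in \<open>H1\<close> span at most one
  dimension, so multiplication is a symmetric bilinear form on \<open>H1\<close>. If all squares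
  vanish, so does the form, and no compensation is called for. Otherwise let \<open>s\<close> be
  anisotropic. An anisotropic \<open>t\<close> orthogonal to \<open>s\<close> permits a
  compensation. Without such a \<open>t\<close> the form vanishes on the orthogonal complement of
  \<open>s\<close>, which contains \<open>h g + k g * s\<close>; any nonzero \<open>lam\<close> in
  this complement then has all products \<open>h g * lam\<close> in \<open>I\<close>.\<close>

lemma kap_of_quadratic_obstruction:
  assumes H: "\<And>m. hm m \<Longrightarrow> [m w = 0] (mod int p) \<Longrightarrow> H1 m"
  shows "\<exists>y \<in> C. \<exists>g \<in> carrier G. \<exists>a \<in> A. kap y g = w \<otimes> a"
proof (cases "\<forall>s. H1 s \<longrightarrow> I (\<lambda>x. s x * s x)")
  case True
  obtain g0 g1 where g: "g0 \<in> carrier G" "g1 \<in> carrier G" "[h g0 g1 = 1] (mod int p)" using h_nonzero by blast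
  have n: "\<not> [h g0 g1 = 0] (mod int p)" using cong_trans[OF cong_sym[OF g(3)]] one_not_cong by blast
  show ?thesis
  proof (rule kap_of_products[OF h_H1[OF g(1)] g(2) n])
    fix g assume "g \<in> carrier G"
    then have "H1 (h g)" "H1 (h g0)" "H1 (\<lambda>x. h g x + h g0 x)" using h_H1 g(1) H1_add by blast+
    then show "I (\<lambda>x. h g x * h g0 x)" using I_square_prod[of "h g" "h g0"] True by blast
  qed
next
  case False
  then obtain s where s: "H1 s" "\<not> I (\<lambda>x. s x * s x)" by blast
  obtain y0 where y0: "J y0 (\<lambda>x. s x * s x)" using J_prod[OF s(1) s(1)] by blast
  have dich: "\<exists>i. I (\<lambda>x. t x * u x + i * (s x * s x))" if tu: "H1 t" "H1 u" for t u
    using J_prod[OF tu] J_dichotomy[OF y0 s(2)] by blast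
  show ?thesis
  proof (cases "\<exists>t. H1 t \<and> I (\<lambda>x. t x * s x) \<and> \<not> I (\<lambda>x. t x * t x)")
    case True
    then show ?thesis using kap_of_compensated_square[OF H s _ _ _ dich] by blast
  next
    case False
    then have sq: "I (\<lambda>x. t x * t x)" if "H1 t" "I (\<lambda>x. t x * s x)" for t using that by blast
    obtain k where k: "\<And>g. g \<in> carrier G \<Longrightarrow> I (\<lambda>x. h g x * s x + k g * (s x * s x))"
      using dich[OF h_H1 s(1)] by metis
    have k': "H1 (\<lambda>x. h g x + k g * s x)" "I (\<lambda>x. (h g x + k g * s x) * s x)" if "g \<in> carrier G" for g
    proof -
      show "H1 (\<lambda>x. h g x + k g * s x)" by (intro H1_add H1_scale h_H1 that s)
      show "I (\<lambda>x. (h g x + k g * s x) * s x)" by (rule rep_cong[OF k[OF that]]) (simp add: algebra_simps)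
    qed
    \<comment> \<open>If the orthogonal complement of \<open>s\<close> were zero, then
      \<open>h a b\<close> would be \<open>c * s a * s b\<close> and therefore symmetric.\<close>
    have "\<exists>lam. H1 lam \<and> I (\<lambda>x. lam x * s x) \<and> (\<exists>g1 \<in> carrier G. \<not> [lam g1 = 0] (mod int p))"
    proof (rule ccontr)
      assume "\<not> ?thesis"
      then have no: "[lam x = 0] (mod int p)" if "H1 lam" "I (\<lambda>x. lam x * s x)" "x \<in> carrier G" for lam x
        using that by blast
      have kH: "H1 k" by (rule H[OF I_coefficient_hm[OF s(2) k]])
      obtain c where c: "I (\<lambda>x. k x * s x + c * (s x * s x))" using dich[OF kH s(1)] by blast
      have c1: "H1 (\<lambda>x. k x + c * s x)" by (intro H1_add H1_scale kH s)
      have c2: "I (\<lambda>x. (k x + c * s x) * s x)" by (rule rep_cong[OF c]) (simp add: algebra_simps)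
      have hs: "[h a b = c * s a * s b] (mod int p)" if ab: "a \<in> carrier G" "b \<in> carrier G" for a b
        using no[OF k'[OF ab(1)] ab(2)] no[OF c1 c2 ab(1)] unfolding cong_iff_dvd_diff by Groebner_Basis.algebra
      have "[h a b = h b a] (mod int p)" if ab: "a \<in> carrier G" "b \<in> carrier G" for a b
        using hs[OF ab] hs[OF ab(2,1)] unfolding cong_iff_dvd_diff by Groebner_Basis.algebra
      then show False using h_not_symmetric by blast
    qed
    then obtain lam g1 where lam: "H1 lam" "I (\<lambda>x. lam x * s x)" "g1 \<in> carrier G" "\<not> [lam g1 = 0] (mod int p)" by blast
    show ?thesis
    proof (rule kap_of_products[OF lam(1,3,4)])
      fix g assume g: "g \<in> carrier G"
      let ?f = "\<lambda>x. h g x + k g * s x"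
      have "I (\<lambda>x. (?f x + lam x) * s x)"
        by (rule rep_cong[OF I_add[OF k'(2)[OF g] lam(2)]]) (simp add: algebra_simps)
      then have "I (\<lambda>x. (?f x + lam x) * (?f x + lam x))"
        by (rule sq[OF H1_add[OF k'(1)[OF g] lam(1)]])
      then have "I (\<lambda>x. ?f x * lam x)"
        using I_square_prod[of ?f lam] sq[OF k'[OF g]] sq[OF lam(1,2)] by blast
      then have "I (\<lambda>x. ?f x * lam x + (- k g) * (lam x * s x))" by (intro I_add I_scale lam(2))
      then show "I (\<lambda>x. h g x * lam x)" by (rule rep_cong) (simp add: algebra_simps)
    qed
  qed
qed

end

section \<open>Commutators of quadratic elements and the contradiction\<close>

context large_centralizer
begin

lemma kap_of_Quad:
  assumes w: "w \<in> Quad" "w [^] p = \<one>" "w \<notin> cent Phi" and CP: "C \<subseteq> Phi \<or> w \<notin> Phi"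
  shows "\<exists>y \<in> C. \<exists>g \<in> carrier G. \<exists>a \<in> Y. kap y g = w \<otimes> a"
proof -
  have "\<forall>g \<in> carrier G. \<exists>f. lin (kap w g) f" using Omega_lin Quad_kap[OF w(1)] by blast
  then have "\<exists>f. \<forall>g \<in> carrier G. lin (kap w g) (f g)" by (rule bchoice)
  then obtain f where f: "\<And>g. g \<in> carrier G \<Longrightarrow> lin (kap w g) (f g)" by blast
  note wc = Quad_carrier[OF w(1)]
  have "elem {a \<otimes> w [^] (i::int) | a i. a \<in> A}"
  proof (rule elem_adjoin[OF A_elem wc w(2)])
    fix a assume "a \<in> A"
    then show "w \<otimes> a = a \<otimes> w" using Y_cent_C[OF A_Y Quad_C[OF w(1)]] by simp
  next
    fix g assume "g \<in> carrier G"
    then show "kap w g \<in> A" using Quad_kap[OF w(1)] Omega_A by blast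
  qed
  then obtain l where l: "func {a \<otimes> w [^] (i::int) | a i. a \<in> A} l" using ex_func by blast
  interpret quad_element G p \<zeta> N r w l f
    by unfold_locales (use w l f in auto)
  have "\<exists>y \<in> C. \<exists>g \<in> carrier G. \<exists>a \<in> A. kap y g = w \<otimes> a"
  proof (cases "w \<in> Phi")
    case True
    then have CP': "C \<subseteq> Phi" using CP by blast
    show ?thesis
    proof (cases "\<exists>e. hm e \<and> \<not> H1 e")
      case True
      then show ?thesis using kap_of_linear_obstruction[OF CP'] by blast
    next
      case False
      then show ?thesis using kap_of_quadratic_obstruction by blast
    qed
  next
    case False
    \<comment> \<open>Every \<open>m\<close> that vanishes at \<open>w\<close> is in
      \<open>H1\<close>: otherwise some \<open>e + i * m\<close> would be in \<open>H1\<close> and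
      hence vanish at \<open>w\<close>, which lies in \<open>C\<close>, although its value there is
      1.\<close>
    obtain e where e: "hm e" "[e w = 1] (mod int p)" using hm_separation[OF wc False] by blast
    show ?thesis
    proof (rule kap_of_quadratic_obstruction, rule ccontr)
      fix m assume m: "hm m" "[m w = 0] (mod int p)" "\<not> H1 m"
      obtain i where i: "H1 (\<lambda>x. e x + i * m x)" using H1_dichotomy[OF m(1,3) e(1)] by blast
      have "[e w + i * m w = 0] (mod int p)" using H1_C[OF i Quad_C[OF w(1)]] .
      then have "[(1::int) = 0] (mod int p)" using e(2) m(2) unfolding cong_iff_dvd_diff by Groebner_Basis.algebra
      then show False using one_not_cong by blast
    qed
  qed
  then show ?thesis using A_Y by blast
qed

text \<open>In \<open>w = (w a) a^-1\<close> both factors commute with \<open>C\<close>: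
  \<open>w a\<close> is a commutator of an element of \<open>C\<close>, hence of \<open>Phi\<close>,
  and so lies in \<open>N\<close>, while \<open>a\<close> lies in \<open>Y\<close>. If
  \<open>w\<close> centralizes \<open>Phi\<close>, the inclusion of \<open>C\<close>
  suffices.\<close>

lemma Quad_central_in_C:
  assumes CP: "C \<subseteq> Phi" and w: "w \<in> Quad" "w [^] p = \<one>" and x: "x \<in> C"
  shows "w \<otimes> x = x \<otimes> w"
proof (cases "w \<in> cent Phi")
  case True
  have "x \<in> Phi" using CP x by blast
  with True show ?thesis unfolding cent_iff by blast
next
  case False
  then obtain y g a where y: "y \<in> C" "g \<in> carrier G" "a \<in> Y" "kap y g = w \<otimes> a"
    using kap_of_Quad[OF w] CP by blast
  have n: "w \<otimes> a \<in> N" using kap_Phi_N[of y g] y CP by auto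
  have ac: "a \<in> carrier G" and wc: "w \<in> carrier G" and xc: "x \<in> carrier G"
    using Y_carrier[OF y(3)] Quad_carrier[OF w(1)] C_carrier[OF x] by auto
  have ia: "inv a \<otimes> x = x \<otimes> inv a" by (rule comm_inv[OF ac xc Y_cent_C[OF y(3) x]])
  have "((w \<otimes> a) \<otimes> inv a) \<otimes> x = x \<otimes> ((w \<otimes> a) \<otimes> inv a)"
    by (rule comm_mult[OF _ _ xc C_comm[OF x n, symmetric] ia]) (use ac wc in auto)
  then show ?thesis using ac wc xc by (simp add: m_assoc)
qed

lemma kap_rel: "w \<in> carrier G \<Longrightarrow> v \<in> carrier G \<Longrightarrow> kap w v = z [^] (i::int) \<Longrightarrow> v \<otimes> w = w \<otimes> v \<otimes> z [^] (- i)"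
proof -
  assume w: "w \<in> carrier G" and v: "v \<in> carrier G" and k: "kap w v = z [^] i"
  have "cj v w = w \<otimes> z [^] i" using w v k Z_comm[OF zi_Z w, of i] by (simp add: cj_eq_kap)
  then have "v \<otimes> cj v w = v \<otimes> (w \<otimes> z [^] i)" by simp
  then have "w \<otimes> v = v \<otimes> w \<otimes> z [^] i" using w v by (simp add: cj_def m_assoc inv_r_cancel)
  then have "w \<otimes> v \<otimes> z [^] (- i) = v \<otimes> w \<otimes> (z [^] i \<otimes> z [^] (- i))" using w v by (simp add: m_assoc)
  then show ?thesis using w v by (simp add: int_pow_neg)
qed

text \<open>The correcting factors are a power of \<open>v\<close> and a central element; both
  commute with \<open>v\<close>, and \<open>kap\<close> is multiplicative on \<open>Quad\<close>, so
  the commutator with \<open>v\<close> is preserved.\<close>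

lemma Quad_corrected:
  assumes w: "w \<in> Quad" and v: "v \<in> Quad" "\<And>e. e \<in> Z \<Longrightarrow> v [^] p \<noteq> e [^] p" and k: "kap w v = z"
  shows "\<exists>u \<in> Quad. u [^] p = \<one> \<and> kap u v = z"
proof -
  note wc = Quad_carrier[OF w] and vc = Quad_carrier[OF v(1)]
  have rel: "v \<otimes> w = w \<otimes> v \<otimes> z [^] (- (1::int))" by (rule kap_rel[OF wc vc]) (simp add: k)
  obtain i c where c: "c \<in> Z" "(w \<otimes> v [^] (i::nat) \<otimes> c) [^] p = \<one>"
    using power_correction[OF wc Quad_pow_Z[OF w] vc Quad_pow_Z[OF v(1)] v(2) rel] by blast
  have q: "v [^] i \<in> Quad" "w \<otimes> v [^] i \<in> Quad" "c \<in> Quad"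
    using Quad_pow[OF v(1), of i] Quad_mult[OF w] Quad_Z[OF c(1)] by blast+
  have cc: "c \<in> carrier G" by (rule Z_carrier[OF c(1)])
  have "kap (v [^] i) v = \<one>" using comm_pow[OF vc vc refl, of i] vc by (simp add: kap_eq_one)
  moreover have "kap c v = \<one>" using Z_comm[OF c(1) vc] cc vc by (simp add: kap_eq_one)
  ultimately have "kap (w \<otimes> v [^] i \<otimes> c) v = z"
    using kap_Quad_mult[OF q(2,3) vc] kap_Quad_mult[OF w q(1) vc] k by simp
  then show ?thesis using c(2) Quad_mult[OF q(2,3)] by blast
qed

text \<open>Two noncommuting elements of \<open>Quad\<close> can be modified so that one of them has order \<open>p\<close>, contrary to
  \<open>Quad_central_in_C\<close>. If \<open>C\<close> is not contained in \<open>Phi\<close>, an element \<open>v\<close> of the second centre plays the role of the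
  other one.\<close>

lemma contradiction: False
proof (cases "C \<subseteq> Phi")
  case True
  obtain x where x: "x \<in> C" "x \<notin> N" using large by blast
  obtain w1 where w1: "w1 \<in> Quad" "kap w1 x = z" using Quad_separation[of x] x True by blast
  have nc: "\<not> u \<in> Quad \<or> u [^] p \<noteq> \<one>" if "kap u v = z" "v \<in> C" "u \<in> carrier G" for u v
    using Quad_central_in_C[OF True _ _ that(2), of u] that z_not_one kap_eq_one[OF that(3) C_carrier[OF that(2)]] by auto
  have w1p: "w1 [^] p \<noteq> e [^] p" if e: "e \<in> Z" for e
  proof
    assume eq: "w1 [^] p = e [^] p"
    note w1c = Quad_carrier[OF w1(1)] and xc = C_carrier[OF x(1)]
    note ie = pow_mult_inv_Z[OF w1c e eq]
    have iec: "inv e \<in> carrier G" by (rule Z_carrier[OF ie(1)])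
    have "kap (inv e) x = \<one>" using Z_comm[OF ie(1) xc] iec xc by (simp add: kap_eq_one)
    then have "kap (w1 \<otimes> inv e) x = z" using kap_Quad_mult[OF w1(1) Quad_Z[OF ie(1)] xc] w1(2) by simp
    then show False using nc[of "w1 \<otimes> inv e" x] Quad_mult[OF w1(1) Quad_Z[OF ie(1)]] x(1) w1c iec ie(2) by auto
  qed
  \<comment> \<open>Since \<open>w1\<close> fails to commute with \<open>x\<close> in
    \<open>C\<close>, it is outside \<open>N\<close>. It can thus take over the role of
    \<open>x\<close>, and being uncorrectable by the centre it corrects the order of its partner
    \<open>w2\<close>.\<close>
  have "w1 \<notin> N"
  proof
    assume "w1 \<in> N"
    then have "kap w1 x = \<one>" using C_comm[OF x(1), of w1] C_carrier[OF x(1)] N_carrier by (simp add: kap_eq_one)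
    then show False using w1 z_not_one by simp
  qed
  moreover have w1C: "w1 \<in> C" by (rule Quad_C[OF w1(1)])
  ultimately obtain w2 where w2: "w2 \<in> Quad" "kap w2 w1 = z" using Quad_separation[of w1] True by blast
  obtain u where "u \<in> Quad" "u [^] p = \<one>" "kap u w1 = z" using Quad_corrected[OF w2(1) w1(1) w1p w2(2)] by blast
  then show False using nc[OF _ w1C] Quad_carrier by blast
next
  case False
  then obtain c where c: "c \<in> C" "c \<notin> Phi" by blast
  note cc = C_carrier[OF c(1)]
  obtain e where e: "hm e" "[e c = 1] (mod int p)" using hm_separation[OF cc c(2)] by blast
  obtain v where v: "lin v e" using ex_lin[OF e(1)] by blast
  have nH: "\<not> H1 e"
  proof
    assume "H1 e"
    then have "[e c = 0] (mod int p)" using H1_C c(1) by blast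
    then show False using cong_trans[OF cong_sym[OF e(2)]] one_not_cong by blast
  qed
  have "v \<notin> N"
  proof
    assume "v \<in> N"
    then have "v \<otimes> c = c \<otimes> v" using C_comm[OF c(1)] by simp
    then have "[e c = 0] (mod int p)" using lin_comm[OF v cc] by simp
    then show False using cong_trans[OF cong_sym[OF e(2)]] one_not_cong by blast
  qed
  then obtain w1 where w1: "w1 \<in> Quad" "kap w1 v = z" using Quad_separation[OF lin_Phi[OF v]] by blast
  obtain w where w: "w \<in> Quad" "w [^] p = \<one>" "kap w v = z"
    using Quad_corrected[OF w1(1) Quad_lin[OF v] not_H1_power[OF nH v] w1(2)] by blast
  have wv: "w \<otimes> v \<noteq> v \<otimes> w" using w(3) z_not_one kap_eq_one[OF Quad_carrier[OF w(1)] lin_carrier[OF v]] by auto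
  \<comment> \<open>The element \<open>v\<close> both centralizes \<open>Phi\<close> and lies in it,
    so not commuting with \<open>v\<close> keeps \<open>w\<close> out of \<open>Phi\<close> and out
    of its centralizer.\<close>
  have wPhi: "w \<notin> Phi" using lin_cent_Phi[OF v] wv unfolding cent_iff by metis
  have wcP: "w \<notin> cent Phi" using lin_Phi[OF v] wv unfolding cent_iff by blast
  obtain y g a where y: "y \<in> C" "g \<in> carrier G" "a \<in> Y" "kap y g = w \<otimes> a"
    using kap_of_Quad[OF w(1,2) wcP] wPhi by blast
  have "w \<otimes> a \<in> Phi" using Phi_kap[OF C_carrier[OF y(1)] y(2)] y(4) by simp
  then have "(w \<otimes> a) \<otimes> inv a \<in> Phi"
    using subgroup.m_closed[OF Phi_sub _ subgroup.m_inv_closed[OF Phi_sub Y_Phi[OF y(3)]]] by blast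
  then show False using wPhi Quad_carrier[OF w(1)] Y_carrier[OF y(3)] by (simp add: m_assoc)
qed

end

section \<open>The required properties of \<open>\<gamma>_3(G)G^p\<close>\<close>

context group
begin

lemma generate_cj:
  assumes S: "S \<subseteq> carrier G" "\<And>g s. g \<in> carrier G \<Longrightarrow> s \<in> S \<Longrightarrow> cj g s \<in> S"
    and g: "g \<in> carrier G" and x: "x \<in> generate G S"
  shows "cj g x \<in> generate G S"
  using x
proof induction
  case one
  show ?case using g generate.one by simp
next
  case (incl s)
  show ?case by (rule generate.incl[OF S(2)[OF g incl]])
next
  case (inv s)
  have "cj g (inv s) = inv (cj g s)" using S(1) inv g by (intro cj_inv) auto
  then show ?case using generate.inv[OF S(2)[OF g inv]] by simp
next
  case (eng a b)
  have "a \<in> carrier G" "b \<in> carrier G" using eng S(1) generate_in_carrier by auto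
  then show ?case using eng.IH g by (simp add: cj_mult generate.eng)
qed

lemma commutator_gens_carrier:
  "A \<subseteq> carrier G \<Longrightarrow> B \<subseteq> carrier G \<Longrightarrow>
   (\<Union>a \<in> A. \<Union>b \<in> B. {a \<otimes> b \<otimes> inv a \<otimes> inv b}) \<subseteq> carrier G"
  by blast

lemma commutator_subgroup_cj:
  assumes A: "A \<subseteq> carrier G" "\<And>g a. g \<in> carrier G \<Longrightarrow> a \<in> A \<Longrightarrow> cj g a \<in> A"
    and g: "g \<in> carrier G" and x: "x \<in> commutator_subgroup G A (carrier G)"
  shows "cj g x \<in> commutator_subgroup G A (carrier G)"
  unfolding commutator_subgroup_def
proof (rule generate_cj[OF _ _ g x[unfolded commutator_subgroup_def]])
  show "(\<Union>a \<in> A. \<Union>b \<in> carrier G. {a \<otimes> b \<otimes> inv a \<otimes> inv b}) \<subseteq> carrier G" using A by blast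
  fix h s assume h: "h \<in> carrier G" and "s \<in> (\<Union>a \<in> A. \<Union>b \<in> carrier G. {a \<otimes> b \<otimes> inv a \<otimes> inv b})"
  then obtain a b where ab: "a \<in> A" "b \<in> carrier G" "s = a \<otimes> b \<otimes> inv a \<otimes> inv b" by blast
  have ac: "a \<in> carrier G" using ab A by blast
  have "cj h s = cj h a \<otimes> cj h b \<otimes> inv (cj h a) \<otimes> inv (cj h b)"
    unfolding ab(3) using ac ab(2) h by (simp add: cj_mult cj_inv)
  moreover have "cj h a \<in> A" "cj h b \<in> carrier G" using A(2)[OF h ab(1)] h ab(2) by auto
  ultimately show "cj h s \<in> (\<Union>a \<in> A. \<Union>b \<in> carrier G. {a \<otimes> b \<otimes> inv a \<otimes> inv b})" by blast
qed

lemma pow_subgroup_cj: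
  assumes g: "g \<in> carrier G" and x: "x \<in> power_subgroup G p"
  shows "cj g x \<in> power_subgroup G p"
  unfolding power_subgroup_def
proof (rule generate_cj[OF _ _ g x[unfolded power_subgroup_def]])
  show "{a [^] p | a. a \<in> carrier G} \<subseteq> carrier G" by auto
  fix h s assume h: "h \<in> carrier G" and "s \<in> {a [^] p | a. a \<in> carrier G}"
  then obtain a where a: "a \<in> carrier G" "s = a [^] p" by blast
  have "cj h s = cj h a [^] p" unfolding a(2) by (rule cj_pow[OF h a(1)])
  then show "cj h s \<in> {a [^] p | a. a \<in> carrier G}" using cj_closed[OF h a(1)] by blast
qed

lemma subgroup_normal_mult:
  assumes H: "subgroup H G" and K: "subgroup K G" and Kn: "\<And>g k. g \<in> carrier G \<Longrightarrow> k \<in> K \<Longrightarrow> cj g k \<in> K"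
  shows "subgroup (H <#> K) G"
proof (rule subgroupI)
  have Hc: "a \<in> carrier G" if "a \<in> H" for a using H that by (rule subgroup.mem_carrier)
  have Kc: "a \<in> carrier G" if "a \<in> K" for a using K that by (rule subgroup.mem_carrier)
  show "H <#> K \<subseteq> carrier G" using Hc Kc by (auto simp: set_mult_def)
  show "H <#> K \<noteq> {}" using subgroup.one_closed[OF H] subgroup.one_closed[OF K] by (auto simp: set_mult_def)
  fix x assume "x \<in> H <#> K"
  then obtain a b where x: "x = a \<otimes> b" "a \<in> H" "b \<in> K" by (auto simp: set_mult_def)
  have ac: "a \<in> carrier G" "b \<in> carrier G" using x Hc Kc by auto
  have "inv x = inv a \<otimes> cj (inv a) (inv b)" unfolding x(1) using ac by (simp add: cj_def group_word)
  moreover have "inv a \<in> H" "cj (inv a) (inv b) \<in> K"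
    using subgroup.m_inv_closed[OF H x(2)] Kn[OF inv_closed[OF ac(1)] subgroup.m_inv_closed[OF K x(3)]] by auto
  ultimately show "inv x \<in> H <#> K" unfolding set_mult_def by blast
  fix y assume "y \<in> H <#> K"
  then obtain c d where y: "y = c \<otimes> d" "c \<in> H" "d \<in> K" by (auto simp: set_mult_def)
  have cc: "c \<in> carrier G" "d \<in> carrier G" using y Hc Kc by auto
  have "x \<otimes> y = (a \<otimes> c) \<otimes> (cj c b \<otimes> d)" unfolding x(1) y(1) using ac cc by (simp add: cj_def group_word)
  moreover have "a \<otimes> c \<in> H" "cj c b \<otimes> d \<in> K"
    using subgroup.m_closed[OF H x(2) y(2)] subgroup.m_closed[OF K Kn[OF cc(1) x(3)] y(3)] by auto
  ultimately show "x \<otimes> y \<in> H <#> K" unfolding set_mult_def by blast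
qed

text \<open>The elements that are central modulo the normal subgroup \<open>N\<close> form a
  subgroup, so it is enough to look at generators.\<close>

lemma frattini_kap:
  assumes N: "subgroup N G" and Nn: "\<And>g n. g \<in> carrier G \<Longrightarrow> n \<in> N \<Longrightarrow> cj g n \<in> N"
    and gens: "\<And>s g. s \<in> S \<Longrightarrow> g \<in> carrier G \<Longrightarrow> kap s g \<in> N" and S: "S \<subseteq> carrier G"
    and x: "x \<in> generate G S" and g: "g \<in> carrier G"
  shows "kap x g \<in> N"
  using x g
proof (induction arbitrary: g)
  case one
  then show ?case using subgroup.one_closed[OF N] by (simp add: kap_def)
next
  case (incl s)
  then show ?case by (rule gens)
next
  case (inv s)
  have "s \<in> carrier G" using inv S by auto
  then have "kap (inv s) g = inv (cj s (kap s g))" using inv by (simp add: kap_def cj_def group_word)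
  then show ?case using subgroup.m_inv_closed[OF N Nn[OF \<open>s \<in> carrier G\<close> gens]] inv by simp
next
  case (eng a b)
  have ab: "a \<in> carrier G" "b \<in> carrier G" using eng S generate_in_carrier by auto
  have "kap (a \<otimes> b) g = kap a g \<otimes> cj (inv a) (kap b g)"
    using ab eng by (simp add: kap_def cj_def group_word)
  then show ?case using subgroup.m_closed[OF N eng.IH(1) Nn[OF inv_closed[OF ab(1)] eng.IH(2)]] eng by simp
qed

end

lemma (in group) ex_noninner_automorphism:
  fixes p :: nat
  assumes p: "Factorial_Ring.prime p" and odd: "odd p" and pG: "p_group G p" and nab: "\<not> comm_group G"
    and cyc: "cyclic_group (subgroup_generated G (grp_center G))"
    and large: "\<not> grp_centralizer G (lower_central G 3 <#> power_subgroup G p) \<subseteq> lower_central G 3 <#> power_subgroup G p"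
  shows "\<exists>\<phi> \<in> auto G. \<not> inner_automorphism G \<phi> \<and> group.ord (AutoGroup G) \<phi> = p"
proof (rule ccontr)
  assume no: "\<not> ?thesis"
  define H where "H = lower_central G 3"
  define K where "K = power_subgroup G p"
  define D where "D = commutator_subgroup G (carrier G) (carrier G)"
  have He: "H = commutator_subgroup G D (carrier G)" by (simp add: H_def D_def numeral_3_eq_3)
  have pk: "{a [^] p | a. a \<in> carrier G} \<subseteq> carrier G" by auto
  have Ds: "subgroup D G" unfolding D_def commutator_subgroup_def
    by (rule generate_is_subgroup[OF commutator_gens_carrier]) auto
  have Dc: "D \<subseteq> carrier G" by (rule subgroup.subset[OF Ds])
  have Hs: "subgroup H G" unfolding He commutator_subgroup_def
    by (rule generate_is_subgroup[OF commutator_gens_carrier[OF Dc subset_refl]])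
  have Ks: "subgroup K G" unfolding K_def power_subgroup_def by (rule generate_is_subgroup[OF pk])
  have Dn: "cj g d \<in> D" if "g \<in> carrier G" "d \<in> D" for g d
    using commutator_subgroup_cj[OF subset_refl cj_closed that(1)] that unfolding D_def by blast
  have Hn: "cj g d \<in> H" if "g \<in> carrier G" "d \<in> H" for g d
    using commutator_subgroup_cj[OF Dc Dn that(1)] that unfolding He by blast
  have Kn: "cj g d \<in> K" if "g \<in> carrier G" "d \<in> K" for g d
    using pow_subgroup_cj[OF that(1)] that unfolding K_def by blast
  have Ns: "subgroup (H <#> K) G" by (rule subgroup_normal_mult[OF Hs Ks Kn])
  have HN: "x \<in> H <#> K" if "x \<in> H" for x
  proof -
    have "x = x \<otimes> \<one>" using subgroup.mem_carrier[OF Hs that] by simp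
    then show ?thesis using that subgroup.one_closed[OF Ks] unfolding set_mult_def by blast
  qed
  have KN: "x \<in> H <#> K" if "x \<in> K" for x
  proof -
    have "x = \<one> \<otimes> x" using subgroup.mem_carrier[OF Ks that] by simp
    then show ?thesis using that subgroup.one_closed[OF Hs] unfolding set_mult_def by blast
  qed
  have Nn: "cj g x \<in> H <#> K" if g: "g \<in> carrier G" and x: "x \<in> H <#> K" for g x
  proof -
    obtain a b where ab: "x = a \<otimes> b" "a \<in> H" "b \<in> K" using x by (auto simp: set_mult_def)
    have "cj g x = cj g a \<otimes> cj g b" unfolding ab(1)
      by (rule cj_mult[OF g subgroup.mem_carrier[OF Hs ab(2)] subgroup.mem_carrier[OF Ks ab(3)]])
    then show ?thesis using Hn[OF g ab(2)] Kn[OF g ab(3)] unfolding set_mult_def by blast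
  qed
  have pK: "a [^] p \<in> K" if "a \<in> carrier G" for a
    unfolding K_def power_subgroup_def using that by (intro generate.incl) blast
  have cD: "a \<otimes> b \<otimes> inv a \<otimes> inv b \<in> D" if "a \<in> carrier G" "b \<in> carrier G" for a b
    unfolding D_def commutator_subgroup_def using that by (intro generate.incl) blast
  have cH: "a \<otimes> b \<otimes> inv a \<otimes> inv b \<in> H" if "a \<in> D" "b \<in> carrier G" for a b
    unfolding He commutator_subgroup_def using that by (intro generate.incl) blast
  have fg: "frattini_gens p \<subseteq> carrier G" by (auto simp: frattini_gens_def)
  have gens: "kap s g \<in> H <#> K" if s: "s \<in> frattini_gens p" and g: "g \<in> carrier G" for s g
  proof -
    consider a b where "a \<in> carrier G" "b \<in> carrier G" "s = a \<otimes> b \<otimes> inv a \<otimes> inv b"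
      | a where "a \<in> carrier G" "s = a [^] p"
      using s unfolding frattini_gens_def by blast
    then show ?thesis
    proof cases
      case 1
      then have sD: "s \<in> D" using cD by blast
      then have sc: "s \<in> carrier G" using Dc by blast
      have "kap s g = inv (s \<otimes> inv g \<otimes> inv s \<otimes> inv (inv g))" using sc g by (simp add: kap_def group_word)
      then show ?thesis using HN[OF subgroup.m_inv_closed[OF Hs cH[OF sD inv_closed[OF g]]]] by simp
    next
      case 2
      have "kap s g = cj g a [^] p \<otimes> inv (a [^] p)"
        unfolding 2(2) cj_pow[OF g 2(1), symmetric] by (simp add: kap_def cj_def)
      also have "\<dots> \<in> K"
        by (rule subgroup.m_closed[OF Ks pK[OF cj_closed[OF g 2(1)]] subgroup.m_inv_closed[OF Ks pK[OF 2(1)]]])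
      finally show ?thesis by (rule KN)
    qed
  qed
  have Nle: "H <#> K \<subseteq> generate G (frattini_gens p)"
  proof -
    have P: "subgroup (generate G (frattini_gens p)) G" by (rule generate_is_subgroup[OF fg])
    have "H \<subseteq> generate G (frattini_gens p)" unfolding He commutator_subgroup_def
      by (rule generate_subgroup_incl[OF _ P])
        (use Dc in \<open>auto simp: frattini_gens_def intro!: generate.incl\<close>)
    moreover have "K \<subseteq> generate G (frattini_gens p)" unfolding K_def power_subgroup_def
      by (rule generate_subgroup_incl[OF _ P]) (auto simp: frattini_gens_def intro!: generate.incl)
    ultimately show ?thesis using subgroup.m_closed[OF P] by (auto simp: set_mult_def)
  qed
  obtain m where m: "p = Suc (2 * m)" using odd by (auto elim: oddE)
  \<comment> \<open>With \<open>p = 2 * m + 1\<close> the number \<open>m + 1\<close> is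
    \<open>(p + 1) / 2\<close>, one half modulo \<open>p\<close>.\<close>
  have half: "[2 * (int m + 1) = 1] (mod int p)" by (simp add: m cong_iff_dvd_diff)
  have Zs: "subgroup (grp_center G) G"
    by (rule center_subgroup)
  have cZ: "carrier (subgroup_generated G (grp_center G)) = grp_center G"
    by (rule subgroup.carrier_subgroup_generated_subgroup[OF Zs])
  interpret Zg: group "subgroup_generated G (grp_center G)" by (rule group_subgroup_generated)
  obtain \<zeta> where \<zeta>: "\<zeta> \<in> grp_center G"
    and r: "grp_center G = range (\<lambda>i::int. \<zeta> [^]\<^bsub>subgroup_generated G (grp_center G)\<^esub> i)"
    using cyc unfolding Zg.cyclic_group cZ by blast
  have "\<zeta> [^]\<^bsub>subgroup_generated G (grp_center G)\<^esub> i = \<zeta> [^] i" for i :: int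
    by (rule int_pow_subgroup_generated) (simp only: cZ \<zeta>)
  then have \<zeta>r: "grp_center G = range (\<lambda>i::int. \<zeta> [^] i)" using r by simp
  have \<zeta>c: "\<zeta> \<in> carrier G" using \<zeta> by (simp add: grp_center_def)
  have nc: "\<exists>a \<in> carrier G. \<exists>b \<in> carrier G. a \<otimes> b \<noteq> b \<otimes> a"
    using nab group_comm_groupI by blast
  have P: "finite (carrier G)" "\<exists>n. card (carrier G) = p ^ n" using pG by (auto simp: p_group_def)
  have noninn: "inner_automorphism G \<phi>" if "\<phi> \<in> auto G" "group.ord (AutoGroup G) \<phi> = p" for \<phi>
    using no that by blast
  have Npow: "g [^] p \<in> H <#> K" if "g \<in> carrier G" for g by (rule KN[OF pK[OF that]])
  have Nkap: "kap x g \<in> H <#> K" if "x \<in> generate G (frattini_gens p)" "g \<in> carrier G" for x g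
    by (rule frattini_kap[OF Ns Nn gens fg that])
  have large': "\<not> grp_centralizer G (H <#> K) \<subseteq> H <#> K" using large by (simp only: H_def K_def not_False_eq_True)
  have "large_centralizer G p \<zeta> (H <#> K) (int m + 1)"
    by (intro large_centralizer.intro only_inner.intro large_centralizer_axioms.intro only_inner_axioms.intro;
      fact group_axioms p odd half P nc \<zeta>c \<zeta>r noninn Ns Nn Npow Nle Nkap large')
  then show False by (rule large_centralizer.contradiction)
qed

theorem theorem5p1:
  fixes G :: "('a, 'b) monoid_scheme" and p :: nat
  assumes "group G"
    and "Factorial_Ring.prime p" and "odd p"
    and "p_group G p"
    and "\<not> comm_group G"
    and "cyclic_group (subgroup_generated G (grp_center G))"
    and "\<not> grp_centralizer G (lower_central G 3 <#>\<^bsub>G\<^esub> power_subgroup G p)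
            \<subseteq> lower_central G 3 <#>\<^bsub>G\<^esub> power_subgroup G p"
  shows "\<exists>\<phi> \<in> auto G. \<not> inner_automorphism G \<phi> \<and> group.ord (AutoGroup G) \<phi> = p"
  using group.ex_noninner_automorphism[OF assms] .

end
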